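(* Let $f(z)=\sum_{k=0}^\infty a_k z^k$ with $\{a_k\}_{k\ge 0}$ i.i.d. real standard Gaussian random variables, and for $0<r<1$ let $N_r$ be the number of real zeros of $f$ in the interval $[-r,r]$. Then $$E N_r=\frac1\pi\log\frac{1+r}{1-r}\quad(0<r<1),\qquad \mathrm{Var}\,N_r=2\left(1-\frac2\pi\right)E N_r+O(1)\quad\text{as } r\to1.$$
   Context: The series $f$ converges almost surely on the open unit disc. *)

theory Defs
  imports "HOL-Probability.Probability" "HOL-Library.Landau_Symbols"
begin

definition iid_std_gaussian :: "'w measure \<Rightarrow> (nat \<Rightarrow> 'w \<Rightarrow> real) \<Rightarrow> bool" where
  "iid_std_gaussian M a \<longleftrightarrow>
     prob_space.indep_vars M (\<lambda>_. borel) a UNIV \<and>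
     (\<forall>k. distributed M lborel (a k) std_normal_density)"

definition random_series :: "(nat \<Rightarrow> 'w \<Rightarrow> real) \<Rightarrow> 'w \<Rightarrow> complex \<Rightarrow> complex" where
  "random_series a \<omega> z = (\<Sum>k. of_real (a k \<omega>) * z ^ k)"

definition converges_on_disc :: "(nat \<Rightarrow> 'w \<Rightarrow> real) \<Rightarrow> 'w \<Rightarrow> bool" where
  "converges_on_disc a \<omega> \<longleftrightarrow>
     (\<forall>z::complex. norm z < 1 \<longrightarrow> summable (\<lambda>k. of_real (a k \<omega>) * z ^ k))"

definition real_zeros :: "(nat \<Rightarrow> 'w \<Rightarrow> real) \<Rightarrow> real \<Rightarrow> 'w \<Rightarrow> real set" where
  "real_zeros a r \<omega> = {x \<in> {-r..r}. random_series a \<omega> (of_real x) = 0}"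

text \<open>
  The number of distinct real zeros in \<open>[-r, r]\<close>. The series is a function on the disc only
  almost surely; off the convergence event the count is set to 0. There, \<open>suminf\<close> of a divergent
  series is an unspecified constant, whose zeros have no meaning. Also, \<open>card\<close> of an infinite
  set is 0, so a user of this count has to know that \<open>real_zeros\<close> is almost surely finite.
\<close>
definition num_real_zeros :: "(nat \<Rightarrow> 'w \<Rightarrow> real) \<Rightarrow> real \<Rightarrow> 'w \<Rightarrow> real" where
  "num_real_zeros a r \<omega> =
     (if converges_on_disc a \<omega> then real (card (real_zeros a r \<omega>)) else 0)"

end

theory Submission imports Defs begin

text \<open>
  In the coordinate \<open>x = tanh u\<close> the normalised series \<open>X u = sech u * f (tanh u)\<close> is a stationary
  Gaussian process with covariance \<open>sech (u - v)\<close>. Every count of sign changes along a grid has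
  moments that are determined by the sign correlations, and these are explicit: with
  \<open>A x = arcsin (sech x)\<close>, the two-point correlation is \<open>2 / pi * A (u2 - u1)\<close>, and for
  \<open>u1 < u2 < u3 < u4\<close> the four-point correlation is the Pfaffian
  \<open>4 / pi\<^sup>2 * (A12 * A34 - A13 * A24 + A14 * A23)\<close> (Matsumoto and Shirai). It is obtained by
  differentiating in \<open>u4\<close>: conditioning on \<open>X u4 = 0\<close> multiplies the process by \<open>tanh (u - u4)\<close>, so that
  the derivative is an expectation of \<open>sgn (X u1) * sgn (X u2) * sgn (X u3)\<close> against a linear form, which a
  Gaussian integration by parts reduces to two-point correlations.

  The zeros are almost surely simple, so the number of sign changes on finer and finer grids converges
  to the number of zeros from below, and so do the first two moments. The variance of the
  grid counts is a sum of second differences; its limit is a closed form of \<open>A\<close> and \<open>ln (cosh L)\<close>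
  with \<open>L = ln ((1 + r) / (1 - r))\<close>.
\<close>

subsection \<open>The limit of the grid variance\<close>

text \<open>The four-point formula closes because \<open>sech (u i - u j)\<close> is a Cauchy matrix
  up to diagonal factors: its inverse is again a \<open>sech\<close> matrix, up to diagonal factors
  and alternating signs. So the density of three values has the shape of the covariance itself,
  integration by parts leaves a two-point integral, and conditioning on a fourth zero is a mere
  dilation of coordinates. All factors \<open>tanh (u4 - u i)\<close> cancel in the derivative, and
  what is left is \<open>sech\<close>, whose primitive is \<open>- gd_co\<close>. Constants: a cell
  of length h carries a sign change with probability \<open>1 / 2 - gd_co h / pi\<close>, about h /
  pi, so the mean tends to L / pi. In the variance the diagonal gives L / pi again and the pairs of
  cells give \<open>2 / pi\<^sup>2 * var_fun L\<close>. As \<open>var_fun\<close> has slope pi / 2 -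
  2 at infinity, the coefficient of L is 1 / pi + (2 / pi^2) (pi / 2 - 2) = 2 (1 - 2 / pi) / pi. The
  limit of the second moments needs a dominating variable. It is the square of the zero count
  itself, whose integrability has to be obtained first, by Fatou's lemma.\<close>

text \<open>For \<open>x \<ge> 0\<close> this is \<open>arcsin (sech x)\<close>, the complement of the Gudermannian function.\<close>

definition gd_co :: "real \<Rightarrow> real" where
  "gd_co x = 2 * arctan (exp (- x))"

lemma gd_co_0 [simp]: "gd_co 0 = pi / 2"
  by (simp add: gd_co_def arctan_one)

lemma gd_co_pos: "0 < gd_co x"
  by (simp add: gd_co_def)

lemma gd_co_le: "0 \<le> x \<Longrightarrow> gd_co x \<le> pi / 2"
  using arctan_monotone'[of "exp (- x)" 1] by (simp add: gd_co_def arctan_one)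

lemma gd_co_has_derivative [derivative_intros]:
  assumes "(g has_real_derivative D) (at x within S)"
  shows "((\<lambda>x. gd_co (g x)) has_real_derivative - D / cosh (g x)) (at x within S)"
proof -
  have *: "(gd_co has_real_derivative - 1 / cosh y) (at y)" for y
  proof -
    have "(gd_co has_real_derivative 2 * (inverse (1 + (exp (- y))\<^sup>2) * (- exp (- y)))) (at y)"
      unfolding gd_co_def by (auto intro!: derivative_eq_intros simp: mult_ac)
    also have "2 * (inverse (1 + (exp (- y))\<^sup>2) * (- exp (- y))) = - 1 / cosh y"
    proof -
      have p: "1 + (exp (- y))\<^sup>2 > 0"
        by (simp add: add_pos_nonneg)
      have "exp y * exp (- y) = 1"
        by (simp flip: exp_add)
      then have "exp (- y) * cosh y = (1 + (exp (- y))\<^sup>2) / 2"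
        by (simp add: cosh_def power2_eq_square field_simps)
      then show ?thesis
        using p cosh_real_pos[of y] by (simp add: field_simps)
    qed
    finally show ?thesis .
  qed
  from DERIV_chain2[OF * assms] show ?thesis by simp
qed

lemma sech_has_derivative:
  "((\<lambda>x::real. 1 / cosh x) has_real_derivative - sinh x / (cosh x)\<^sup>2) (at x)"
  by (auto intro!: derivative_eq_intros simp: power2_eq_square)

lemma sech_le_1: "1 / cosh x \<le> (1::real)"
  using cosh_real_ge_1[of x] by simp

lemma abs_sinh_le_cosh: "\<bar>sinh x\<bar> \<le> cosh (x::real)"
  by (simp add: sinh_def cosh_def abs_if exp_minus field_simps)

lemma lipschitz_of_deriv:
  fixes g :: "real \<Rightarrow> real"
  assumes "\<And>x. (g has_real_derivative g' x) (at x)" "\<And>x. \<bar>g' x\<bar> \<le> B"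
  shows "\<bar>g x - g y\<bar> \<le> B * \<bar>x - y\<bar>"
  using field_differentiable_bound[of UNIV g g' B x y] assms by auto

lemma gd_co_lipschitz: "\<bar>gd_co x - gd_co y\<bar> \<le> \<bar>x - y\<bar>"
  using lipschitz_of_deriv[of gd_co "\<lambda>x. - 1 / cosh x" 1 x y]
    gd_co_has_derivative[OF DERIV_ident] sech_le_1 by (simp add: abs_if)

lemma abs_sech_deriv_le_1: "\<bar>sinh x / (cosh x)\<^sup>2\<bar> \<le> (1::real)"
proof -
  have "\<bar>sinh x\<bar> \<le> cosh x * cosh x"
    using abs_sinh_le_cosh[of x] cosh_real_ge_1[of x] mult_left_mono[of 1 "cosh x" "cosh x"] by linarith
  then show ?thesis
    by (simp add: power2_eq_square)
qed

lemma sech_lipschitz: "\<bar>1 / cosh x - 1 / cosh y\<bar> \<le> \<bar>x - (y::real)\<bar>"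
proof -
  have "\<bar>1 / cosh x - 1 / cosh y\<bar> \<le> 1 * \<bar>x - y\<bar>"
    using abs_sech_deriv_le_1
    by (intro lipschitz_of_deriv[of "\<lambda>x. 1 / cosh x", OF sech_has_derivative]) simp
  then show ?thesis by simp
qed

text \<open>Chosen such that the second derivative is \<open>A * A'' - A'\<^sup>2\<close> for \<open>A = gd_co\<close>, up to a factor the
  covariance density of sign changes at distance \<open>x\<close>.\<close>

definition var_fun :: "real \<Rightarrow> real" where
  "var_fun x = (gd_co x)\<^sup>2 / 2 - pi\<^sup>2 / 8 + pi / 2 * x - 2 * ln (cosh x)"

definition var_fun' :: "real \<Rightarrow> real" where
  "var_fun' x = - gd_co x / cosh x + pi / 2 - 2 * tanh x"

definition var_fun'' :: "real \<Rightarrow> real" where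
  "var_fun'' x = gd_co x * (sinh x / (cosh x)\<^sup>2) - (1 / cosh x)\<^sup>2"

text \<open>Since (A^2 / 2)'' = A A'' + A'^2, the term \<open>- 2 * ln (cosh x)\<close> supplies the
  missing - 2 A'^2. The terms \<open>- pi\<^sup>2 / 8\<close> and \<open>pi / 2 * x\<close> are
  integration constants that make value and slope vanish at 0; the slope matters because the sum
  over the grid leaves the boundary term \<open>L * (var_fun h / h)\<close>.\<close>

lemma var_fun_0 [simp]: "var_fun 0 = 0"
  by (simp add: var_fun_def power2_eq_square)

lemma var_fun'_0 [simp]: "var_fun' 0 = 0"
  by (simp add: var_fun'_def)

lemma DERIV_var_fun: "(var_fun has_real_derivative var_fun' x) (at x)"
  unfolding var_fun_def var_fun'_def
  using cosh_real_pos[of x] by (auto intro!: derivative_eq_intros simp: tanh_def field_simps)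

lemma DERIV_var_fun': "(var_fun' has_real_derivative var_fun'' x) (at x)"
proof -
  have c: "cosh x \<noteq> 0"
    using cosh_real_pos[of x] by simp
  have "((\<lambda>x. - (gd_co x * (1 / cosh x)) + pi / 2 - 2 * tanh x) has_real_derivative
      - (gd_co x * (- sinh x / (cosh x)\<^sup>2) + (- 1 / cosh x) * (1 / cosh x)) - 2 * (1 - (tanh x)\<^sup>2)) (at x)"
    by (rule derivative_eq_intros sech_has_derivative refl c | simp)+
  also have eq: "1 - (tanh x)\<^sup>2 = (1 / cosh x)\<^sup>2"
    using c hyperbolic_pythagoras[of x] by (simp add: tanh_def divide_simps power_divide)
  finally show ?thesis
    by (simp add: var_fun'_def[abs_def] var_fun''_def power2_eq_square)
qed

text \<open>As functions of h both sides agree at 0 together with their first derivatives. In the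
  second derivative of the difference, everything combines into a product of two increments minus a
  square, which is O(h); two integrations give the cube.\<close>

lemma var_fun_second_diff:
  assumes h: "0 \<le> h" "h \<le> 1"
  shows "\<bar>var_fun (x + h) - 2 * var_fun x + var_fun (x - h)
           - (gd_co (x + h) * gd_co (x - h) - (gd_co x)\<^sup>2)\<bar> \<le> 8 * h ^ 3"
proof -
  define f0 where "f0 t = var_fun (x + t) - 2 * var_fun x + var_fun (x - t)
           - (gd_co (x + t) * gd_co (x - t) - (gd_co x)\<^sup>2)" for t
  define f1 where "f1 t = var_fun' (x + t) - var_fun' (x - t)
           - (gd_co (x + t) / cosh (x - t) - gd_co (x - t) / cosh (x + t))" for t
  define S where "S y = 1 / cosh y" for y :: real
  \<comment> \<open>\<open>S'\<close> is minus the derivative of \<open>S\<close>, that is, the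
    second derivative of \<open>gd_co\<close>.\<close>
  define S' where "S' y = sinh y / (cosh y)\<^sup>2" for y :: real
  define f2 where "f2 t = (S' (x + t) - S' (x - t)) * (gd_co (x + t) - gd_co (x - t))
           - (S (x + t) - S (x - t))\<^sup>2" for t
  have d0: "(f0 has_real_derivative f1 t) (at t)" for t
    unfolding f0_def f1_def
    by (auto intro!: derivative_eq_intros DERIV_chain2[OF DERIV_var_fun] simp: field_simps)
  have d1: "(f1 has_real_derivative f2 t) (at t)" for t
  proof -
    have *: "f1 = (\<lambda>t. var_fun' (x + t) - var_fun' (x - t)
           - (gd_co (x + t) * S (x - t) - gd_co (x - t) * S (x + t)))"
      by (simp add: f1_def S_def fun_eq_iff)
    have dS: "(S has_real_derivative - S' y) (at y)" for y
      unfolding S_def S'_def using sech_has_derivative[of y] by simp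
    have W: "var_fun'' y = gd_co y * S' y - (S y)\<^sup>2" for y
      by (simp add: var_fun''_def S_def S'_def)
    have dA: "(gd_co has_real_derivative - S y) (at y)" for y
      using gd_co_has_derivative[OF DERIV_ident, of y] by (simp add: S_def)
    show ?thesis
      unfolding * f2_def
      by (rule derivative_eq_intros DERIV_chain2[OF DERIV_var_fun'] DERIV_chain2[OF dS] DERIV_chain2[OF dA] refl)+
         (simp add: W algebra_simps power2_eq_square)
  qed
  have b2: "\<bar>f2 t\<bar> \<le> 8 * t" if t: "0 \<le> t" "t \<le> 1" for t
  proof -
    have "\<bar>S' (x + t) - S' (x - t)\<bar> \<le> 2"
      using abs_sech_deriv_le_1[of "x+t"] abs_sech_deriv_le_1[of "x-t"] unfolding S'_def by linarith
    moreover have "\<bar>gd_co (x + t) - gd_co (x - t)\<bar> \<le> 2 * t"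
      using gd_co_lipschitz[of "x+t" "x-t"] t by simp
    ultimately have "\<bar>(S' (x + t) - S' (x - t)) * (gd_co (x + t) - gd_co (x - t))\<bar> \<le> 2 * (2 * t)"
      unfolding abs_mult by (intro mult_mono) auto
    moreover have "\<bar>S (x + t) - S (x - t)\<bar> \<le> 2 * t"
      using sech_lipschitz[of "x+t" "x-t"] t by (simp add: S_def)
    then have "(S (x + t) - S (x - t))\<^sup>2 \<le> (2 * t)\<^sup>2"
      by (metis abs_ge_zero power2_abs power_mono)
    moreover have "(2 * t)\<^sup>2 \<le> 4 * t"
      using t by (simp add: power2_eq_square mult_left_le)
    ultimately show ?thesis
      unfolding f2_def using zero_le_power2[of "S (x + t) - S (x - t)"] by linarith
  qed
  have b1: "\<bar>f1 t\<bar> \<le> 8 * h * h" if t: "0 \<le> t" "t \<le> h" for t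
  proof -
    have "\<bar>f1 t - f1 0\<bar> \<le> 8 * h * \<bar>t - 0\<bar>"
    proof -
      have "\<bar>f2 z\<bar> \<le> 8 * h" if "0 \<le> z" "z \<le> h" for z
        using b2[of z] that h by simp
      then show ?thesis
        using field_differentiable_bound[of "{0..h}" f1 f2 "8*h" t 0] d1 t h
        by (auto intro: has_field_derivative_at_within)
    qed
    also have "\<dots> \<le> 8 * h * h"
      using t h by (simp add: mult_left_mono)
    finally show ?thesis
      by (simp add: f1_def)
  qed
  have "\<bar>f0 h - f0 0\<bar> \<le> 8 * h * h * \<bar>h - 0\<bar>"
    using field_differentiable_bound[of "{0..h}" f0 f1 "8*h*h" h 0] d0 b1 h
    by (auto intro: has_field_derivative_at_within)
  moreover have "f0 0 = 0"
    by (simp add: f0_def power2_eq_square)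
  ultimately show ?thesis
    using h unfolding f0_def by (simp add: power3_eq_cube)
qed

text \<open>Two summations by parts. Among m + 1 cells, the weight m - d is the number of pairs at
  lag d + 1.\<close>

lemma sum_weighted_second_diff:
  fixes w :: "nat \<Rightarrow> real"
  shows "(\<Sum>d<m. (real m - real d) * (w (Suc (Suc d)) - 2 * w (Suc d) + w d))
         = w (Suc m) - (real m + 1) * w 1 + real m * w 0"
proof (induction m)
  case (Suc m)
  have "(\<Sum>d<m. w (Suc (Suc d)) - 2 * w (Suc d) + w d) = w (Suc m) - w m - w 1 + w 0" for m
    by (induction m) auto
  from this[of "Suc m"] Suc show ?case
    by (simp add: algebra_simps sum.distrib sum_subtractf)
qed simp

text \<open>For \<open>var_fun\<close> the weighted second differences telescope to the two ends of
  the grid. The error of passing to them is at most \<open>8 * h ^ 3\<close> per term, with fewer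
  than m + 1 terms of weight at most m + 1; as (m + 1) h = L, it totals at most
  \<open>8 * L\<^sup>2 * h\<close>.\<close>

lemma var_fun_limit:
  assumes L: "0 < L"
  shows "(\<lambda>m. \<Sum>d<m. (real m - real d) *
             (gd_co (real (d + 2) * (L / Suc m)) * gd_co (real d * (L / Suc m))
              - (gd_co (real (d + 1) * (L / Suc m)))\<^sup>2)) \<longlonglongrightarrow> var_fun L"
proof -
  define h where "h m = L / Suc m" for m
  define D where "D m d = gd_co (real (d + 2) * h m) * gd_co (real d * h m)
      - (gd_co (real (d + 1) * h m))\<^sup>2" for m d
  define w where "w m d = var_fun (real d * h m)" for m d
  define E where "E m d = w m (Suc (Suc d)) - 2 * w m (Suc d) + w m d" for m d
  have h0: "h \<longlonglongrightarrow> 0"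
    unfolding h_def by (rule LIMSEQ_Suc[OF lim_const_over_n])
  have hpos: "0 < h m" for m
    using L by (simp add: h_def)
  have lim1: "(\<lambda>m. \<Sum>d<m. (real m - real d) * E m d) \<longlonglongrightarrow> var_fun L"
  proof -
    have eq: "(\<Sum>d<m. (real m - real d) * E m d) = var_fun L - L * (var_fun (h m) / h m)" for m
    proof -
      have "w m (Suc m) = var_fun L" "w m 1 = var_fun (h m)" "w m 0 = 0" "real m + 1 = L / h m"
        using L by (simp_all add: w_def h_def)
      then show ?thesis
        unfolding E_def sum_weighted_second_diff[of m "w m"] by simp
    qed
    have "((\<lambda>t. (var_fun (0 + t) - var_fun 0) / t) \<longlongrightarrow> 0) (at 0)"
      using DERIV_var_fun[of 0] by (simp add: DERIV_def)
    then have "((\<lambda>t. var_fun t / t) \<longlongrightarrow> 0) (at 0)"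
      by simp
    moreover have "filterlim h (at 0) sequentially"
      using h0 hpos by (auto simp: filterlim_at less_imp_neq[symmetric])
    ultimately have "(\<lambda>m. var_fun (h m) / h m) \<longlonglongrightarrow> 0"
      by (rule filterlim_compose)
    then have "(\<lambda>m. var_fun L - L * (var_fun (h m) / h m)) \<longlonglongrightarrow> var_fun L - L * 0"
      by (intro tendsto_intros)
    then show ?thesis
      by (simp add: eq)
  qed
  have "\<forall>\<^sub>F m in sequentially. h m < 1"
    using h0 by (auto dest: order_tendstoD(2)[where a = 1])
  then have "\<forall>\<^sub>F m in sequentially. norm ((\<Sum>d<m. (real m - real d) * E m d) - (\<Sum>d<m. (real m - real d) * D m d))
      \<le> 8 * L\<^sup>2 * h m"
  proof eventually_elim
    case (elim m)
    have "\<bar>E m d - D m d\<bar> \<le> 8 * h m ^ 3" for d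
      using var_fun_second_diff[of "h m" "real (d + 1) * h m"] elim hpos[of m]
      by (simp add: E_def D_def w_def algebra_simps)
    then have "\<bar>(real m - real d) * (E m d - D m d)\<bar> \<le> Suc m * (8 * h m ^ 3)" if "d < m" for d
      unfolding abs_mult using that by (intro mult_mono) auto
    then have "norm (\<Sum>d<m. (real m - real d) * (E m d - D m d)) \<le> (\<Sum>d<m. Suc m * (8 * h m ^ 3))"
      by (intro sum_norm_le) auto
    also have "\<dots> \<le> real (Suc m) * (Suc m * (8 * h m ^ 3))"
      using hpos[of m] by (simp add: mult_right_mono)
    also have "\<dots> = 8 * L\<^sup>2 * h m"
    proof -
      have "L = Suc m * h m"
        by (simp add: h_def)
      then show ?thesis
        by (simp only: power2_eq_square power3_eq_cube) simp
    qed
    finally show ?case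
      by (simp add: right_diff_distrib sum_subtractf)
  qed
  moreover have "(\<lambda>m. 8 * L\<^sup>2 * h m) \<longlonglongrightarrow> 0"
    using tendsto_mult_right_zero[OF h0] by simp
  ultimately have "(\<lambda>m. (\<Sum>d<m. (real m - real d) * E m d) - (\<Sum>d<m. (real m - real d) * D m d)) \<longlonglongrightarrow> 0"
    by (rule Lim_null_comparison)
  from tendsto_diff[OF lim1 this] show ?thesis
    by (simp add: D_def h_def)
qed

text \<open>A difference quotient of \<open>gd_co\<close> at 0, where the slope is -1. The bracket
  will be the probability of a sign change in one cell.\<close>

lemma gd_co_limit_0:
  assumes "0 < L"
  shows "(\<lambda>m. real (Suc m) * (1 / 2 - gd_co (L / Suc m) / pi)) \<longlonglongrightarrow> L / pi"
proof -
  define h where "h m = L / Suc m" for m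
  have "((\<lambda>t. (gd_co (0 + t) - gd_co 0) / t) \<longlongrightarrow> - 1) (at 0)"
    using gd_co_has_derivative[OF DERIV_ident, of 0 UNIV] by (simp add: DERIV_def)
  moreover have "h \<longlonglongrightarrow> 0"
    unfolding h_def by (rule LIMSEQ_Suc[OF lim_const_over_n])
  then have "filterlim h (at 0) sequentially"
    using assms by (auto simp: filterlim_at h_def)
  ultimately have "(\<lambda>m. (gd_co (0 + h m) - gd_co 0) / h m) \<longlonglongrightarrow> - 1"
    by (rule filterlim_compose)
  then have "(\<lambda>m. - (L / pi) * ((gd_co (0 + h m) - gd_co 0) / h m)) \<longlonglongrightarrow> - (L / pi) * (- 1)"
    by (intro tendsto_intros)
  also have "(\<lambda>m. - (L / pi) * ((gd_co (0 + h m) - gd_co 0) / h m)) =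
     (\<lambda>m. real (Suc m) * (1 / 2 - gd_co (h m) / pi))"
    using assms by (simp add: h_def fun_eq_iff field_simps)
  finally show ?thesis
    by (simp add: h_def)
qed

text \<open>\<open>gd_co\<close> stays in [0, pi / 2] and \<open>ln (cosh L)\<close> differs from L
  by at most \<open>ln 2\<close>; these two facts give the two constants.\<close>

lemma var_fun_asymp:
  assumes "0 \<le> L"
  shows "\<bar>var_fun L - (pi / 2 - 2) * L\<bar> \<le> pi\<^sup>2 / 8 + 2 * ln 2"
proof -
  have "(gd_co L)\<^sup>2 \<le> (pi / 2)\<^sup>2"
    using gd_co_le[OF assms] gd_co_pos[of L] by (intro power_mono) auto
  then have 1: "(gd_co L)\<^sup>2 / 2 \<le> pi\<^sup>2 / 8"
    by (simp add: power2_eq_square)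
  have "cosh L \<le> exp L"
    using assms by (simp add: cosh_def)
  then have 2: "ln (cosh L) \<le> L"
    using cosh_real_pos[of L] by (metis ln_exp ln_le_cancel_iff exp_gt_zero)
  have "exp L / 2 \<le> cosh L"
    by (simp add: cosh_def)
  then have "ln (exp L / 2) \<le> ln (cosh L)"
    using cosh_real_pos[of L] by (subst ln_le_cancel_iff) auto
  then have 3: "L - ln 2 \<le> ln (cosh L)"
    by (simp add: ln_div)
  have "0 \<le> (gd_co L)\<^sup>2 / 2"
    by simp
  moreover have "0 \<le> ln (2::real)" by simp
  moreover have eq: "var_fun L - (pi / 2 - 2) * L = (gd_co L)\<^sup>2 / 2 - pi\<^sup>2 / 8 + 2 * (L - ln (cosh L))"
    by (simp add: var_fun_def algebra_simps)
  ultimately show ?thesis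
    using 1 2 3 zero_le_power2[of pi] unfolding eq by (intro abs_leI; argo)
qed

subsection \<open>Gaussian sign integrals on the line and in the plane\<close>

text \<open>Dominated convergence for the difference quotients, which the mean value theorem bounds
  by \<open>g\<close>.\<close>

lemma DERIV_lebesgue_integral:
  fixes f f' :: "real \<Rightarrow> 'a \<Rightarrow> real"
  assumes \<delta>: "0 < \<delta>"
    and int: "\<And>x. \<bar>x - x0\<bar> < \<delta> \<Longrightarrow> integrable M (f x)"
    and deriv: "\<And>x w. \<bar>x - x0\<bar> < \<delta> \<Longrightarrow> w \<in> space M \<Longrightarrow> ((\<lambda>x. f x w) has_real_derivative f' x w) (at x)"
    and bound: "\<And>x w. \<bar>x - x0\<bar> < \<delta> \<Longrightarrow> w \<in> space M \<Longrightarrow> \<bar>f' x w\<bar> \<le> g w"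
    and g: "integrable M g"
  shows "((\<lambda>x. integral\<^sup>L M (f x)) has_real_derivative integral\<^sup>L M (f' x0)) (at x0)"
  unfolding DERIV_def tendsto_at_iff_sequentially
proof (intro allI impI, goal_cases)
  case (1 X)
  \<comment> \<open>The increments may leave the \<delta>-neighbourhood for finitely many n. There
    they are replaced by \<delta> / 2, so that the bound holds for every n.\<close>
  define h where "h n = (if \<bar>X n\<bar> < \<delta> then X n else \<delta> / 2)" for n
  have ev: "\<forall>\<^sub>F n in sequentially. \<bar>X n\<bar> < \<delta>"
    using 1(2) \<delta> by (auto simp: tendsto_iff dist_real_def)
  then have evh: "\<forall>\<^sub>F n in sequentially. h n = X n"
    by eventually_elim (simp add: h_def)
  have h0: "h \<longlonglongrightarrow> 0"
    using 1(2) tendsto_cong[OF evh] by simp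
  have hn: "h n \<noteq> 0" "\<bar>h n\<bar> < \<delta>" for n
    using 1(1) \<delta> by (auto simp: h_def)
  define q where "q n w = (f (x0 + h n) w - f x0 w) / h n" for n w
  have qint: "integrable M (q n)" for n
    unfolding q_def using int[of "x0 + h n"] int[of x0] hn[of n] \<delta> by auto
  have qlim: "(\<lambda>n. q n w) \<longlonglongrightarrow> f' x0 w" if w: "w \<in> space M" for w
  proof -
    have "((\<lambda>t. (f (x0 + t) w - f x0 w) / t) \<longlongrightarrow> f' x0 w) (at 0)"
      using deriv[of x0 w] w \<delta> by (simp add: DERIV_def)
    moreover have "filterlim h (at 0) sequentially"
      using h0 hn by (auto simp: filterlim_at)
    ultimately show ?thesis
      unfolding q_def by (rule filterlim_compose)
  qed
  have qb: "norm (q n w) \<le> g w" if w: "w \<in> space M" for n w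
  proof -
    have "norm (f (x0 + h n) w - f x0 w) \<le> g w * norm (x0 + h n - x0)"
    proof (rule field_differentiable_bound[of "ball x0 \<delta>" "\<lambda>x. f x w" "\<lambda>x. f' x w"])
      fix z assume "z \<in> ball x0 \<delta>"
      then have z: "\<bar>z - x0\<bar> < \<delta>"
        by (simp add: dist_real_def abs_minus_commute)
      show "((\<lambda>x. f x w) has_field_derivative f' z w) (at z within ball x0 \<delta>)"
        using deriv[OF z w] by (rule has_field_derivative_at_within)
      show "norm (f' z w) \<le> g w"
        using bound[OF z w] by simp
    qed (use hn[of n] \<delta> in \<open>simp_all add: dist_real_def\<close>)
    then have "\<bar>f (x0 + h n) w - f x0 w\<bar> \<le> g w * \<bar>h n\<bar>"
      by simp
    then show ?thesis
      using hn(1)[of n] by (simp add: q_def pos_divide_le_eq)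
  qed
  have meas: "f' x0 \<in> borel_measurable M"
    by (rule borel_measurable_LIMSEQ_real[OF qlim borel_measurable_integrable[OF qint]])
  have "(\<lambda>n. integral\<^sup>L M (q n)) \<longlonglongrightarrow> integral\<^sup>L M (f' x0)"
    by (rule integral_dominated_convergence[OF meas borel_measurable_integrable[OF qint] g])
       (intro AE_I2 qlim qb, assumption)+
  moreover have "integral\<^sup>L M (q n) = (integral\<^sup>L M (f (x0 + h n)) - integral\<^sup>L M (f x0)) / h n" for n
    unfolding q_def using int[of "x0 + h n"] int[of x0] hn[of n] \<delta> by simp
  ultimately have "(\<lambda>n. (integral\<^sup>L M (f (x0 + h n)) - integral\<^sup>L M (f x0)) / h n) \<longlonglongrightarrow> integral\<^sup>L M (f' x0)"
    by simp
  moreover have "\<forall>\<^sub>F n in sequentially. (integral\<^sup>L M (f (x0 + h n)) - integral\<^sup>L M (f x0)) / h n =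
     (integral\<^sup>L M (f (x0 + X n)) - integral\<^sup>L M (f x0)) / X n"
    using evh by eventually_elim simp
  ultimately show ?case
    by (simp add: tendsto_cong comp_def)
qed

interpretation std_normal: real_distribution std_normal_distribution
  by (rule real_dist_normal_dist)

lemma std_normal_density_uminus [simp]: "std_normal_density (- x) = std_normal_density x"
  by (simp add: std_normal_density_def)

lemma std_normal_density_le: "std_normal_density x \<le> 1 / sqrt (2 * pi)"
  by (simp add: std_normal_density_def field_simps)

lemma std_normal_density_le_half: "std_normal_density x \<le> 1 / 2"
proof -
  have "2\<^sup>2 \<le> (sqrt (2 * pi))\<^sup>2"
    using pi_gt3 by simp
  then have "2 \<le> sqrt (2 * pi)"
    by (rule power2_le_imp_le) simp
  then have "1 / sqrt (2 * pi) \<le> 1 / 2"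
    by (intro frac_le) auto
  then show ?thesis
    using std_normal_density_le[of x] by linarith
qed

lemma isCont_std_normal_density: "isCont std_normal_density x"
  unfolding std_normal_density_def by (intro continuous_intros) auto

lemma integral_std_normal:
  fixes f :: "real \<Rightarrow> real"
  assumes [measurable]: "f \<in> borel_measurable borel"
  shows "(LINT x|std_normal_distribution. f x) = (LINT x|lborel. std_normal_density x * f x)"
  by (subst integral_density) (auto simp: normal_density_nonneg)

text \<open>This is 2 Phi(x) - 1 for the standard normal distribution function Phi. It is written as
  a mean sign because it arises by integrating out the last Gaussian variable of a sign
  product.\<close>

definition sgn_normal :: "real \<Rightarrow> real" where
  "sgn_normal x = (LINT z|std_normal_distribution. sgn (x + z))"

lemma borel_measurable_sgn_real [measurable]: "(sgn :: real \<Rightarrow> real) \<in> borel_measurable borel"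
  unfolding sgn_real_def[abs_def] by measurable

lemma integrable_sgn_std_normal: "integrable std_normal_distribution (\<lambda>z. sgn (x + z))"
  by (intro std_normal.integrable_const_bound[where B = 1]) (auto simp: abs_sgn_eq)

lemma abs_sgn_normal_le: "\<bar>sgn_normal x\<bar> \<le> 1"
proof -
  have "\<bar>sgn_normal x\<bar> \<le> (LINT z|std_normal_distribution. \<bar>sgn (x + z)\<bar>)"
    unfolding sgn_normal_def by (rule integral_abs_bound)
  also have "\<dots> \<le> (LINT z|std_normal_distribution. 1)"
    by (intro integral_mono integrable_abs integrable_sgn_std_normal) (auto simp: abs_sgn_eq)
  also have "\<dots> = 1"
    using std_normal.prob_space by simp
  finally show ?thesis .
qed

lemma sgn_normal_uminus: "sgn_normal (- x) = - sgn_normal x"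
proof -
  have "sgn_normal (- x) = (LINT z|lborel. std_normal_density z * sgn (- x + z))"
    unfolding sgn_normal_def by (rule integral_std_normal) simp
  also have "\<dots> = (LINT z|lborel. std_normal_density z * - sgn (x + z))"
    by (subst lborel_integral_real_affine[where c = "-1" and t = 0])
       (auto simp: sgn_minus[symmetric] simp del: sgn_minus)
  also have "\<dots> = - sgn_normal x"
    unfolding sgn_normal_def by (subst integral_std_normal) simp_all
  finally show ?thesis .
qed

lemma sgn_normal_0 [simp]: "sgn_normal 0 = 0"
  using sgn_normal_uminus[of 0] by simp

lemma DERIV_sgn_normal: "(sgn_normal has_real_derivative 2 * std_normal_density x) (at x)"
proof -
  define G where "G x = (LBINT y=0..ereal x. std_normal_density y)" for x
  have dG: "(G has_real_derivative std_normal_density x) (at x)" for x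
  proof -
    have "((\<lambda>u. LBINT y=0..u. std_normal_density y) has_vector_derivative std_normal_density x)
        (at x within {- \<bar>x\<bar> - 1 .. \<bar>x\<bar> + 1})"
      by (rule interval_integral_FTC2[of _ 0, unfolded zero_ereal_def[symmetric]])
         (auto intro!: continuous_at_imp_continuous_on isCont_std_normal_density)
    then have "(G has_vector_derivative std_normal_density x) (at x within {- \<bar>x\<bar> - 1 .. \<bar>x\<bar> + 1})"
      by (simp add: G_def[abs_def])
    moreover have "at x within {- \<bar>x\<bar> - 1 .. \<bar>x\<bar> + 1} = at x"
      by (intro at_within_interior) (auto simp: interior_atLeastAtMost_real)
    ultimately show ?thesis
      by (simp add: has_real_derivative_iff_has_vector_derivative)
  qed
  \<comment> \<open>Off the two end points, the difference of the signs is twice the indicator of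
    [-x, -y].\<close>
  have le: "sgn_normal x - sgn_normal y = 2 * (G (- y) - G (- x))" if "y \<le> x" for x y
  proof -
    have "sgn_normal x - sgn_normal y = (LINT z|std_normal_distribution. sgn (x + z) - sgn (y + z))"
      unfolding sgn_normal_def by (simp add: integrable_sgn_std_normal)
    also have "\<dots> = (LINT z|lborel. std_normal_density z * (sgn (x + z) - sgn (y + z)))"
      by (rule integral_std_normal) simp
    also have "\<dots> = (LINT z|lborel. 2 * (indicator {- x .. - y} z *\<^sub>R std_normal_density z))"
    proof (rule integral_cong_AE)
      have "AE z in lborel. z \<noteq> - x" "AE z in lborel. z \<noteq> - y"
        by (rule AE_lborel_singleton)+
      then show "AE z in lborel. std_normal_density z * (sgn (x + z) - sgn (y + z)) =
          2 * (indicator {- x .. - y} z *\<^sub>R std_normal_density z)"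
        by eventually_elim (use that in \<open>auto simp: sgn_if split: split_indicator\<close>)
    qed auto
    also have "\<dots> = 2 * (LINT z|lborel. indicator {- x .. - y} z *\<^sub>R std_normal_density z)"
      by simp
    also have "(LINT z|lborel. indicator {- x .. - y} z *\<^sub>R std_normal_density z) = G (- y) - G (- x)"
      using dG isCont_std_normal_density that
      by (intro integral_FTC_atLeastAtMost)
         (auto simp: has_real_derivative_iff_has_vector_derivative[symmetric]
           intro: has_field_derivative_at_within continuous_at_imp_continuous_on)
    finally show ?thesis .
  qed
  have "sgn_normal x = 2 * (G 0 - G (- x))" for x
    using le[of 0 x] le[of x 0] by (cases "0 \<le> x") auto
  then have *: "sgn_normal = (\<lambda>x. 2 * (G 0 - G (- x)))"
    by auto
  show ?thesis
    unfolding * by (auto intro!: derivative_eq_intros DERIV_chain2[OF dG])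
qed

lemma continuous_sgn_normal: "isCont sgn_normal x"
  using DERIV_sgn_normal by (rule DERIV_isCont)

lemma borel_measurable_sgn_normal [measurable]: "sgn_normal \<in> borel_measurable borel"
  using continuous_sgn_normal by (intro borel_measurable_continuous_onI continuous_at_imp_continuous_on) auto

lemma integral_sgn_affine:
  assumes "0 < \<sigma>"
  shows "(LINT z|std_normal_distribution. sgn (m + \<sigma> * z)) = sgn_normal (m / \<sigma>)"
proof -
  have "sgn (m + \<sigma> * z) = sgn (m / \<sigma> + z)" for z
  proof -
    have "m + \<sigma> * z = \<sigma> * (m / \<sigma> + z)"
      using assms by (simp add: field_simps)
    then show ?thesis
      using assms by (simp add: sgn_mult)
  qed
  then show ?thesis
    by (simp add: sgn_normal_def)
qed

lemma integral_abs_gauss: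
  fixes s :: real
  assumes "0 < s"
  shows "(LINT w|lborel. \<bar>w\<bar> * exp (- (s * w)\<^sup>2 / 2)) = 2 / s\<^sup>2"
proof -
  have "(LINT w|lborel. std_normal_density w * \<bar>w\<bar>) = sqrt (2 / pi)"
    using integral_std_normal_moment_abs_odd[of 0] by simp
  also have "(LINT w|lborel. std_normal_density w * \<bar>w\<bar>) =
     s * (LINT w::real|lborel. std_normal_density (s * w) * \<bar>s * w\<bar>)"
    using assms by (subst lborel_integral_real_affine[where c = s and t = 0]) auto
  also have "(LINT w::real|lborel. std_normal_density (s * w) * \<bar>s * w\<bar>) =
     (LINT w|lborel. s / sqrt (2 * pi) * (\<bar>w\<bar> * exp (- (s * w)\<^sup>2 / 2)))"
    using assms by (intro Bochner_Integration.integral_cong) (auto simp: std_normal_density_def abs_mult)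
  finally have "s * (s / sqrt (2 * pi) * (LINT w|lborel. \<bar>w\<bar> * exp (- (s * w)\<^sup>2 / 2))) = sqrt (2 / pi)"
    by simp
  moreover have "sqrt (2 * pi) * sqrt (2 / pi) = 2"
    by (simp add: real_sqrt_mult[symmetric])
  ultimately show ?thesis
    using assms by (simp add: field_simps power2_eq_square)
qed

text \<open>Sheppard's formula, by differentiation in k: the two Gaussian factors merge into one of
  precision 1 + k^2, so the derivative is that of \<open>arctan\<close>, and both sides vanish at k
  = 0.\<close>

lemma integral_sgn_sgn_normal:
  "(LINT w|std_normal_distribution. sgn w * sgn_normal (k * w)) = 2 / pi * arctan k"
proof -
  define H where "H k = (LINT w|std_normal_distribution. sgn w * sgn_normal (k * w))" for k
  have int1: "integrable std_normal_distribution (\<lambda>w. \<bar>w\<bar>)"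
    using integrable_std_normal_distribution_moment[of 1] by (auto dest: integrable_abs)
  have dH: "(H has_real_derivative 2 / pi * (1 / (1 + k\<^sup>2))) (at k)" for k
  proof -
    have "(H has_real_derivative (LINT w|std_normal_distribution. sgn w * (2 * std_normal_density (k * w) * w))) (at k)"
      unfolding H_def
    proof (rule DERIV_lebesgue_integral[where \<delta> = 1 and g = "\<lambda>w. 2 * (1 / sqrt (2 * pi)) * \<bar>w\<bar>"])
      show "integrable std_normal_distribution (\<lambda>w. sgn w * sgn_normal (x * w))" for x
        using abs_sgn_normal_le
        by (intro std_normal.integrable_const_bound[where B = 1]) (auto simp: abs_mult abs_sgn_eq)
      show "((\<lambda>x. sgn w * sgn_normal (x * w)) has_real_derivative sgn w * (2 * std_normal_density (x * w) * w)) (at x)" for x w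
        by (auto intro!: derivative_eq_intros DERIV_chain2[OF DERIV_sgn_normal])
      show "\<bar>sgn w * (2 * std_normal_density (x * w) * w)\<bar> \<le> 2 * (1 / sqrt (2 * pi)) * \<bar>w\<bar>" for x w
        using mult_right_mono[OF std_normal_density_le[of "x * w"], of "2 * \<bar>w\<bar>"] normal_density_nonneg[of 0 1 "x * w"]
        by (simp add: abs_mult abs_sgn_eq mult_ac)
    qed (use int1 in auto)
    also have "(LINT w|std_normal_distribution. sgn w * (2 * std_normal_density (k * w) * w)) =
        (LINT w|lborel. std_normal_density w * (sgn w * (2 * std_normal_density (k * w) * w)))"
      by (rule integral_std_normal) simp
    also have "\<dots> = (LINT w|lborel. 1 / pi * (\<bar>w\<bar> * exp (- (sqrt (1 + k\<^sup>2) * w)\<^sup>2 / 2)))"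
    proof (intro Bochner_Integration.integral_cong refl)
      fix w :: real
      have "exp (- w\<^sup>2 / 2) * exp (- (k * w)\<^sup>2 / 2) = exp (- (sqrt (1 + k\<^sup>2) * w)\<^sup>2 / 2)"
        by (simp add: exp_add[symmetric] power_mult_distrib algebra_simps add_divide_distrib)
      moreover have "sgn w * w = \<bar>w\<bar>"
        by (simp add: sgn_if)
      ultimately show "std_normal_density w * (sgn w * (2 * std_normal_density (k * w) * w)) =
          1 / pi * (\<bar>w\<bar> * exp (- (sqrt (1 + k\<^sup>2) * w)\<^sup>2 / 2))"
        by (simp add: std_normal_density_def mult_ac)
    qed
    also have "\<dots> = 2 / pi * (1 / (1 + k\<^sup>2))"
      using integral_abs_gauss[of "sqrt (1 + k\<^sup>2)"] by (simp add: add_pos_nonneg)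
    finally show ?thesis .
  qed
  have "\<exists>c. \<forall>k\<in>UNIV. H k - 2 / pi * arctan k = c"
  proof (rule has_field_derivative_zero_constant)
    show "((\<lambda>k. H k - 2 / pi * arctan k) has_field_derivative 0) (at k within UNIV)" for k
      by (auto intro!: derivative_eq_intros dH simp: divide_simps)
  qed simp
  then obtain c where c: "\<And>k. H k - 2 / pi * arctan k = c"
    by auto
  have "H 0 = 0"
    by (simp add: H_def)
  then have "c = 0"
    using c[of 0] by simp
  then show ?thesis
    using c[of k] by (simp add: H_def)
qed

lemma integral_sgn_gauss_shift:
  "(LINT z|lborel. sgn z * exp (- (z + b)\<^sup>2 / 2)) = sqrt (2 * pi) * sgn_normal (- b)"
proof -
  have "(LINT z|lborel. sgn z * exp (- (z + b)\<^sup>2 / 2)) =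
      (LINT z|lborel. sqrt (2 * pi) * (std_normal_density z * sgn (- b + z)))"
    by (subst lborel_integral_real_affine[where c = 1 and t = "- b"])
       (auto simp: std_normal_density_def mult_ac intro!: Bochner_Integration.integral_cong)
  also have "\<dots> = sqrt (2 * pi) * sgn_normal (- b)"
    unfolding sgn_normal_def by (subst integral_std_normal) auto
  finally show ?thesis .
qed

text \<open>Sheppard's formula without normalisation. The number c is an off-diagonal entry of the
  precision matrix, so the correlation is - c, whence the minus sign; s is the root of the
  determinant. Completing the square in z reduces it to the one-dimensional formula.\<close>

lemma integral_sgn_gauss2:
  assumes s: "0 < s" "s\<^sup>2 + c\<^sup>2 = 1"
  shows "(LINT y|lborel. LINT z|lborel. sgn y * sgn z * exp (- (y\<^sup>2 + z\<^sup>2 + 2 * c * y * z) / 2))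
    = - (4 / s) * arctan (c / s)"
proof -
  have inner: "(LINT z|lborel. sgn y * sgn z * exp (- (y\<^sup>2 + z\<^sup>2 + 2 * c * y * z) / 2)) =
      sqrt (2 * pi) * (sgn y * exp (- (s * y)\<^sup>2 / 2) * sgn_normal (- (c * y)))" for y
  proof -
    have e: "exp (- (y\<^sup>2 + z\<^sup>2 + 2 * c * y * z) / 2) = exp (- (s * y)\<^sup>2 / 2) * exp (- (z + c * y)\<^sup>2 / 2)" for z
    proof -
      have "y\<^sup>2 + z\<^sup>2 + 2 * c * y * z = (s\<^sup>2 + c\<^sup>2) * y\<^sup>2 + z\<^sup>2 + 2 * c * y * z"
        using s by simp
      also have "\<dots> = (s * y)\<^sup>2 + (z + c * y)\<^sup>2"
        by algebra
      finally show ?thesis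
        unfolding exp_add[symmetric] by (simp add: add_divide_distrib)
    qed
    have "(LINT z|lborel. sgn y * sgn z * exp (- (y\<^sup>2 + z\<^sup>2 + 2 * c * y * z) / 2)) =
      (LINT z|lborel. (sgn y * exp (- (s * y)\<^sup>2 / 2)) * (sgn z * exp (- (z + c * y)\<^sup>2 / 2)))"
      unfolding e by (simp add: mult_ac)
    also have "\<dots> = (sgn y * exp (- (s * y)\<^sup>2 / 2)) * (sqrt (2 * pi) * sgn_normal (- (c * y)))"
      by (simp only: integral_mult_right_zero integral_sgn_gauss_shift)
    finally show ?thesis by simp
  qed
  have "(LINT y|lborel. LINT z|lborel. sgn y * sgn z * exp (- (y\<^sup>2 + z\<^sup>2 + 2 * c * y * z) / 2)) =
     sqrt (2 * pi) * (LINT y|lborel. sgn y * exp (- (s * y)\<^sup>2 / 2) * sgn_normal (- (c * y)))"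
    unfolding inner by simp
  also have "(LINT y|lborel. sgn y * exp (- (s * y)\<^sup>2 / 2) * sgn_normal (- (c * y))) =
     1 / s * (LINT w|lborel. sqrt (2 * pi) * (std_normal_density w * (sgn w * sgn_normal (- (c / s) * w))))"
    using s by (subst lborel_integral_real_affine[where c = "1 / s" and t = 0])
       (auto simp: std_normal_density_def sgn_mult mult_ac intro!: Bochner_Integration.integral_cong)
  also have "(LINT w|lborel. sqrt (2 * pi) * (std_normal_density w * (sgn w * sgn_normal (- (c / s) * w)))) =
     sqrt (2 * pi) * (2 / pi * arctan (- (c / s)))"
    unfolding integral_sgn_sgn_normal[symmetric] by (subst integral_std_normal) auto
  finally show ?thesis
    using s by (simp add: arctan_minus field_simps)
qed

lemma arctan_inverse_sinh:
  assumes "0 < d"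
  shows "arctan (1 / sinh d) = gd_co d"
proof -
  have "exp (- d) < 1" using assms by simp
  then have "2 * arctan (exp (- d)) = arctan (2 * exp (- d) / (1 - (exp (- d))\<^sup>2))"
    by (intro arctan_double) simp
  also have "2 * exp (- d) / (1 - (exp (- d))\<^sup>2) = 1 / sinh d"
    using assms by (simp add: sinh_def exp_minus field_simps power2_eq_square)
  finally show ?thesis
    by (simp add: gd_co_def)
qed

text \<open>Integration by parts: the factor after \<open>sgn z\<close> is the derivative of minus
  the exponential, which is 1 at z = 0. Each half-line contributes 1, whatever b is; in other words,
  the derivative of the sign is twice a unit mass at 0.\<close>

lemma integral_sgn_gauss_deriv:
  fixes b :: real
  shows "(LINT z|lborel. sgn z * (z + b) * exp (- (z\<^sup>2 + 2 * b * z) / 2)) = 2"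
proof -
  define f where "f z = (z + b) * exp (- (z\<^sup>2 + 2 * b * z) / 2)" for z
  have fint: "integrable lborel f"
  proof -
    have "integrable lborel (\<lambda>z. std_normal_density z * z)"
      using integrable_std_normal_moment[of 1] by simp
    then have "integrable lborel (\<lambda>z::real. std_normal_density (b + 1 * z) * (b + 1 * z))"
      by (rule lborel_integrable_real_affine) simp
    then have "integrable lborel (\<lambda>z::real. (sqrt (2 * pi) * exp (b\<^sup>2 / 2)) * (std_normal_density (b + 1 * z) * (b + 1 * z)))"
      by (rule integrable_mult_right)
    also have "(\<lambda>z::real. (sqrt (2 * pi) * exp (b\<^sup>2 / 2)) * (std_normal_density (b + 1 * z) * (b + 1 * z))) = f"
    proof
      fix z
      have "exp (b\<^sup>2 / 2) * exp (- (b + z)\<^sup>2 / 2) = exp (- (z\<^sup>2 + 2 * b * z) / 2)"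
        unfolding exp_add[symmetric] by (simp add: power2_sum algebra_simps add_divide_distrib diff_divide_distrib)
      then show "(sqrt (2 * pi) * exp (b\<^sup>2 / 2)) * (std_normal_density (b + 1 * z) * (b + 1 * z)) = f z"
        by (simp add: f_def std_normal_density_def mult_ac add_ac)
    qed
    finally show ?thesis .
  qed
  define F where "F z = - exp (- (z\<^sup>2 + 2 * b * z) / 2)" for z
  have dF: "(F has_real_derivative f z) (at z)" for z
    unfolding F_def f_def by (auto intro!: derivative_eq_intros simp: field_simps)
  have contf: "isCont f z" for z
    unfolding f_def by (intro continuous_intros) auto
  \<comment> \<open>The end at minus infinity is the mirror image with - b in place of b, so one
    limit with a free c serves both ends.\<close>
  have lim: "((\<lambda>z. - exp (- (z * (z / 2 + c)))) \<longlongrightarrow> 0) at_top" for c :: real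
  proof -
    have "filterlim (\<lambda>z. z / 2 + c) at_top at_top"
      using filterlim_tendsto_add_at_top[OF tendsto_const[of c] filterlim_at_top_mult_tendsto_pos[OF tendsto_const[of "1/2"] _ filterlim_ident]]
      by (simp add: add.commute)
    then have "filterlim (\<lambda>z. - (z * (z / 2 + c))) at_bot at_top"
      unfolding filterlim_uminus_at_top[symmetric] by (rule filterlim_at_top_mult_at_top[OF filterlim_ident])
    then have "((\<lambda>z. exp (- (z * (z / 2 + c)))) \<longlongrightarrow> 0) at_top"
      by (rule filterlim_compose[OF exp_at_bot])
    from tendsto_minus[OF this] show ?thesis by simp
  qed
  have "F = (\<lambda>z. - exp (- (z * (z / 2 + b))))" "(\<lambda>z. F (- z)) = (\<lambda>z. - exp (- (z * (z / 2 + (- b)))))"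
    by (simp_all add: F_def fun_eq_iff power2_eq_square algebra_simps add_divide_distrib diff_divide_distrib)
  then have Finf: "(F \<longlongrightarrow> 0) at_top" "(F \<longlongrightarrow> 0) at_bot"
    unfolding filterlim_at_bot_mirror using lim[of b] lim[of "- b"] by simp_all
  have F0: "F 0 = - 1"
    by (simp add: F_def)
  have fint': "set_integrable lborel A f" if "A \<in> sets borel" for A
    unfolding set_integrable_def using that fint by (intro integrable_mult_indicator) auto
  have pos: "(LBINT z=0..\<infinity>. f z) = 0 - (- 1)"
  proof (rule interval_integral_FTC_integrable)
    show "((F \<circ> real_of_ereal) \<longlongrightarrow> - 1) (at_right 0)"
      using isCont_tendsto_compose DERIV_isCont[OF dF, of 0] F0
      unfolding zero_ereal_def ereal_tendsto_simps by (auto simp: isCont_def filterlim_at_split)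
    show "((F \<circ> real_of_ereal) \<longlongrightarrow> 0) (at_left \<infinity>)"
      using Finf unfolding ereal_tendsto_simps by simp
  qed (use dF contf fint' in \<open>auto simp: has_real_derivative_iff_has_vector_derivative[symmetric]\<close>)
  have neg: "(LBINT z=-\<infinity>..0. f z) = - 1 - 0"
  proof (rule interval_integral_FTC_integrable)
    show "((F \<circ> real_of_ereal) \<longlongrightarrow> - 1) (at_left 0)"
      using DERIV_isCont[OF dF, of 0] F0
      unfolding zero_ereal_def ereal_tendsto_simps by (auto simp: isCont_def filterlim_at_split)
    show "((F \<circ> real_of_ereal) \<longlongrightarrow> 0) (at_right (-\<infinity>))"
      using Finf unfolding ereal_tendsto_simps by simp
  qed (use dF contf fint' in \<open>auto simp: has_real_derivative_iff_has_vector_derivative[symmetric]\<close>)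
  have i: "integrable lborel (\<lambda>z. indicator {0<..} z * f z)" "integrable lborel (\<lambda>z. indicator {..<0} z * f z)"
    using fint by (auto intro: integrable_mult_indicator[where 'b = real, simplified])
  have "(LINT z|lborel. sgn z * (z + b) * exp (- (z\<^sup>2 + 2 * b * z) / 2)) =
     (LINT z|lborel. indicator {0<..} z * f z - indicator {..<0} z * f z)"
    by (intro Bochner_Integration.integral_cong) (auto simp: f_def sgn_if algebra_simps split: split_indicator)
  also have "\<dots> = (LINT z|lborel. indicator {0<..} z * f z) - (LINT z|lborel. indicator {..<0} z * f z)"
    using i by simp
  also have "\<dots> = 2"
    using pos neg
    by (simp add: interval_lebesgue_integral_def set_lebesgue_integral_def einterval_def zero_ereal_def
        greaterThan_def lessThan_def)
  finally show ?thesis .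
qed

subsection \<open>Gaussian integrals in three dimensions\<close>

definition sech :: "real \<Rightarrow> real" where "sech x = 1 / cosh x"

lemma sech_pos: "0 < sech x"
  by (simp add: sech_def)

lemma sech_0 [simp]: "sech 0 = 1"
  by (simp add: sech_def)

lemma tanh_sech_square: "(tanh x)\<^sup>2 + (sech x)\<^sup>2 = 1"
  using cosh_real_pos[of x] hyperbolic_pythagoras[of x] by (simp add: tanh_def sech_def divide_simps power_divide)

lemma sech_mult_tanh_add: "sech x * sech y * tanh (x + y) = sech (x + y) * (tanh x + tanh y)"
  using cosh_real_pos[of x] cosh_real_pos[of y] cosh_real_pos[of "x + y"]
  by (simp add: sech_def tanh_def sinh_add divide_simps)

lemma sech_diff_mult: "sech (x - y) * (1 - tanh x * tanh y) = sech x * sech y"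
  using cosh_real_pos[of x] cosh_real_pos[of y] cosh_real_pos[of "x - y"]
  by (simp add: sech_def tanh_def cosh_diff divide_simps)

lemma sech_div_tanh: "sech x / tanh x = 1 / sinh x"
  by (simp add: sech_def tanh_def)

lemma integrable_mult_pair:
  fixes f :: "real \<Rightarrow> real" and g :: "'b::euclidean_space \<Rightarrow> real"
  assumes f: "integrable lborel f" and g: "integrable lborel g"
  shows "integrable lborel (\<lambda>(x, y). f x * g y)"
proof -
  have [measurable]: "f \<in> borel_measurable borel" "g \<in> borel_measurable borel"
    using f g by auto
  have "integrable (lborel \<Otimes>\<^sub>M lborel) (\<lambda>(x, y). f x * g y)"
    using f g by (intro lborel_pair.Fubini_integrable) (auto simp: abs_mult)
  then show ?thesis
    by (simp add: lborel_prod)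
qed

lemma integrable_abs_gauss:
  assumes "0 < e"
  shows "integrable lborel (\<lambda>x::real. (1 + \<bar>x\<bar>) * exp (- (e * x\<^sup>2)))"
proof -
  define s where "s = sqrt (2 * e)"
  have s: "0 < s" "s\<^sup>2 = 2 * e" using assms by (auto simp: s_def)
  have "integrable lborel (\<lambda>x::real. std_normal_density x * \<bar>x\<bar> ^ 0)"
      "integrable lborel (\<lambda>x::real. std_normal_density x * \<bar>x\<bar> ^ 1)"
    by (rule integrable_std_normal_moment_abs)+
  then have "integrable lborel (\<lambda>x::real. sqrt (2 * pi) * (std_normal_density x * \<bar>x\<bar> ^ 0) + sqrt (2 * pi) / s * (std_normal_density x * \<bar>x\<bar> ^ 1))"
    by auto
  from lborel_integrable_real_affine[OF this, of s 0] s
  have "integrable lborel (\<lambda>x::real. sqrt (2 * pi) * (std_normal_density (s * x) * \<bar>s * x\<bar> ^ 0) + sqrt (2 * pi) / s * (std_normal_density (s * x) * \<bar>s * x\<bar> ^ 1))"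
    by simp
  also have "(\<lambda>x::real. sqrt (2 * pi) * (std_normal_density (s * x) * \<bar>s * x\<bar> ^ 0) + sqrt (2 * pi) / s * (std_normal_density (s * x) * \<bar>s * x\<bar> ^ 1)) =
     (\<lambda>x::real. (1 + \<bar>x\<bar>) * exp (- (e * x\<^sup>2)))"
    using s by (simp add: std_normal_density_def power_mult_distrib abs_mult distrib_right fun_eq_iff)
  finally show ?thesis .
qed

text \<open>The linear factor is at most (1 + |x|) (1 + |y|) (1 + |z|), so the bound splits into
  one-dimensional integrals.\<close>

lemma integrable_gauss3_bound:
  fixes f :: "real \<times> real \<times> real \<Rightarrow> real"
  assumes e: "0 < e" and [measurable]: "f \<in> borel_measurable borel"
    and b: "\<And>x y z. \<bar>f (x, y, z)\<bar> \<le> C * (1 + \<bar>x\<bar> + \<bar>y\<bar> + \<bar>z\<bar>) * exp (- (e * (x\<^sup>2 + y\<^sup>2 + z\<^sup>2)))"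
  shows "integrable lborel f"
proof (rule Bochner_Integration.integrable_bound)
  define k where "k x = (1 + \<bar>x\<bar>) * exp (- (e * x\<^sup>2))" for x :: real
  have k: "integrable lborel k"
    unfolding k_def using e by (rule integrable_abs_gauss)
  show "integrable lborel (\<lambda>p. C * (case p of (x, q) \<Rightarrow> k x * (case q of (y, z) \<Rightarrow> k y * k z)))"
    by (intro integrable_mult_right integrable_mult_pair k)
  have C: "0 \<le> C"
    using b[of 0 0 0] by simp
  show "AE p in lborel. norm (f p) \<le> norm (C * (case p of (x, q) \<Rightarrow> k x * (case q of (y, z) \<Rightarrow> k y * k z)))"
  proof (intro AE_I2)
    fix p :: "real \<times> real \<times> real"
    obtain x y z where p: "p = (x, y, z)" by (cases p) auto
    have "1 + \<bar>x\<bar> + \<bar>y\<bar> + \<bar>z\<bar> \<le> (1 + \<bar>x\<bar>) * ((1 + \<bar>y\<bar>) * (1 + \<bar>z\<bar>))"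
      by (simp add: algebra_simps)
    then have "C * (1 + \<bar>x\<bar> + \<bar>y\<bar> + \<bar>z\<bar>) * exp (- (e * (x\<^sup>2 + y\<^sup>2 + z\<^sup>2))) \<le>
       C * ((1 + \<bar>x\<bar>) * ((1 + \<bar>y\<bar>) * (1 + \<bar>z\<bar>))) * exp (- (e * (x\<^sup>2 + y\<^sup>2 + z\<^sup>2)))"
      using C by (intro mult_right_mono mult_left_mono) auto
    also have "\<dots> = C * (k x * (k y * k z))"
    proof -
      have "exp (- (e * (x\<^sup>2 + y\<^sup>2 + z\<^sup>2))) = exp (- (e * x\<^sup>2)) * (exp (- (e * y\<^sup>2)) * exp (- (e * z\<^sup>2)))"
        unfolding exp_add[symmetric] by (simp add: algebra_simps)
      then show ?thesis
        by (simp only: k_def mult_ac)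
    qed
    finally show "norm (f p) \<le> norm (C * (case p of (x, q) \<Rightarrow> k x * (case q of (y, z) \<Rightarrow> k y * k z)))"
      using b[of x y z] C by (simp add: p)
  qed
qed simp

text \<open>The three orders put each coordinate innermost in turn or keep it for last, as the
  integrations by parts in x, y and z demand.\<close>

lemma integral_lborel3:
  fixes f :: "real \<times> real \<times> real \<Rightarrow> real"
  assumes f: "integrable lborel f"
  shows integral_lborel3_xyz: "(LINT p|lborel. f p) = (LINT x|lborel. LINT y|lborel. LINT z|lborel. f (x, y, z))"
    and integral_lborel3_xzy: "(LINT p|lborel. f p) = (LINT x|lborel. LINT z|lborel. LINT y|lborel. f (x, y, z))"
    and integral_lborel3_yzx: "(LINT p|lborel. f p) = (LINT y|lborel. LINT z|lborel. LINT x|lborel. f (x, y, z))"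
proof -
  have f1: "integrable (lborel \<Otimes>\<^sub>M lborel) f"
    using f by (simp add: lborel_prod)
  then have [measurable]: "f \<in> borel_measurable (lborel \<Otimes>\<^sub>M lborel)"
    by auto
  have m [measurable]: "(\<lambda>(x, y, z). f (x, y, z)) \<in> borel_measurable (borel \<Otimes>\<^sub>M (borel \<Otimes>\<^sub>M borel))"
    using f by (simp add: borel_prod)
  have *: "(LINT p|lborel. f p) = (LINT x|lborel. LINT q|lborel. f (x, q))"
    using lborel_pair.integral_fst'[OF f1] by (simp add: lborel_prod)
  have yz: "AE x in lborel. (LINT q|lborel. f (x, q)) = (LINT y|lborel. LINT z|lborel. f (x, y, z))"
    using lborel_pair.AE_integrable_fst'[OF f1]
  proof eventually_elim
    case (elim x)
    then have "integrable (lborel \<Otimes>\<^sub>M lborel) (\<lambda>q. f (x, q))"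
      by (simp add: lborel_prod)
    from lborel_pair.integral_fst'[OF this] show ?case
      by (simp add: lborel_prod)
  qed
  have zy: "AE x in lborel. (LINT q|lborel. f (x, q)) = (LINT z|lborel. LINT y|lborel. f (x, y, z))"
    using lborel_pair.AE_integrable_fst'[OF f1]
  proof eventually_elim
    case (elim x)
    then have "integrable (lborel \<Otimes>\<^sub>M lborel) (\<lambda>(y, z). f (x, y, z))"
      by (simp add: lborel_prod case_prod_eta[where f = "\<lambda>q. f (x, q)"])
    from lborel_pair.integral_snd[OF this] show ?case
      by (simp add: lborel_prod case_prod_eta[where f = "\<lambda>q. f (x, q)"])
  qed
  have m0: "(\<lambda>x. LINT q|lborel. f (x, q)) \<in> borel_measurable lborel"
    using lborel_pair.integrable_fst'[OF f1] by auto
  have m1: "(\<lambda>x. LINT y|lborel. LINT z|lborel. f (x, y, z)) \<in> borel_measurable lborel"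
    and m2: "(\<lambda>x. LINT z|lborel. LINT y|lborel. f (x, y, z)) \<in> borel_measurable lborel"
    by measurable
  show "(LINT p|lborel. f p) = (LINT x|lborel. LINT y|lborel. LINT z|lborel. f (x, y, z))"
    unfolding * by (rule integral_cong_AE[OF m0 m1 yz])
  show "(LINT p|lborel. f p) = (LINT x|lborel. LINT z|lborel. LINT y|lborel. f (x, y, z))"
    unfolding * by (rule integral_cong_AE[OF m0 m2 zy])
  have f1': "integrable (lborel \<Otimes>\<^sub>M lborel) (\<lambda>(x, q). f (x, q))"
    using f1 by simp
  have "(LINT p|lborel. f p) = (LINT q|lborel. LINT x|lborel. f (x, q))"
    using lborel_pair.integral_snd[OF f1'] by (simp add: lborel_prod)
  also have "\<dots> = (LINT y|lborel. LINT z|lborel. LINT x|lborel. f (x, y, z))"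
  proof -
    have "integrable (lborel \<Otimes>\<^sub>M lborel) (\<lambda>q. LINT x|lborel. f (x, q))"
      using lborel_pair.integrable_snd[OF f1'] by (simp add: lborel_prod)
    from lborel_pair.integral_fst'[OF this] show ?thesis
      by (simp add: lborel_prod)
  qed
  finally show "(LINT p|lborel. f p) = (LINT y|lborel. LINT z|lborel. LINT x|lborel. f (x, y, z))" .
qed

lemma integral_lborel3_scale:
  fixes f :: "real \<times> real \<times> real \<Rightarrow> real"
  assumes f: "integrable lborel f" and f': "integrable lborel (\<lambda>(x, y, z). f (\<alpha> * x, \<beta> * y, \<gamma> * z))"
    and pos: "0 < \<alpha>" "0 < \<beta>" "0 < \<gamma>"
  shows "(LINT p|lborel. f p) = \<alpha> * \<beta> * \<gamma> * (LINT p|lborel. (case p of (x, y, z) \<Rightarrow> f (\<alpha> * x, \<beta> * y, \<gamma> * z)))"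
proof -
  have z: "(LINT z|lborel. f (x, y, z)) = \<gamma> * (LINT z|lborel. f (x, y, \<gamma> * z))" for x y
    using lborel_integral_real_affine[of \<gamma> "\<lambda>z. f (x, y, z)" 0] pos by simp
  have y: "(LINT y|lborel. LINT z|lborel. f (x, y, \<gamma> * z)) = \<beta> * (LINT y|lborel. LINT z|lborel. f (x, \<beta> * y, \<gamma> * z))" for x
    using lborel_integral_real_affine[of \<beta> "\<lambda>y. LINT z|lborel. f (x, y, \<gamma> * z)" 0] pos by simp
  have x: "(LINT x|lborel. LINT y|lborel. LINT z|lborel. f (x, \<beta> * y, \<gamma> * z)) =
      \<alpha> * (LINT x|lborel. LINT y|lborel. LINT z|lborel. f (\<alpha> * x, \<beta> * y, \<gamma> * z))"
    using lborel_integral_real_affine[of \<alpha> "\<lambda>x. LINT y|lborel. LINT z|lborel. f (x, \<beta> * y, \<gamma> * z)" 0] pos by simp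
  show ?thesis
    unfolding integral_lborel3_xyz[OF f] integral_lborel3_xyz[OF f'] by (simp add: x y z)
qed

text \<open>An unnormalised Gaussian density with unit diagonal in the precision matrix; a, b, c are
  its entries for the pairs xy, xz, yz. They are not correlations.\<close>

definition gauss3 :: "real \<Rightarrow> real \<Rightarrow> real \<Rightarrow> real \<Rightarrow> real \<Rightarrow> real \<Rightarrow> real" where
  "gauss3 a b c x y z = exp (- (x\<^sup>2 + y\<^sup>2 + z\<^sup>2 + 2 * a * x * y + 2 * b * x * z + 2 * c * y * z) / 2)"

text \<open>The linear form is minus the logarithmic derivative of \<open>gauss3\<close> in x, so
  integration by parts leaves twice the integrand's value on the plane x = 0.\<close>

lemma integral_sgn3_inner:
  "(LINT x|lborel. sgn x * sgn y * sgn z * (x + a * y + b * z) * gauss3 a b c x y z) =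
     2 * (sgn y * sgn z * exp (- (y\<^sup>2 + z\<^sup>2 + 2 * c * y * z) / 2))"
proof -
  have "(LINT x|lborel. sgn x * sgn y * sgn z * (x + a * y + b * z) * gauss3 a b c x y z) =
    (LINT x|lborel. (sgn y * sgn z * exp (- (y\<^sup>2 + z\<^sup>2 + 2 * c * y * z) / 2)) *
      (sgn x * (x + (a * y + b * z)) * exp (- (x\<^sup>2 + 2 * (a * y + b * z) * x) / 2)))"
  proof (intro Bochner_Integration.integral_cong refl)
    fix x :: real
    have "gauss3 a b c x y z = exp (- (y\<^sup>2 + z\<^sup>2 + 2 * c * y * z) / 2) * exp (- (x\<^sup>2 + 2 * (a * y + b * z) * x) / 2)"
      unfolding gauss3_def exp_add[symmetric] by (rule arg_cong[of _ _ exp]) (simp add: field_simps)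
    then show "sgn x * sgn y * sgn z * (x + a * y + b * z) * gauss3 a b c x y z =
      (sgn y * sgn z * exp (- (y\<^sup>2 + z\<^sup>2 + 2 * c * y * z) / 2)) *
      (sgn x * (x + (a * y + b * z)) * exp (- (x\<^sup>2 + 2 * (a * y + b * z) * x) / 2))"
      by (simp add: mult_ac add_ac)
  qed
  also have "\<dots> = (sgn y * sgn z * exp (- (y\<^sup>2 + z\<^sup>2 + 2 * c * y * z) / 2)) * 2"
    by (simp only: integral_mult_right_zero integral_sgn_gauss_deriv)
  finally show ?thesis by simp
qed

text \<open>Here a, b, c stand for the \<open>tanh\<close> of three consecutive gaps, and the
  defined terms are the addition theorem for merged gaps. These are the rational identities behind
  the inverse of the Cauchy matrix; positivity keeps the denominators away from 0.\<close>

lemma tanh_three_points: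
  fixes a b c :: real
  assumes "0 < a" "0 < b" "0 < c"
  defines "ab \<equiv> (a + b) / (1 + a * b)" and "bc \<equiv> (b + c) / (1 + b * c)"
    and "abc \<equiv> (a + b + c + a * b * c) / (1 + a * b + b * c + a * c)"
  shows "1 / (a * ab) - (a + bc) / (abc * a * b) + (ab + c) / (abc * ab * b) = bc * c"
    and "(1 - abc * a) / (a * ab) - 1 / (a * b) + (b + c) / (bc * ab * b) = abc * c"
    and "(1 - abc * ab) / (a * ab) - (1 - bc * b) / (a * b) + 1 / (ab * b) = abc * bc"
proof -
  have p: "1 + a * b > 0" "1 + b * c > 0" "1 + a * b + b * c + a * c > 0" "a + b > 0" "b + c > 0" "a + b + c + a * b * c > 0"
    using assms(1-3) by (auto intro!: add_pos_pos)
  note n = p[THEN less_imp_neq, symmetric] assms(1-3)[THEN less_imp_neq, symmetric]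
  show "1 / (a * ab) - (a + bc) / (abc * a * b) + (ab + c) / (abc * ab * b) = bc * c"
    unfolding ab_def bc_def abc_def using n
    by (simp add: divide_simps) algebra
  show "(1 - abc * a) / (a * ab) - 1 / (a * b) + (b + c) / (bc * ab * b) = abc * c"
    unfolding ab_def bc_def abc_def using n
    by (simp add: divide_simps) algebra
  show "(1 - abc * ab) / (a * ab) - (1 - bc * b) / (a * b) + 1 / (ab * b) = abc * bc"
    unfolding ab_def bc_def abc_def using n
    by (simp add: divide_simps) algebra
qed

subsection \<open>The four-point sign correlation\<close>

text \<open>Only three points are fixed: the fourth is the variable of the differential
  equation.\<close>

locale three_points =
  fixes u1 u2 u3 :: real
  assumes u12: "u1 < u2" and u23: "u2 < u3"
begin

definition "c12 = sech (u2 - u1)"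
definition "c13 = sech (u3 - u1)"
definition "c23 = sech (u3 - u2)"
definition "t12 = tanh (u2 - u1)"
definition "t13 = tanh (u3 - u1)"
definition "t23 = tanh (u3 - u2)"

lemma t_pos: "0 < t12" "0 < t13" "0 < t23"
  using u12 u23 by (simp_all add: t12_def t13_def t23_def)

lemma c_pos: "0 < c12" "0 < c13" "0 < c23"
  by (simp_all add: c12_def c13_def c23_def sech_pos)

lemma t_c_square: "t12\<^sup>2 + c12\<^sup>2 = 1" "t13\<^sup>2 + c13\<^sup>2 = 1" "t23\<^sup>2 + c23\<^sup>2 = 1"
  by (simp_all add: t12_def t13_def t23_def c12_def c13_def c23_def tanh_sech_square)

lemma rel_add: "c12 * c23 * t13 = c13 * (t12 + t23)"
  using sech_mult_tanh_add[of "u2 - u1" "u3 - u2"]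
  by (simp add: t12_def t13_def t23_def c12_def c13_def c23_def)

lemma rel_diff: "c12 * (1 - t13 * t23) = c13 * c23"
  using sech_diff_mult[of "u3 - u1" "u3 - u2"]
  by (simp add: t12_def t13_def t23_def c12_def c13_def c23_def)

abbreviation "E \<equiv> gauss3 c12 c13 c23"

text \<open>The coordinates in which the covariance form of the three points is a sum of squares
  (a Takenaka--Malmquist basis).\<close>

definition "\<eta>1 x = t12 * t13 * x"
definition "\<eta>2 x y = - (c12 * t13 * x) - t23 * y"
definition "\<eta>3 x y z = c23 * y + c13 * x + z"

lemma sum_squares:
  "x\<^sup>2 + y\<^sup>2 + z\<^sup>2 + 2 * c12 * x * y + 2 * c13 * x * z + 2 * c23 * y * z
    = (\<eta>1 x)\<^sup>2 + (\<eta>2 x y)\<^sup>2 + (\<eta>3 x y z)\<^sup>2"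
proof -
  have "(\<eta>1 x)\<^sup>2 + (\<eta>2 x y)\<^sup>2 + (\<eta>3 x y z)\<^sup>2 = (t13\<^sup>2 * (t12\<^sup>2 + c12\<^sup>2) + c13\<^sup>2) * x\<^sup>2
      + (t23\<^sup>2 + c23\<^sup>2) * y\<^sup>2 + z\<^sup>2 + 2 * (c12 * t13 * t23 + c13 * c23) * x * y + 2 * c13 * x * z + 2 * c23 * y * z"
    unfolding \<eta>1_def \<eta>2_def \<eta>3_def by algebra
  \<comment> \<open>The coefficient of xy is the only one that needs more than
    \<open>tanh\<^sup>2 + sech\<^sup>2 = 1\<close>.\<close>
  also have "c12 * t13 * t23 + c13 * c23 = c12"
    using rel_diff by (simp add: algebra_simps)
  finally show ?thesis
    by (simp add: t_c_square)
qed

text \<open>The three coordinates form a triangular invertible system, so x, y and z are recovered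
  in turn; \<open>K1\<close>, \<open>K2\<close>, \<open>K3\<close> bound them as multiples of the
  root \<open>r\<close> of the sum of squares.\<close>

lemma coercive: "\<exists>e>0. \<forall>x y z. e * (x\<^sup>2 + y\<^sup>2 + z\<^sup>2) \<le> (\<eta>1 x)\<^sup>2 + (\<eta>2 x y)\<^sup>2 + (\<eta>3 x y z)\<^sup>2"
proof -
  define K1 where "K1 = 1 / (t12 * t13)"
  define K2 where "K2 = (1 + c12 * t13 * K1) / t23"
  define K3 where "K3 = 1 + c23 * K2 + c13 * K1"
  have K: "0 < K1" "0 < K2" "0 < K3"
    using t_pos c_pos by (auto simp: K1_def K2_def K3_def intro!: add_pos_pos divide_pos_pos mult_pos_pos)
  have "1 / (K1\<^sup>2 + K2\<^sup>2 + K3\<^sup>2) * (x\<^sup>2 + y\<^sup>2 + z\<^sup>2) \<le> (\<eta>1 x)\<^sup>2 + (\<eta>2 x y)\<^sup>2 + (\<eta>3 x y z)\<^sup>2" for x y z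
  proof -
    define q where "q = (\<eta>1 x)\<^sup>2 + (\<eta>2 x y)\<^sup>2 + (\<eta>3 x y z)\<^sup>2"
    define r where "r = sqrt q"
    have q: "0 \<le> q" by (simp add: q_def)
    have r: "\<bar>\<eta>1 x\<bar> \<le> r" "\<bar>\<eta>2 x y\<bar> \<le> r" "\<bar>\<eta>3 x y z\<bar> \<le> r"
      unfolding r_def by (auto intro!: real_le_rsqrt simp: q_def)
    have x: "\<bar>x\<bar> \<le> K1 * r"
      using r(1) t_pos by (simp add: \<eta>1_def K1_def abs_mult field_simps)
    have "t23 * \<bar>y\<bar> = \<bar>\<eta>2 x y + c12 * t13 * x\<bar>"
      using t_pos by (simp add: \<eta>2_def abs_mult)
    also have "\<dots> \<le> \<bar>\<eta>2 x y\<bar> + c12 * t13 * \<bar>x\<bar>"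
      using abs_triangle_ineq[of "\<eta>2 x y" "c12 * t13 * x"] t_pos c_pos by (simp add: abs_mult)
    also have "\<dots> \<le> r + c12 * t13 * (K1 * r)"
      using r(2) x t_pos c_pos by (intro add_mono mult_left_mono) auto
    finally have y: "\<bar>y\<bar> \<le> K2 * r"
      using t_pos by (simp add: K2_def field_simps)
    have "\<bar>z\<bar> = \<bar>\<eta>3 x y z - c23 * y - c13 * x\<bar>"
      by (simp add: \<eta>3_def)
    also have "\<dots> \<le> \<bar>\<eta>3 x y z\<bar> + \<bar>c23 * y\<bar> + \<bar>c13 * x\<bar>"
      by linarith
    also have "\<dots> \<le> r + c23 * (K2 * r) + c13 * (K1 * r)"
      using r(3) x y c_pos by (auto simp: abs_mult intro!: add_mono mult_left_mono)
    finally have z: "\<bar>z\<bar> \<le> K3 * r"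
      by (simp add: K3_def algebra_simps)
    have "x\<^sup>2 \<le> (K1 * r)\<^sup>2" "y\<^sup>2 \<le> (K2 * r)\<^sup>2" "z\<^sup>2 \<le> (K3 * r)\<^sup>2"
      using x y z by (simp_all add: abs_le_square_iff[symmetric])
    then have "x\<^sup>2 + y\<^sup>2 + z\<^sup>2 \<le> (K1\<^sup>2 + K2\<^sup>2 + K3\<^sup>2) * r\<^sup>2"
      by (simp add: power_mult_distrib algebra_simps)
    also have "r\<^sup>2 = q"
      using q by (simp add: r_def)
    finally show ?thesis
      unfolding q_def[symmetric] using K by (simp add: divide_le_eq mult.commute add_pos_pos)
  qed
  moreover have "0 < 1 / (K1\<^sup>2 + K2\<^sup>2 + K3\<^sup>2)"
    using K by (simp add: add_pos_pos)
  ultimately show ?thesis by blast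
qed

lemma E_bound: "\<exists>e>0. \<forall>x y z. E x y z \<le> exp (- (e * (x\<^sup>2 + y\<^sup>2 + z\<^sup>2)))"
proof -
  obtain e where "0 < e" "\<And>x y z. e * (x\<^sup>2 + y\<^sup>2 + z\<^sup>2) \<le> (\<eta>1 x)\<^sup>2 + (\<eta>2 x y)\<^sup>2 + (\<eta>3 x y z)\<^sup>2"
    using coercive by blast
  note e = this
  have "E x y z \<le> exp (- (e / 2 * (x\<^sup>2 + y\<^sup>2 + z\<^sup>2)))" for x y z
    unfolding gauss3_def sum_squares exp_le_cancel_iff using e(2)[of x y z] by (simp add: field_simps)
  then show ?thesis
    using e(1) by (intro exI[of _ "e / 2"]) simp
qed

lemma E_pos: "0 < E x y z"
  by (simp add: gauss3_def)

lemma integrable_E_bound: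
  fixes f :: "real \<times> real \<times> real \<Rightarrow> real"
  assumes [measurable]: "f \<in> borel_measurable borel"
    and b: "\<And>x y z. \<bar>f (x, y, z)\<bar> \<le> C * (1 + \<bar>x\<bar> + \<bar>y\<bar> + \<bar>z\<bar>) * E x y z"
  shows "integrable lborel f"
proof -
  obtain e where e: "0 < e" "\<And>x y z. E x y z \<le> exp (- (e * (x\<^sup>2 + y\<^sup>2 + z\<^sup>2)))"
    using E_bound by blast
  have "0 \<le> C * E 0 0 0"
    using b[of 0 0 0] by simp
  then have C: "0 \<le> C"
    using E_pos[of 0 0 0] by (simp add: zero_le_mult_iff)
  show ?thesis
  proof (rule integrable_gauss3_bound[OF e(1), of _ C])
    fix x y z
    have "C * (1 + \<bar>x\<bar> + \<bar>y\<bar> + \<bar>z\<bar>) * E x y z \<le> C * (1 + \<bar>x\<bar> + \<bar>y\<bar> + \<bar>z\<bar>) * exp (- (e * (x\<^sup>2 + y\<^sup>2 + z\<^sup>2)))"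
      using e(2) C by (intro mult_left_mono) auto
    then show "\<bar>f (x, y, z)\<bar> \<le> C * (1 + \<bar>x\<bar> + \<bar>y\<bar> + \<bar>z\<bar>) * exp (- (e * (x\<^sup>2 + y\<^sup>2 + z\<^sup>2)))"
      using b[of x y z] by simp
  qed simp
qed

definition S3 :: "real \<times> real \<times> real \<Rightarrow> real" where
  "S3 p = sgn (fst p) * sgn (fst (snd p)) * sgn (snd (snd p))"

definition E3 :: "real \<times> real \<times> real \<Rightarrow> real" where
  "E3 p = E (fst p) (fst (snd p)) (snd (snd p))"

lemma measurable_S3_E3 [measurable]: "S3 \<in> borel_measurable borel" "E3 \<in> borel_measurable borel"
  unfolding S3_def[abs_def] E3_def[abs_def] gauss3_def borel_prod[symmetric] by measurable

lemma abs_S3_le: "\<bar>S3 p\<bar> \<le> 1"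
  by (simp add: S3_def abs_mult abs_sgn_eq)

definition lin :: "real \<Rightarrow> real \<Rightarrow> real \<Rightarrow> real \<times> real \<times> real \<Rightarrow> real" where
  "lin a b c p = a * fst p + b * fst (snd p) + c * snd (snd p)"

lemma measurable_lin [measurable]: "lin a b c \<in> borel_measurable borel"
  unfolding lin_def[abs_def] borel_prod[symmetric] by measurable

lemma abs_lin_le: "\<bar>lin a b c (x, y, z)\<bar> \<le> (\<bar>a\<bar> + \<bar>b\<bar> + \<bar>c\<bar>) * (1 + \<bar>x\<bar> + \<bar>y\<bar> + \<bar>z\<bar>)"
proof -
  have "\<bar>lin a b c (x, y, z)\<bar> \<le> \<bar>a\<bar> * \<bar>x\<bar> + \<bar>b\<bar> * \<bar>y\<bar> + \<bar>c\<bar> * \<bar>z\<bar>"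
    unfolding lin_def fst_conv snd_conv abs_mult[symmetric] by linarith
  also have "\<dots> \<le> \<bar>a\<bar> * (1 + \<bar>x\<bar> + \<bar>y\<bar> + \<bar>z\<bar>) + \<bar>b\<bar> * (1 + \<bar>x\<bar> + \<bar>y\<bar> + \<bar>z\<bar>) + \<bar>c\<bar> * (1 + \<bar>x\<bar> + \<bar>y\<bar> + \<bar>z\<bar>)"
    by (intro add_mono mult_left_mono) auto
  finally show ?thesis
    by (simp add: algebra_simps)
qed

lemma integrable_lin:
  "integrable lborel (\<lambda>p. S3 p * lin a b c p * E3 p)"
proof (rule integrable_E_bound[where C = "\<bar>a\<bar> + \<bar>b\<bar> + \<bar>c\<bar>"])
  fix x y z
  have "\<bar>S3 (x, y, z) * lin a b c (x, y, z)\<bar> \<le> 1 * ((\<bar>a\<bar> + \<bar>b\<bar> + \<bar>c\<bar>) * (1 + \<bar>x\<bar> + \<bar>y\<bar> + \<bar>z\<bar>))"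
    unfolding abs_mult by (intro mult_mono abs_S3_le abs_lin_le) auto
  from mult_right_mono[OF this less_imp_le[OF E_pos[of x y z]]]
  show "\<bar>S3 (x, y, z) * lin a b c (x, y, z) * E3 (x, y, z)\<bar> \<le> (\<bar>a\<bar> + \<bar>b\<bar> + \<bar>c\<bar>) * (1 + \<bar>x\<bar> + \<bar>y\<bar> + \<bar>z\<bar>) * E x y z"
    using E_pos[of x y z] by (simp add: abs_mult[of _ "E _ _ _"] E3_def)
qed measurable

definition "A12 = gd_co (u2 - u1)"
definition "A13 = gd_co (u3 - u1)"
definition "A23 = gd_co (u3 - u2)"

lemma arctan_A: "arctan (c12 / t12) = A12" "arctan (c13 / t13) = A13" "arctan (c23 / t23) = A23"
  using u12 u23 arctan_inverse_sinh
  by (simp_all add: c12_def t12_def A12_def c13_def t13_def A13_def c23_def t23_def A23_def sech_div_tanh)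

text \<open>The form is the first row of the precision matrix, so x can be integrated by parts. What
  remains is Sheppard's integral in y and z. The next two lemmas do the same with the other
  rows.\<close>

lemma integral_lin1: "(LINT p|lborel. S3 p * lin 1 c12 c13 p * E3 p) = - 8 * A23 / t23"
proof -
  have "(LINT p|lborel. S3 p * lin 1 c12 c13 p * E3 p) =
     (LINT y|lborel. LINT z|lborel. LINT x|lborel. sgn x * sgn y * sgn z * (x + c12 * y + c13 * z) * gauss3 c12 c13 c23 x y z)"
    by (subst integral_lborel3_yzx[OF integrable_lin]) (simp add: S3_def E3_def lin_def)
  then show ?thesis
    using integral_sgn_gauss2[of t23 c23] t_pos t_c_square arctan_A
    by (simp only: integral_sgn3_inner) simp
qed

lemma integral_lin2: "(LINT p|lborel. S3 p * lin c12 1 c23 p * E3 p) = - 8 * A13 / t13"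
proof -
  have "(LINT p|lborel. S3 p * lin c12 1 c23 p * E3 p) =
     (LINT x|lborel. LINT z|lborel. LINT y|lborel. sgn y * sgn x * sgn z * (y + c12 * x + c23 * z) * gauss3 c12 c23 c13 y x z)"
    by (subst integral_lborel3_xzy[OF integrable_lin]) (simp add: S3_def E3_def lin_def gauss3_def algebra_simps)
  then show ?thesis
    using integral_sgn_gauss2[of t13 c13] t_pos t_c_square arctan_A
    by (simp only: integral_sgn3_inner) simp
qed

lemma integral_lin3: "(LINT p|lborel. S3 p * lin c13 c23 1 p * E3 p) = - 8 * A12 / t12"
proof -
  have "(LINT p|lborel. S3 p * lin c13 c23 1 p * E3 p) =
     (LINT x|lborel. LINT y|lborel. LINT z|lborel. sgn z * sgn x * sgn y * (z + c13 * x + c23 * y) * gauss3 c13 c23 c12 z x y)"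
    by (subst integral_lborel3_xyz[OF integrable_lin]) (simp add: S3_def E3_def lin_def gauss3_def algebra_simps)
  then show ?thesis
    using integral_sgn_gauss2[of t12 c12] t_pos t_c_square arctan_A
    by (simp only: integral_sgn3_inner) simp
qed

text \<open>The coefficients are the precision matrix applied to (v1, v2, v3). Any linear form is
  thus covered once this system is solved for v.\<close>

lemma integral_lin:
  "(LINT p|lborel. S3 p * lin (v1 + v2 * c12 + v3 * c13) (v1 * c12 + v2 + v3 * c23) (v1 * c13 + v2 * c23 + v3) p * E3 p)
    = - 8 * (v1 * A23 / t23 + v2 * A13 / t13 + v3 * A12 / t12)"
proof -
  have "(LINT p|lborel. S3 p * lin (v1 + v2 * c12 + v3 * c13) (v1 * c12 + v2 + v3 * c23) (v1 * c13 + v2 * c23 + v3) p * E3 p)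
    = (LINT p|lborel. v1 * (S3 p * lin 1 c12 c13 p * E3 p) + v2 * (S3 p * lin c12 1 c23 p * E3 p) + v3 * (S3 p * lin c13 c23 1 p * E3 p))"
    by (intro Bochner_Integration.integral_cong) (simp_all add: lin_def algebra_simps)
  also have "\<dots> = v1 * (- 8 * A23 / t23) + v2 * (- 8 * A13 / t13) + v3 * (- 8 * A12 / t12)"
    by (simp only: integrable_lin integrable_mult_right Bochner_Integration.integral_add integral_mult_right_zero
        Bochner_Integration.integrable_add integral_lin1 integral_lin2 integral_lin3)
  finally show ?thesis
    by (simp add: algebra_simps)
qed

section \<open>Conditioning on a zero at the fourth point\<close>

context
  fixes u :: real
  assumes u3u: "u3 < u"
begin

definition "s1 = sech (u - u1)"
definition "s2 = sech (u - u2)"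
definition "s3 = sech (u - u3)"
definition "t1 = tanh (u - u1)"
definition "t2 = tanh (u - u2)"
definition "t3 = tanh (u - u3)"

lemma t4_pos: "0 < t1" "0 < t2" "0 < t3"
  using u12 u23 u3u by (simp_all add: t1_def t2_def t3_def)

lemma rel4:
  shows "c12 * s2 * t1 = s1 * (t12 + t2)" "c13 * s3 * t1 = s1 * (t13 + t3)" "c23 * s3 * t2 = s2 * (t23 + t3)"
    and "c12 * (1 - t1 * t2) = s1 * s2" "c13 * (1 - t1 * t3) = s1 * s3" "c23 * (1 - t2 * t3) = s2 * s3"
    and "s2 * (1 - t1 * t12) = s1 * c12" "s3 * (1 - t1 * t13) = s1 * c13" "s3 * (1 - t2 * t23) = s2 * c23"
  using sech_mult_tanh_add[of "u2 - u1" "u - u2"] sech_mult_tanh_add[of "u3 - u1" "u - u3"]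
    sech_mult_tanh_add[of "u3 - u2" "u - u3"]
    sech_diff_mult[of "u - u1" "u - u2"] sech_diff_mult[of "u - u1" "u - u3"] sech_diff_mult[of "u - u2" "u - u3"]
    sech_diff_mult[of "u - u1" "u2 - u1"] sech_diff_mult[of "u - u1" "u3 - u1"] sech_diff_mult[of "u - u2" "u3 - u2"]
  by (simp_all add: s1_def s2_def s3_def t1_def t2_def t3_def t12_def t13_def t23_def c12_def c13_def c23_def)

lemma t4_square: "t1\<^sup>2 + s1\<^sup>2 = 1" "t2\<^sup>2 + s2\<^sup>2 = 1" "t3\<^sup>2 + s3\<^sup>2 = 1"
  by (simp_all add: s1_def s2_def s3_def t1_def t2_def t3_def tanh_sech_square)

lemma tanh_rel: "t13 = (t12 + t23) / (1 + t12 * t23)" "t2 = (t23 + t3) / (1 + t23 * t3)"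
    "t1 = (t12 + t23 + t3 + t12 * t23 * t3) / (1 + t12 * t23 + t23 * t3 + t12 * t3)"
proof -
  show a: "t13 = (t12 + t23) / (1 + t12 * t23)" "t2 = (t23 + t3) / (1 + t23 * t3)"
    using tanh_add[of "u2 - u1" "u3 - u2"] tanh_add[of "u3 - u2" "u - u3"]
    by (simp_all add: t12_def t13_def t23_def t2_def t3_def)
  have t1: "t1 = (t12 + t2) / (1 + t12 * t2)"
    using tanh_add[of "u2 - u1" "u - u2"] by (simp add: t12_def t2_def t1_def)
  have p: "1 + t23 * t3 > 0" "1 + t12 * t2 > 0" "1 + t12 * t23 + t23 * t3 + t12 * t3 > 0"
    using t_pos t4_pos by (auto intro!: add_pos_pos)
  have "(t12 + t2) * (1 + t23 * t3) = t12 + t23 + t3 + t12 * t23 * t3"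
       "(1 + t12 * t2) * (1 + t23 * t3) = 1 + t12 * t23 + t23 * t3 + t12 * t3"
    unfolding a using p(1) by (simp_all add: field_simps)
  then show "t1 = (t12 + t23 + t3 + t12 * t23 * t3) / (1 + t12 * t23 + t23 * t3 + t12 * t3)"
    unfolding t1 using p by (metis mult_divide_mult_cancel_right less_imp_neq)
qed

text \<open>The explicit inverse of the 3 x 3 Cauchy-type matrix, with its alternating signs,
  applied to the coefficients of \<open>L\<close>. Multiplied by \<sigma>, each row turns into one
  of the identities \<open>tanh_three_points\<close>.\<close>

lemma solve_system:
  defines "\<sigma> \<equiv> t1 * t2 * t3"
  defines "v1 \<equiv> s1 / (t12 * t13 * \<sigma>)" and "v2 \<equiv> - s2 / (t12 * t23 * \<sigma>)" and "v3 \<equiv> s3 / (t13 * t23 * \<sigma>)"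
  shows "v1 + v2 * c12 + v3 * c13 = s1 / t1" "v1 * c12 + v2 + v3 * c23 = s2 / t2" "v1 * c13 + v2 * c23 + v3 = s3 / t3"
proof -
  note pos = t_pos t4_pos
  note nz = pos[THEN less_imp_neq, symmetric]
  note id = tanh_three_points[of t12 t23 t3, folded tanh_rel, OF t_pos(1) t_pos(3) t4_pos(3)]
  have "(v1 + v2 * c12 + v3 * c13) * \<sigma> = s1 / (t12 * t13) - (c12 * s2) / (t12 * t23) + (c13 * s3) / (t13 * t23)"
    using nz by (simp add: v1_def v2_def v3_def \<sigma>_def divide_simps)
  also have "\<dots> = s1 / (t12 * t13) - (s1 * (t12 + t2) / t1) / (t12 * t23) + (s1 * (t13 + t3) / t1) / (t13 * t23)"
  proof -
    have "c12 * s2 = s1 * (t12 + t2) / t1" "c13 * s3 = s1 * (t13 + t3) / t1"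
      using rel4(1,2) nz by (simp_all only: eq_divide_eq) simp_all
    then show ?thesis by simp
  qed
  also have "s1 / (t12 * t13) - (s1 * (t12 + t2) / t1) / (t12 * t23) + (s1 * (t13 + t3) / t1) / (t13 * t23) =
     s1 * (1 / (t12 * t13) - (t12 + t2) / (t1 * t12 * t23) + (t13 + t3) / (t1 * t13 * t23))"
    by (simp add: algebra_simps)
  also have "\<dots> = s1 * (t2 * t3)"
    unfolding id ..
  finally have "((v1 + v2 * c12 + v3 * c13) * t1) * (t2 * t3) = s1 * (t2 * t3)"
    unfolding \<sigma>_def by (simp only: mult_ac)
  then have "(v1 + v2 * c12 + v3 * c13) * t1 = s1"
    using nz by simp
  then show "v1 + v2 * c12 + v3 * c13 = s1 / t1"
    using nz by (simp only: eq_divide_eq) simp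
  have "(v1 * c12 + v2 + v3 * c23) * \<sigma> = (s1 * c12) / (t12 * t13) - s2 / (t12 * t23) + (c23 * s3) / (t13 * t23)"
    using nz by (simp add: v1_def v2_def v3_def \<sigma>_def divide_simps)
  also have "\<dots> = s2 * (1 - t1 * t12) / (t12 * t13) - s2 / (t12 * t23) + s2 * (t23 + t3) / t2 / (t13 * t23)"
  proof -
    have "s1 * c12 = s2 * (1 - t1 * t12)" "c23 * s3 = s2 * (t23 + t3) / t2"
      using rel4(3,7) nz by (simp_all only: eq_divide_eq) simp_all
    then show ?thesis by simp
  qed
  also have "s2 * (1 - t1 * t12) / (t12 * t13) - s2 / (t12 * t23) + s2 * (t23 + t3) / t2 / (t13 * t23) =
     s2 * ((1 - t1 * t12) / (t12 * t13) - 1 / (t12 * t23) + (t23 + t3) / (t2 * t13 * t23))"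
    by (simp add: algebra_simps)
  also have "\<dots> = s2 * (t1 * t3)"
    unfolding id ..
  finally have "((v1 * c12 + v2 + v3 * c23) * t2) * (t1 * t3) = s2 * (t1 * t3)"
    unfolding \<sigma>_def by (simp only: mult_ac)
  then have "(v1 * c12 + v2 + v3 * c23) * t2 = s2"
    using nz by simp
  then show "v1 * c12 + v2 + v3 * c23 = s2 / t2"
    using nz by (simp only: eq_divide_eq) simp
  have "(v1 * c13 + v2 * c23 + v3) * \<sigma> = (s1 * c13) / (t12 * t13) - (s2 * c23) / (t12 * t23) + s3 / (t13 * t23)"
    using nz by (simp add: v1_def v2_def v3_def \<sigma>_def divide_simps)
  also have "\<dots> = s3 * (1 - t1 * t13) / (t12 * t13) - s3 * (1 - t2 * t23) / (t12 * t23) + s3 / (t13 * t23)"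
    using rel4(8,9) by simp
  also have "s3 * (1 - t1 * t13) / (t12 * t13) - s3 * (1 - t2 * t23) / (t12 * t23) + s3 / (t13 * t23) =
     s3 * ((1 - t1 * t13) / (t12 * t13) - (1 - t2 * t23) / (t12 * t23) + 1 / (t13 * t23))"
    by (simp add: algebra_simps)
  also have "\<dots> = s3 * (t1 * t2)"
    unfolding id ..
  finally have "((v1 * c13 + v2 * c23 + v3) * t3) * (t1 * t2) = s3 * (t1 * t2)"
    unfolding \<sigma>_def by (simp only: mult_ac)
  then have "(v1 * c13 + v2 * c23 + v3) * t3 = s3"
    using nz by simp
  then show "v1 * c13 + v2 * c23 + v3 = s3 / t3"
    using nz by (simp only: eq_divide_eq) simp
qed

text \<open>In the rescaled coordinates used below, \<open>L\<close> is the conditional mean of the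
  fourth value given the first three, divided by its conditional standard deviation
  \<open>t1 * t2 * t3\<close>. The companion \<open>L'\<close> is its derivative in u, as
  \<open>sech / tanh\<close> has derivative \<open>- sech / tanh\<^sup>2\<close>.\<close>

definition L :: "real \<times> real \<times> real \<Rightarrow> real" where "L = lin (s1 / t1) (s2 / t2) (s3 / t3)"

definition L' :: "real \<times> real \<times> real \<Rightarrow> real" where "L' = lin (- s1 / t1\<^sup>2) (- s2 / t2\<^sup>2) (- s3 / t3\<^sup>2)"

lemma integral_S3_L:
  "(LINT p|lborel. S3 p * L p * E3 p)
     = - 8 / (t12 * t13 * t23 * (t1 * t2 * t3)) * (s1 * A23 - s2 * A13 + s3 * A12)"
  unfolding L_def solve_system[symmetric] integral_lin
  using t_pos t4_pos by (simp add: divide_simps)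

lemma integrable_S3_L': "integrable lborel (\<lambda>p. S3 p * (2 * std_normal_density (L p) * L' p) * E3 p)"
proof (rule Bochner_Integration.integrable_bound)
  show "integrable lborel (\<lambda>p. 2 / sqrt (2 * pi) * (S3 p * L' p * E3 p))"
    unfolding L'_def by (intro integrable_mult_right integrable_lin)
  have "2 * std_normal_density (L p) \<le> 2 / sqrt (2 * pi)" for p
    using std_normal_density_le[of "L p"] by simp
  then have "2 * std_normal_density (L p) * \<bar>S3 p * L' p * E3 p\<bar> \<le> 2 / sqrt (2 * pi) * \<bar>S3 p * L' p * E3 p\<bar>" for p
    by (rule mult_right_mono) simp
  then show "AE p in lborel. norm (S3 p * (2 * std_normal_density (L p) * L' p) * E3 p) \<le> norm (2 / sqrt (2 * pi) * (S3 p * L' p * E3 p))"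
    by (intro AE_I2) (simp add: abs_mult mult_ac normal_density_nonneg)
qed (simp add: L_def L'_def)

text \<open>The effect of conditioning on a zero at u. Dividing coordinate i by
  \<open>tanh (u - u i)\<close> adds the rank-one form \<open>L\<^sup>2\<close> to the quadratic
  form, which is exactly the exponent of \<open>std_normal_density (L p)\<close>; at the same time
  \<open>L\<close> becomes \<open>- L'\<close>.\<close>

lemma scaled_integrand:
  "S3 (x / t1, y / t2, z / t3) * L (x / t1, y / t2, z / t3) * E3 (x / t1, y / t2, z / t3)
     = - (sqrt (2 * pi) / 2) * (S3 (x, y, z) * (2 * std_normal_density (L (x, y, z)) * L' (x, y, z)) * E3 (x, y, z))"
proof -
  note pos = t4_pos
  note nz = pos[THEN less_imp_neq, symmetric]
  have S: "S3 (x / t1, y / t2, z / t3) = S3 (x, y, z)"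
    using pos by (simp add: S3_def divide_inverse sgn_mult)
  have L: "L (x / t1, y / t2, z / t3) = - L' (x, y, z)"
    using nz by (simp add: L_def L'_def lin_def power2_eq_square)
  have sq: "1 / t1\<^sup>2 = 1 + (s1 / t1)\<^sup>2" "1 / t2\<^sup>2 = 1 + (s2 / t2)\<^sup>2" "1 / t3\<^sup>2 = 1 + (s3 / t3)\<^sup>2"
    using t4_square nz by (simp_all add: power_divide divide_simps)
  have mx: "c12 / (t1 * t2) = c12 + (s1 / t1) * (s2 / t2)" "c13 / (t1 * t3) = c13 + (s1 / t1) * (s3 / t3)"
      "c23 / (t2 * t3) = c23 + (s2 / t2) * (s3 / t3)"
    using rel4(4,5,6) nz by (simp_all add: divide_simps) (simp_all add: algebra_simps)
  have "(x / t1)\<^sup>2 + (y / t2)\<^sup>2 + (z / t3)\<^sup>2 + 2 * c12 * (x / t1) * (y / t2) + 2 * c13 * (x / t1) * (z / t3) + 2 * c23 * (y / t2) * (z / t3)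
     = (1 / t1\<^sup>2) * x\<^sup>2 + (1 / t2\<^sup>2) * y\<^sup>2 + (1 / t3\<^sup>2) * z\<^sup>2 + 2 * (c12 / (t1 * t2)) * x * y
       + 2 * (c13 / (t1 * t3)) * x * z + 2 * (c23 / (t2 * t3)) * y * z"
    by (simp add: power_divide)
  also have "\<dots> = (x\<^sup>2 + y\<^sup>2 + z\<^sup>2 + 2 * c12 * x * y + 2 * c13 * x * z + 2 * c23 * y * z) + (L (x, y, z))\<^sup>2"
    unfolding sq mx L_def lin_def fst_conv snd_conv by algebra
  finally have E: "E3 (x / t1, y / t2, z / t3) = E3 (x, y, z) * exp (- (L (x, y, z))\<^sup>2 / 2)"
    unfolding E3_def gauss3_def exp_add[symmetric] fst_conv snd_conv by (simp add: add_divide_distrib)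
  show ?thesis
    unfolding S L E by (simp add: std_normal_density_def)
qed

text \<open>The Jacobian of the dilation cancels the factor \<open>t1 * t2 * t3\<close> of
  \<open>integral_S3_L\<close>. So u enters only through the three \<open>sech\<close> values, which
  have the elementary primitive \<open>- gd_co\<close>.\<close>

lemma integral_S3_L':
  "(LINT p|lborel. S3 p * (2 * std_normal_density (L p) * L' p) * E3 p)
     = 16 / (sqrt (2 * pi) * (t12 * t13 * t23)) * (s1 * A23 - s2 * A13 + s3 * A12)"
proof -
  define f where "f p = S3 p * L p * E3 p" for p
  have sc: "f (1 / t1 * x, 1 / t2 * y, 1 / t3 * z) =
     - (sqrt (2 * pi) / 2) * (S3 (x, y, z) * (2 * std_normal_density (L (x, y, z)) * L' (x, y, z)) * E3 (x, y, z))" for x y z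
    using scaled_integrand[of x y z] by (simp add: f_def)
  have i1: "integrable lborel f"
    unfolding f_def L_def by (rule integrable_lin)
  have i2: "integrable lborel (\<lambda>(x, y, z). f (1 / t1 * x, 1 / t2 * y, 1 / t3 * z))"
  proof -
    have "(\<lambda>(x, y, z). f (1 / t1 * x, 1 / t2 * y, 1 / t3 * z)) =
        (\<lambda>p. - (sqrt (2 * pi) / 2) * (S3 p * (2 * std_normal_density (L p) * L' p) * E3 p))"
      using sc by (auto simp only: fun_eq_iff split_paired_all prod.case)
    then show ?thesis
      by (simp only: integrable_mult_right integrable_S3_L')
  qed
  have "integral\<^sup>L lborel f = 1 / t1 * (1 / t2) * (1 / t3) *
     (- (sqrt (2 * pi) / 2) * (LINT p|lborel. S3 p * (2 * std_normal_density (L p) * L' p) * E3 p))"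
  proof -
    have "(LINT p|lborel. (case p of (x, y, z) \<Rightarrow> f (1 / t1 * x, 1 / t2 * y, 1 / t3 * z))) =
        (LINT p|lborel. - (sqrt (2 * pi) / 2) * (S3 p * (2 * std_normal_density (L p) * L' p) * E3 p))"
      by (intro Bochner_Integration.integral_cong refl) (auto simp only: split_paired_all prod.case sc)
    then show ?thesis
      using integral_lborel3_scale[OF i1 i2] t4_pos by (simp only: integral_mult_right_zero) simp
  qed
  moreover have "integral\<^sup>L lborel f = - 8 / (t12 * t13 * t23 * (t1 * t2 * t3)) * (s1 * A23 - s2 * A13 + s3 * A12)"
    unfolding f_def by (rule integral_S3_L)
  ultimately show ?thesis
    using t_pos t4_pos by (simp add: divide_simps)
qed

end

end

section \<open>The differential equation in the fourth point\<close>

lemma sech_div_tanh_square: "sech x / (tanh x)\<^sup>2 = 1 / (tanh x * sinh x)"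
  by (simp add: sech_def tanh_def power2_eq_square)

lemma sech_div_tanh_deriv:
  assumes "0 < x"
  shows "((\<lambda>x. sech x / tanh x) has_real_derivative - sech x / (tanh x)\<^sup>2) (at x)"
proof -
  have "((\<lambda>x. 1 / sinh x) has_real_derivative - sech x / (tanh x)\<^sup>2) (at x)"
    using assms cosh_real_pos[of x]
    by (auto intro!: derivative_eq_intros simp: sech_def tanh_def field_simps power2_eq_square)
  then show ?thesis
    by (simp add: sech_div_tanh)
qed

lemma sech_div_tanh_square_le:
  assumes "0 < m" "m \<le> a"
  shows "\<bar>sech a / (tanh a)\<^sup>2\<bar> \<le> sech m / (tanh m)\<^sup>2"
proof -
  have "tanh m * sinh m \<le> tanh a * sinh a" "0 < tanh m * sinh m"
    using assms by (auto intro!: mult_mono)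
  then show ?thesis
    using assms by (simp add: sech_div_tanh_square frac_le)
qed

lemma tendsto_inverse_sinh: "((\<lambda>u. sech (u - c) / tanh (u - c)) \<longlongrightarrow> 0) at_top"
proof -
  have "filterlim (\<lambda>u. sinh (u - c)) at_top at_top"
  proof (rule filterlim_at_top_mono)
    show "filterlim (\<lambda>u. u + (- c)) at_top at_top"
      using filterlim_tendsto_add_at_top[OF tendsto_const[of "- c"] filterlim_ident] by (simp add: add.commute)
    have "x \<le> sinh x" if "0 \<le> x" for x :: real
    proof -
      have "sinh 0 - 0 \<le> sinh x - x"
      proof (rule DERIV_nonneg_imp_nondecreasing[OF that])
        fix y :: real
        have "((\<lambda>x. sinh x - x) has_real_derivative cosh y - 1) (at y)"
          by (auto intro!: derivative_eq_intros)
        then show "\<exists>D. ((\<lambda>x. sinh x - x) has_real_derivative D) (at y) \<and> 0 \<le> D"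
          using cosh_real_ge_1[of y] by auto
      qed
      then show ?thesis by simp
    qed
    then show "\<forall>\<^sub>F x in at_top. x + - c \<le> sinh (x - c)"
      by (intro eventually_mono[OF eventually_ge_at_top[of c]]) simp
  qed
  then have "((\<lambda>u. inverse (sinh (u - c))) \<longlongrightarrow> 0) at_top"
    by (rule tendsto_inverse_0_at_top)
  then show ?thesis
    unfolding sech_div_tanh by (simp add: inverse_eq_divide)
qed

lemma tendsto_gd_co_at_top: "((\<lambda>u. gd_co (u - c)) \<longlongrightarrow> 0) at_top"
proof -
  have "filterlim (\<lambda>u. - (u - c)) at_bot at_top"
    unfolding filterlim_uminus_at_top[symmetric]
    using filterlim_tendsto_add_at_top[OF tendsto_const[of "- c"] filterlim_ident] by (simp add: add.commute)
  then have "((\<lambda>u. exp (- (u - c))) \<longlongrightarrow> 0) at_top"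
    by (rule filterlim_compose[OF exp_at_bot])
  then have "((\<lambda>u. 2 * arctan (exp (- (u - c)))) \<longlongrightarrow> 2 * arctan 0) at_top"
    by (intro tendsto_intros)
  then show ?thesis
    by (simp add: gd_co_def)
qed

context three_points
begin

text \<open>The four-point sign correlation as a function of the last point, up to a factor free of
  u; the fourth variable has been integrated out into \<open>sgn_normal\<close>.\<close>

definition H :: "real \<Rightarrow> real" where
  "H u = (LINT p|lborel. S3 p * sgn_normal (L u p) * E3 p)"

lemma measurable_L [measurable]: "L u \<in> borel_measurable borel" if "u3 < u" for u
  unfolding L_def[OF that] by simp

lemma integrable_H:
  assumes u: "u3 < u"
  shows "integrable lborel (\<lambda>p. S3 p * sgn_normal (L u p) * E3 p)"
proof (rule integrable_E_bound[where C = 1])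
  note [measurable] = measurable_L[OF u]
  show "(\<lambda>p. S3 p * sgn_normal (L u p) * E3 p) \<in> borel_measurable borel"
    by measurable
  fix x y z
  have "\<bar>S3 (x, y, z) * sgn_normal (L u (x, y, z))\<bar> \<le> 1 * 1"
    unfolding abs_mult by (intro mult_mono abs_S3_le abs_sgn_normal_le) auto
  also have "\<dots> \<le> 1 * (1 + \<bar>x\<bar> + \<bar>y\<bar> + \<bar>z\<bar>)"
    by simp
  finally show "\<bar>S3 (x, y, z) * sgn_normal (L u (x, y, z)) * E3 (x, y, z)\<bar> \<le> 1 * (1 + \<bar>x\<bar> + \<bar>y\<bar> + \<bar>z\<bar>) * E x y z"
    using E_pos[of x y z] by (simp add: abs_mult[of _ "E _ _ _"] E3_def mult_right_mono)
qed

lemma DERIV_H: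
  assumes u: "u3 < u"
  shows "(H has_real_derivative 16 / (sqrt (2 * pi) * (t12 * t13 * t23)) *
            (sech (u - u1) * A23 - sech (u - u2) * A13 + sech (u - u3) * A12)) (at u)"
proof -
  \<comment> \<open>Within distance m of u every gap to the three points stays at least m. Since
    \<open>sech / tanh\<^sup>2\<close> decreases, its value \<open>K\<close> at m bounds all
    coefficients of \<open>L'\<close>.\<close>
  define m where "m = (u - u3) / 2"
  have m: "0 < m" using u by (simp add: m_def)
  define K where "K = sech m / (tanh m)\<^sup>2"
  have K: "0 < K" using m by (simp add: K_def sech_pos)
  have ux: "u3 < x" "m \<le> x - u1" "m \<le> x - u2" "m \<le> x - u3" if "\<bar>x - u\<bar> < m" for x
  proof -
    have "u - m < x"
      using that by (simp add: abs_less_iff)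
    moreover have "u - u3 = 2 * m"
      by (simp add: m_def)
    ultimately show "u3 < x" "m \<le> x - u1" "m \<le> x - u2" "m \<le> x - u3"
      using m u12 u23 by linarith+
  qed
  have "(H has_real_derivative (LINT p|lborel. S3 p * (2 * std_normal_density (L u p) * L' u p) * E3 p)) (at u)"
    unfolding H_def
  proof (rule DERIV_lebesgue_integral[where \<delta> = m and g = "\<lambda>p. K * (\<bar>fst p\<bar> + \<bar>fst (snd p)\<bar> + \<bar>snd (snd p)\<bar>) * E3 p"])
    show "integrable lborel (\<lambda>p. S3 p * sgn_normal (L x p) * E3 p)" if "\<bar>x - u\<bar> < m" for x
      using ux(1)[OF that] by (rule integrable_H)
    show "((\<lambda>x. S3 p * sgn_normal (L x p) * E3 p) has_real_derivative
        S3 p * (2 * std_normal_density (L x p) * L' x p) * E3 p) (at x)" if x: "\<bar>x - u\<bar> < m" for x p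
    proof -
      define l where "l x = fst p * (sech (x - u1) / tanh (x - u1)) + fst (snd p) * (sech (x - u2) / tanh (x - u2))
         + snd (snd p) * (sech (x - u3) / tanh (x - u3))" for x
      have x': "u3 < x" using ux[OF x] by simp
      have shift: "((\<lambda>x. sech (x - c) / tanh (x - c)) has_real_derivative - sech (x - c) / (tanh (x - c))\<^sup>2) (at x)"
        if "c < x" for c
      proof -
        have "((\<lambda>x. (\<lambda>y. sech y / tanh y) (x - c)) has_real_derivative - sech (x - c) / (tanh (x - c))\<^sup>2 * 1) (at x)"
          by (rule DERIV_chain2[where f = "\<lambda>y. sech y / tanh y", OF sech_div_tanh_deriv])
             (use that in \<open>auto intro!: derivative_eq_intros\<close>)
        then show ?thesis by simp
      qed
      have "(l has_real_derivative fst p * (- sech (x - u1) / (tanh (x - u1))\<^sup>2) + fst (snd p) * (- sech (x - u2) / (tanh (x - u2))\<^sup>2)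
         + snd (snd p) * (- sech (x - u3) / (tanh (x - u3))\<^sup>2)) (at x)"
        unfolding l_def using x' u12 u23 by (intro DERIV_add DERIV_cmult shift) auto
      also have "fst p * (- sech (x - u1) / (tanh (x - u1))\<^sup>2) + fst (snd p) * (- sech (x - u2) / (tanh (x - u2))\<^sup>2)
         + snd (snd p) * (- sech (x - u3) / (tanh (x - u3))\<^sup>2) = L' x p"
        unfolding L'_def[OF x'] lin_def s1_def[OF x'] s2_def[OF x'] s3_def[OF x'] t1_def[OF x'] t2_def[OF x'] t3_def[OF x']
        by (simp only: mult.commute)
      finally have "((\<lambda>x. S3 p * sgn_normal (l x) * E3 p) has_real_derivative
          S3 p * (2 * std_normal_density (l x) * L' x p) * E3 p) (at x)"
        by (intro DERIV_cmult DERIV_cmult_right DERIV_chain2[OF DERIV_sgn_normal])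
      \<comment> \<open>\<open>L\<close> is unfolded only under \<open>u3 < x\<close>, so the
        derivative is computed for the global expression \<open>l\<close> and transferred by
        agreement near the point.\<close>
      moreover have "l x = L x p" if "u3 < x" for x
        unfolding l_def L_def[OF that] lin_def s1_def[OF that] s2_def[OF that] s3_def[OF that] t1_def[OF that] t2_def[OF that] t3_def[OF that]
        by (simp only: mult.commute)
      moreover have "\<forall>\<^sub>F x in nhds x. u3 < x"
        using x' by (rule eventually_nhds_in_open[of "{u3<..}", simplified, rotated])
      ultimately show ?thesis
        using x' by (auto elim!: DERIV_cong_ev[OF refl _ refl, THEN iffD1, rotated] eventually_mono)
    qed
    show "\<bar>S3 p * (2 * std_normal_density (L x p) * L' x p) * E3 p\<bar>
        \<le> K * (\<bar>fst p\<bar> + \<bar>fst (snd p)\<bar> + \<bar>snd (snd p)\<bar>) * E3 p" if x: "\<bar>x - u\<bar> < m" for x p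
    proof -
      have d: "2 * std_normal_density (L x p) \<le> 1"
        using std_normal_density_le_half[of "L x p"] by simp
      have "\<bar>L' x p\<bar> \<le> K * \<bar>fst p\<bar> + K * \<bar>fst (snd p)\<bar> + K * \<bar>snd (snd p)\<bar>"
      proof -
        have c: "\<bar>sech a / (tanh a)\<^sup>2 * y\<bar> \<le> K * \<bar>y\<bar>" if "m \<le> a" for a y
          unfolding K_def abs_mult using sech_div_tanh_square_le[OF m that] by (rule mult_right_mono) simp
        have "L' x p = - (sech (x - u1) / (tanh (x - u1))\<^sup>2 * fst p) - (sech (x - u2) / (tanh (x - u2))\<^sup>2 * fst (snd p))
           - (sech (x - u3) / (tanh (x - u3))\<^sup>2 * snd (snd p))"
          using ux(1)[OF x] by (simp add: L'_def lin_def s1_def s2_def s3_def t1_def t2_def t3_def)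
        then show ?thesis
          using c[OF ux(2)[OF x], of "fst p"] c[OF ux(3)[OF x], of "fst (snd p)"] c[OF ux(4)[OF x], of "snd (snd p)"]
          by (simp only: abs_le_iff) linarith
      qed
      then have "\<bar>2 * std_normal_density (L x p) * L' x p\<bar> \<le> 1 * (K * (\<bar>fst p\<bar> + \<bar>fst (snd p)\<bar> + \<bar>snd (snd p)\<bar>))"
        unfolding abs_mult using d normal_density_nonneg[of 0 1 "L x p"]
        by (intro mult_mono) (auto simp: algebra_simps)
      then have "\<bar>S3 p\<bar> * \<bar>2 * std_normal_density (L x p) * L' x p\<bar> \<le> 1 * (1 * (K * (\<bar>fst p\<bar> + \<bar>fst (snd p)\<bar> + \<bar>snd (snd p)\<bar>)))"
        by (intro mult_mono abs_S3_le) auto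
      from mult_right_mono[OF this less_imp_le[OF E_pos[of "fst p" "fst (snd p)" "snd (snd p)"]]]
      show ?thesis
        using E_pos[of "fst p" "fst (snd p)" "snd (snd p)"] by (simp add: abs_mult E3_def)
    qed
    show "integrable lborel (\<lambda>p. K * (\<bar>fst p\<bar> + \<bar>fst (snd p)\<bar> + \<bar>snd (snd p)\<bar>) * E3 p)"
    proof (rule integrable_E_bound[where C = K])
      show "(\<lambda>p. K * (\<bar>fst p\<bar> + \<bar>fst (snd p)\<bar> + \<bar>snd (snd p)\<bar>) * E3 p) \<in> borel_measurable borel"
        unfolding borel_prod[symmetric] by (measurable) (simp_all add: borel_prod)
      show "\<bar>K * (\<bar>fst (x, y, z)\<bar> + \<bar>fst (snd (x, y, z))\<bar> + \<bar>snd (snd (x, y, z))\<bar>) * E3 (x, y, z)\<bar> \<le>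
         K * (1 + \<bar>x\<bar> + \<bar>y\<bar> + \<bar>z\<bar>) * E x y z" for x y z
        using K E_pos[of x y z] by (simp add: abs_mult E3_def)
    qed
  qed (use m in simp)
  then show ?thesis
    unfolding integral_S3_L'[OF u] s1_def[OF u] s2_def[OF u] s3_def[OF u] .
qed

text \<open>A distant fourth point decorrelates: \<open>L\<close> tends to 0 and
  \<open>sgn_normal 0 = 0\<close>. This fixes the constant of integration; a sequence suffices for
  that.\<close>

lemma H_tendsto_0: "(\<lambda>n. H (u3 + 1 + real n)) \<longlonglongrightarrow> 0"
proof -
  define v where "v n = u3 + 1 + real n" for n
  have v: "u3 < v n" for n by (simp add: v_def)
  have v_top: "filterlim v at_top sequentially"
    unfolding v_def by (intro filterlim_tendsto_add_at_top[OF tendsto_const] filterlim_real_sequentially)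
  have "(\<lambda>n. H (v n)) \<longlonglongrightarrow> (LINT p|(lborel :: (real \<times> real \<times> real) measure). 0)"
    unfolding H_def
  proof (rule integral_dominated_convergence[where w = E3])
    show "(\<lambda>p. S3 p * sgn_normal (L (v n) p) * E3 p) \<in> borel_measurable lborel" for n
      using integrable_H[OF v] by (rule borel_measurable_integrable)
    show "integrable lborel E3"
      by (rule integrable_E_bound[where C = 1]) (auto simp: E3_def gauss3_def)
    show "AE p in lborel. (\<lambda>n. S3 p * sgn_normal (L (v n) p) * E3 p) \<longlonglongrightarrow> 0"
    proof (rule AE_I2)
      fix p :: "real \<times> real \<times> real"
      have "(\<lambda>n. sech (v n - c) / tanh (v n - c)) \<longlonglongrightarrow> 0" for c
        by (rule filterlim_compose[OF tendsto_inverse_sinh v_top])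
      then have "(\<lambda>n. sech (v n - u1) / tanh (v n - u1) * fst p + sech (v n - u2) / tanh (v n - u2) * fst (snd p)
          + sech (v n - u3) / tanh (v n - u3) * snd (snd p)) \<longlonglongrightarrow> 0 * fst p + 0 * fst (snd p) + 0 * snd (snd p)"
        by (intro tendsto_intros)
      then have "(\<lambda>n. L (v n) p) \<longlonglongrightarrow> 0"
        using v by (simp add: L_def lin_def s1_def s2_def s3_def t1_def t2_def t3_def)
      then have "(\<lambda>n. sgn_normal (L (v n) p)) \<longlonglongrightarrow> sgn_normal 0"
        by (rule isCont_tendsto_compose[OF continuous_sgn_normal])
      then have "(\<lambda>n. S3 p * sgn_normal (L (v n) p) * E3 p) \<longlonglongrightarrow> S3 p * 0 * E3 p"
        by (intro tendsto_intros) simp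
      then show "(\<lambda>n. S3 p * sgn_normal (L (v n) p) * E3 p) \<longlonglongrightarrow> 0"
        by simp
    qed
    show "AE p in lborel. norm (S3 p * sgn_normal (L (v n) p) * E3 p) \<le> E3 p" for n
    proof (rule AE_I2)
      fix p :: "real \<times> real \<times> real"
      have "\<bar>S3 p * sgn_normal (L (v n) p)\<bar> \<le> 1 * 1"
        unfolding abs_mult by (intro mult_mono abs_S3_le abs_sgn_normal_le) auto
      then show "norm (S3 p * sgn_normal (L (v n) p) * E3 p) \<le> E3 p"
        using mult_right_mono[of "\<bar>S3 p * sgn_normal (L (v n) p)\<bar>" 1 "E3 p"]
        by (simp add: abs_mult E3_def gauss3_def)
    qed
  qed auto
  then show ?thesis
    by (simp add: v_def)
qed

text \<open>The difference of the two sides has derivative 0 on the half-line beyond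
  \<open>u3\<close> and tends to 0 along a sequence.\<close>

lemma H_eq:
  assumes u: "u3 < u"
  shows "H u = - 16 / (sqrt (2 * pi) * (t12 * t13 * t23)) *
            (A12 * gd_co (u - u3) - A13 * gd_co (u - u2) + A23 * gd_co (u - u1))"
proof -
  define \<kappa> where "\<kappa> = 16 / (sqrt (2 * pi) * (t12 * t13 * t23))"
  define D where "D u = H u + \<kappa> * (A12 * gd_co (u - u3) - A13 * gd_co (u - u2) + A23 * gd_co (u - u1))" for u
  have "\<exists>c. \<forall>x\<in>{u3<..}. D x = c"
  proof (rule has_field_derivative_zero_constant)
    show "convex {u3<..}"
      by simp
    fix x assume "x \<in> {u3<..}"
    then have x: "u3 < x" by simp
    have "(D has_real_derivative 0) (at x)"
      unfolding D_def \<kappa>_def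
      by (rule derivative_eq_intros DERIV_H[OF x] refl)+ (simp add: sech_def algebra_simps)
    then show "(D has_real_derivative 0) (at x within {u3<..})"
      by (rule has_field_derivative_at_within)
  qed
  then obtain c where c: "\<And>x. u3 < x \<Longrightarrow> D x = c"
    by auto
  have v_top: "filterlim (\<lambda>n. u3 + 1 + real n) at_top sequentially"
    by (intro filterlim_tendsto_add_at_top[OF tendsto_const] filterlim_real_sequentially)
  have "(\<lambda>n. D (u3 + 1 + real n)) \<longlonglongrightarrow> 0 + \<kappa> * (A12 * 0 - A13 * 0 + A23 * 0)"
    unfolding D_def
    by (intro tendsto_intros H_tendsto_0 filterlim_compose[OF tendsto_gd_co_at_top v_top])
  moreover have "D (u3 + 1 + real n) = c" for n
    by (rule c) simp
  ultimately have "(\<lambda>n::nat. c) \<longlonglongrightarrow> 0"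
    by simp
  then have "c = 0"
    by (simp add: LIMSEQ_const_iff)
  with c[OF u] show ?thesis
    by (simp add: D_def \<kappa>_def)
qed

lemma four_sign_integral:
  assumes u: "u3 < u"
  defines "N \<equiv> std_normal_distribution"
  shows "(LINT a|N. LINT b|N. LINT c|N. LINT d|N.
      sgn a * sgn (c12 * a + t12 * b) * sgn (c13 * a + t13 * c23 * b + t13 * t23 * c)
        * sgn (s1 u * a + t1 u * s2 u * b + t1 u * t2 u * s3 u * c + t1 u * t2 u * t3 u * d))
    = 4 / pi\<^sup>2 * (A12 * gd_co (u - u3) - A13 * gd_co (u - u2) + A23 * gd_co (u - u1))"
proof -
  note pos = t_pos t4_pos[OF u]
  define \<sigma> where "\<sigma> = t1 u * t2 u * t3 u"
  have \<sigma>: "0 < \<sigma>" using pos by (simp add: \<sigma>_def)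
  define k where "k a b c = sgn a * sgn (c12 * a + t12 * b) * sgn (c13 * a + t13 * c23 * b + t13 * t23 * c)
      * sgn_normal ((s1 u * a + t1 u * s2 u * b + t1 u * t2 u * s3 u * c) / \<sigma>)" for a b c
  have [measurable]: "(\<lambda>(a, b, c). k a b c) \<in> borel_measurable (borel \<Otimes>\<^sub>M (borel \<Otimes>\<^sub>M borel))"
    unfolding k_def by measurable
  have inner: "(LINT d|N. sgn a * sgn (c12 * a + t12 * b) * sgn (c13 * a + t13 * c23 * b + t13 * t23 * c)
        * sgn (s1 u * a + t1 u * s2 u * b + t1 u * t2 u * s3 u * c + t1 u * t2 u * t3 u * d)) = k a b c" for a b c
    unfolding N_def k_def integral_mult_right_zero \<sigma>_def[symmetric] integral_sgn_affine[OF \<sigma>] ..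
  define \<phi> where "\<phi> = std_normal_density"
  have [measurable]: "\<phi> \<in> borel_measurable borel"
    by (simp add: \<phi>_def)
  have I3: "(LINT c|N. k a b c) = (LINT c|lborel. \<phi> c * k a b c)" for a b
    unfolding N_def \<phi>_def by (rule integral_std_normal) measurable
  have I2: "(LINT b|N. LINT c|lborel. \<phi> c * k a b c) = (LINT b|lborel. \<phi> b * (LINT c|lborel. \<phi> c * k a b c))" for a
    unfolding N_def \<phi>_def by (rule integral_std_normal) (unfold k_def, measurable)
  have I1: "(LINT a|N. LINT b|lborel. \<phi> b * (LINT c|lborel. \<phi> c * k a b c)) =
      (LINT a|lborel. \<phi> a * (LINT b|lborel. \<phi> b * (LINT c|lborel. \<phi> c * k a b c)))"
    unfolding N_def \<phi>_def by (rule integral_std_normal) (unfold k_def, measurable)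
  \<comment> \<open>The substitution is triangular and is made from the outermost variable inwards.
    The Jacobians are \<open>t12 * t13\<close>, the modulus of \<open>- t23\<close>, and 1.\<close>
  have T1: "(LINT a|lborel. f a) = t12 * t13 * (LINT x|lborel. f (\<eta>1 x))" for f :: "real \<Rightarrow> real"
    using pos by (subst lborel_integral_real_affine[where c = "t12 * t13" and t = 0]) (auto simp: \<eta>1_def)
  have T2: "(LINT b|lborel. f b) = t23 * (LINT y|lborel. f (\<eta>2 x y))" for f :: "real \<Rightarrow> real" and x
    using pos by (subst lborel_integral_real_affine[where c = "- t23" and t = "- (c12 * t13 * x)"]) (auto simp: \<eta>2_def)
  have T3: "(LINT c|lborel. f c) = (LINT z|lborel. f (\<eta>3 x y z))" for f :: "real \<Rightarrow> real" and x y
    by (subst lborel_integral_real_affine[where c = 1 and t = "c23 * y + c13 * x"]) (auto simp: \<eta>3_def)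
  have "(LINT a|lborel. \<phi> a * (LINT b|lborel. \<phi> b * (LINT c|lborel. \<phi> c * k a b c))) =
      t12 * t13 * (LINT x|lborel. \<phi> (\<eta>1 x) * (t23 * (LINT y|lborel. \<phi> (\<eta>2 x y) *
         (LINT z|lborel. \<phi> (\<eta>3 x y z) * k (\<eta>1 x) (\<eta>2 x y) (\<eta>3 x y z)))))"
  proof -
    have 3: "(LINT c|lborel. \<phi> c * k (\<eta>1 x) (\<eta>2 x y) c) =
        (LINT z|lborel. \<phi> (\<eta>3 x y z) * k (\<eta>1 x) (\<eta>2 x y) (\<eta>3 x y z))" for x y
      by (rule T3)
    have 2: "(LINT b|lborel. \<phi> b * (LINT c|lborel. \<phi> c * k (\<eta>1 x) b c)) =
        t23 * (LINT y|lborel. \<phi> (\<eta>2 x y) * (LINT z|lborel. \<phi> (\<eta>3 x y z) * k (\<eta>1 x) (\<eta>2 x y) (\<eta>3 x y z)))" for x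
      unfolding T2[of "\<lambda>b. \<phi> b * (LINT c|lborel. \<phi> c * k (\<eta>1 x) b c)" x]

      by (simp only: 3)
    show ?thesis
      unfolding T1[of "\<lambda>a. \<phi> a * (LINT b|lborel. \<phi> b * (LINT c|lborel. \<phi> c * k a b c))"] 2 ..
  qed
  also have "\<dots> = t12 * t13 * t23 * (LINT x|lborel. LINT y|lborel. LINT z|lborel.
      \<phi> (\<eta>1 x) * \<phi> (\<eta>2 x y) * \<phi> (\<eta>3 x y z) * k (\<eta>1 x) (\<eta>2 x y) (\<eta>3 x y z))"
    by (simp only: mult.assoc mult.left_commute[of _ t23] integral_mult_right_zero)
  also have "\<dots> = t12 * t13 * t23 * (LINT x|lborel. LINT y|lborel. LINT z|lborel.
      - 1 / (2 * pi * sqrt (2 * pi)) * (S3 (x, y, z) * sgn_normal (L u (x, y, z)) * E3 (x, y, z)))"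
  proof -
    have "\<phi> (\<eta>1 x) * \<phi> (\<eta>2 x y) * \<phi> (\<eta>3 x y z) * k (\<eta>1 x) (\<eta>2 x y) (\<eta>3 x y z) =
        - 1 / (2 * pi * sqrt (2 * pi)) * (S3 (x, y, z) * sgn_normal (L u (x, y, z)) * E3 (x, y, z))" for x y z
    proof -
      \<comment> \<open>The first three process values become \<open>t12 * t13 * x\<close>,
        \<open>- (t12 * t23 * y)\<close> and \<open>t13 * t23 * z\<close>. The single minus sign
        cancels the one in \<open>H_eq\<close>.\<close>
      have x2: "c12 * \<eta>1 x + t12 * \<eta>2 x y = (t12 * t23) * - y"
        by (simp add: \<eta>1_def \<eta>2_def algebra_simps)
      have "c13 * \<eta>1 x + t13 * c23 * \<eta>2 x y + t13 * t23 * \<eta>3 x y z =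
          (c13 * (t12 + t23) - c12 * c23 * t13) * (t13 * x) + t13 * t23 * z"
        by (simp add: \<eta>1_def \<eta>2_def \<eta>3_def algebra_simps)
      then have x3: "c13 * \<eta>1 x + t13 * c23 * \<eta>2 x y + t13 * t23 * \<eta>3 x y z = (t13 * t23) * z"
        by (simp add: rel_add)
      have "s1 u * \<eta>1 x + t1 u * s2 u * \<eta>2 x y + t1 u * t2 u * s3 u * \<eta>3 x y z =
         (s1 u * t12 * t13 - (c12 * s2 u * t1 u) * t13 + (c13 * s3 u * t1 u) * t2 u) * x
          + t1 u * (c23 * s3 u * t2 u - s2 u * t23) * y + t1 u * t2 u * s3 u * z"
        by (simp add: \<eta>1_def \<eta>2_def \<eta>3_def algebra_simps)
      also have "\<dots> = t2 u * t3 u * s1 u * x + t1 u * t3 u * s2 u * y + t1 u * t2 u * s3 u * z"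
        unfolding rel4[OF u] by (simp add: algebra_simps)
      also have "\<dots> = \<sigma> * L u (x, y, z)"
        using pos by (simp add: \<sigma>_def L_def[OF u] lin_def field_simps)
      finally have "(s1 u * \<eta>1 x + t1 u * s2 u * \<eta>2 x y + t1 u * t2 u * s3 u * \<eta>3 x y z) / \<sigma> = L u (x, y, z)"
        using \<sigma> by simp
      then have k: "k (\<eta>1 x) (\<eta>2 x y) (\<eta>3 x y z) = - (S3 (x, y, z) * sgn_normal (L u (x, y, z)))"
        unfolding k_def x2 x3 using pos by (simp add: sgn_mult S3_def \<eta>1_def)
      have "E3 (x, y, z) = exp (- (\<eta>1 x)\<^sup>2 / 2) * (exp (- (\<eta>2 x y)\<^sup>2 / 2) * exp (- (\<eta>3 x y z)\<^sup>2 / 2))"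
        unfolding E3_def gauss3_def fst_conv snd_conv sum_squares exp_add[symmetric] by (simp add: add_divide_distrib diff_divide_distrib)
      then have "\<phi> (\<eta>1 x) * \<phi> (\<eta>2 x y) * \<phi> (\<eta>3 x y z) = 1 / (2 * pi * sqrt (2 * pi)) * E3 (x, y, z)"
        by (simp add: \<phi>_def std_normal_density_def)
      then show ?thesis
        unfolding k by simp
    qed
    then show ?thesis by (simp only:)
  qed
  also have "\<dots> = t12 * t13 * t23 * (- 1 / (2 * pi * sqrt (2 * pi)) * H u)"
    unfolding H_def integral_lborel3_xyz[OF integrable_H[OF u]] by (simp only: integral_mult_right_zero)
  also have "\<dots> = 4 / pi\<^sup>2 * (A12 * gd_co (u - u3) - A13 * gd_co (u - u2) + A23 * gd_co (u - u1))"
  proof -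
    have "sqrt (2 * pi) * sqrt (2 * pi) = 2 * pi"
      by simp
    then show ?thesis
      unfolding H_eq[OF u] using pos by (simp add: divide_simps power2_eq_square)
  qed
  finally show ?thesis
    unfolding inner I3 I2 I1 .
qed

end

subsection \<open>Uniqueness of multivariate characteristic functions\<close>

lemma (in finite_measure) integrable_bounded:
  fixes f :: "'a \<Rightarrow> 'b::{banach, second_countable_topology}"
  assumes "f \<in> borel_measurable M" "\<And>x. norm (f x) \<le> B"
  shows "integrable M f"
  using assms by (intro integrable_const_bound[where B = B]) auto

lemma integral_re_im:
  assumes "integrable M f" "integrable M g"
  shows "(CLINT x|M. complex_of_real (f x) + \<i> * complex_of_real (g x)) =
    complex_of_real (integral\<^sup>L M f) + \<i> * complex_of_real (integral\<^sup>L M g)"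
  using assms by simp

text \<open>Divided by their common total c, which is read off at t = 0, the weights become
  densities of probability measures, to which Levy's uniqueness theorem applies. If c = 0, both
  sides vanish.\<close>

lemma levy_weighted:
  fixes X :: "'a \<Rightarrow> real" and X' :: "'b \<Rightarrow> real"
  assumes "finite_measure M" "finite_measure N"
    and [measurable]: "X \<in> borel_measurable M" "X' \<in> borel_measurable N"
    and [measurable]: "w \<in> borel_measurable M" "w' \<in> borel_measurable N"
    and w: "\<And>x. 0 \<le> w x" "\<And>x. w x \<le> B" and w': "\<And>x. 0 \<le> w' x" "\<And>x. w' x \<le> B"
    and eq: "\<And>t. (CLINT x|M. complex_of_real (w x) * iexp (t * X x)) = (CLINT x|N. complex_of_real (w' x) * iexp (t * X' x))"
    and [measurable]: "A \<in> sets borel"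
  shows "(LINT x|M. w x * indicator A (X x)) = (LINT x|N. w' x * indicator A (X' x))"
proof -
  interpret M: finite_measure M by fact
  interpret N: finite_measure N by fact
  have B0: "0 \<le> B"
    by (rule order_trans[OF w(1) w(2)])
  have iw: "integrable M w" "integrable M (\<lambda>x. w x * indicator A (X x))"
    using w B0 by (auto intro!: M.integrable_bounded[where B = B] split: split_indicator intro: order_trans)
  have iw': "integrable N w'" "integrable N (\<lambda>x. w' x * indicator A (X' x))"
    using w' B0 by (auto intro!: N.integrable_bounded[where B = B] split: split_indicator intro: order_trans)
  define c where "c = integral\<^sup>L M w"
  have c': "c = integral\<^sup>L N w'"
  proof -
    have "complex_of_real (integral\<^sup>L M w) = complex_of_real (integral\<^sup>L N w')"
      using eq[of 0] by (simp add: integral_complex_of_real[symmetric] del: integral_complex_of_real)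
    then show ?thesis by (simp add: c_def)
  qed
  have c0: "0 \<le> c"
    unfolding c_def using w by simp
  show ?thesis
  proof (cases "c = 0")
    case True
    have "(LINT x|M. w x * indicator A (X x)) \<le> c"
      unfolding c_def using iw w by (auto intro!: integral_mono split: split_indicator)
    moreover have "(LINT x|N. w' x * indicator A (X' x)) \<le> c"
      unfolding c' using iw' w' by (auto intro!: integral_mono split: split_indicator)
    moreover have "0 \<le> (LINT x|M. w x * indicator A (X x))" "0 \<le> (LINT x|N. w' x * indicator A (X' x))"
      using w w' by simp_all
    ultimately show ?thesis
      using True by simp
  next
    case False
    with c0 have c: "0 < c" by simp
    define \<mu> where "\<mu> = distr (density M (\<lambda>x. w x / c)) borel X"
    define \<nu> where "\<nu> = distr (density N (\<lambda>x. w' x / c)) borel X'"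
    have pM: "prob_space (density M (\<lambda>x. w x / c))"
    proof
      have "emeasure (density M (\<lambda>x. w x / c)) (space M) = (\<integral>\<^sup>+x. ennreal (w x / c) \<partial>M)"
        by (subst emeasure_density) (auto intro!: nn_integral_cong)
      also have "\<dots> = ennreal (LINT x|M. w x / c)"
        using iw w c by (intro nn_integral_eq_integral) auto
      also have "\<dots> = 1"
        using c by (simp add: c_def)
      finally show "emeasure (density M (\<lambda>x. w x / c)) (space (density M (\<lambda>x. w x / c))) = 1"
        by simp
    qed
    have pN: "prob_space (density N (\<lambda>x. w' x / c))"
    proof
      have "emeasure (density N (\<lambda>x. w' x / c)) (space N) = (\<integral>\<^sup>+x. ennreal (w' x / c) \<partial>N)"
        by (subst emeasure_density) (auto intro!: nn_integral_cong)
      also have "\<dots> = ennreal (LINT x|N. w' x / c)"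
        using iw' w' c by (intro nn_integral_eq_integral) auto
      also have "\<dots> = 1"
        using c by (simp add: c')
      finally show "emeasure (density N (\<lambda>x. w' x / c)) (space (density N (\<lambda>x. w' x / c))) = 1"
        by simp
    qed
    have "real_distribution \<mu>" "real_distribution \<nu>"
      unfolding \<mu>_def \<nu>_def
      using prob_space.real_distribution_distr[OF pM, of X] prob_space.real_distribution_distr[OF pN, of X'] by auto
    moreover have "char \<mu> = char \<nu>"
    proof
      fix t
      have "char \<mu> t = (CLINT x|M. (w x / c) *\<^sub>R iexp (t * X x))"
        unfolding char_def \<mu>_def using w c by (simp add: integral_distr integral_density)
      also have "\<dots> = (CLINT x|M. complex_of_real (1 / c) * (complex_of_real (w x) * iexp (t * X x)))"
        by (intro Bochner_Integration.integral_cong) (auto simp: scaleR_conv_of_real)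
      also have "\<dots> = (CLINT x|N. complex_of_real (1 / c) * (complex_of_real (w' x) * iexp (t * X' x)))"
        by (simp only: integral_mult_right_zero eq)
      also have "\<dots> = (CLINT x|N. (w' x / c) *\<^sub>R iexp (t * X' x))"
        by (intro Bochner_Integration.integral_cong) (auto simp: scaleR_conv_of_real)
      also have "\<dots> = char \<nu> t"
        unfolding char_def \<nu>_def using w' c by (simp add: integral_distr integral_density)
      finally show "char \<mu> t = char \<nu> t" .
    qed
    ultimately have "\<mu> = \<nu>"
      by (rule Levy_uniqueness)
    then have "(LINT x|\<mu>. indicator A x) = (LINT x|\<nu>. indicat_real A x)"
      by simp
    then have "(LINT x|M. w x / c * indicator A (X x)) = (LINT x|N. w' x / c * indicator A (X' x))"
      unfolding \<mu>_def \<nu>_def using w w' c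
      by (simp add: integral_distr integral_density del: Bochner_Integration.integral_indicator)
    then show ?thesis
      using c by simp
  qed
qed

text \<open>Rectangles form an intersection-stable generator, on which the two weighted image
  measures are finite and agree.\<close>

lemma rectangle_weighted:
  assumes "finite_measure M" "finite_measure N"
    and X[measurable]: "X \<in> M \<rightarrow>\<^sub>M R" "X' \<in> N \<rightarrow>\<^sub>M R" and Z[measurable]: "Z \<in> M \<rightarrow>\<^sub>M S" "Z' \<in> N \<rightarrow>\<^sub>M S"
    and [measurable]: "w \<in> borel_measurable M" "w' \<in> borel_measurable N"
    and w: "\<And>x. 0 \<le> w x" "\<And>x. w x \<le> B" and w': "\<And>x. 0 \<le> w' x" "\<And>x. w' x \<le> B"
    and eq: "\<And>A B. A \<in> sets R \<Longrightarrow> B \<in> sets S \<Longrightarrow>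
      (LINT x|M. w x * indicator B (Z x) * indicator A (X x)) = (LINT x|N. w' x * indicator B (Z' x) * indicator A (X' x))"
    and C: "C \<in> sets (R \<Otimes>\<^sub>M S)"
  shows "(LINT x|M. w x * indicator C (X x, Z x)) = (LINT x|N. w' x * indicat_real C (X' x, Z' x))"
proof -
  interpret M: finite_measure M by fact
  interpret N: finite_measure N by fact
  have B0: "0 \<le> B"
    by (rule order_trans[OF w(1) w(2)])
  define \<mu> where "\<mu> = distr (density M w) (R \<Otimes>\<^sub>M S) (\<lambda>x. (X x, Z x))"
  define \<nu> where "\<nu> = distr (density N w') (R \<Otimes>\<^sub>M S) (\<lambda>x. (X' x, Z' x))"
  have e\<mu>: "emeasure \<mu> C = ennreal (LINT x|M. w x * indicator C (X x, Z x))" if [measurable]: "C \<in> sets (R \<Otimes>\<^sub>M S)" for C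
  proof -
    have "integrable M (\<lambda>x. w x * indicator C (X x, Z x))"
      using w B0 by (auto intro!: M.integrable_bounded[where B = B] split: split_indicator intro: order_trans)
    then show ?thesis
      using w unfolding \<mu>_def
      by (auto simp: emeasure_distr emeasure_density nn_integral_eq_integral[symmetric]
          intro!: nn_integral_cong split: split_indicator)
  qed
  have e\<nu>: "emeasure \<nu> C = ennreal (LINT x|N. w' x * indicator C (X' x, Z' x))" if [measurable]: "C \<in> sets (R \<Otimes>\<^sub>M S)" for C
  proof -
    have "integrable N (\<lambda>x. w' x * indicator C (X' x, Z' x))"
      using w' B0 by (auto intro!: N.integrable_bounded[where B = B] split: split_indicator intro: order_trans)
    then show ?thesis
      using w' unfolding \<nu>_def
      by (auto simp: emeasure_distr emeasure_density nn_integral_eq_integral[symmetric]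
          intro!: nn_integral_cong split: split_indicator)
  qed
  let ?E = "{A \<times> B | A B. A \<in> sets R \<and> B \<in> sets S}"
  have "\<mu> = \<nu>"
  proof (rule measure_eqI_generator_eq[where E = ?E and \<Omega> = "space R \<times> space S" and A = "\<lambda>_. space R \<times> space S"])
    show "Int_stable ?E"
      by (rule Int_stable_pair_measure_generator)
    show "?E \<subseteq> Pow (space R \<times> space S)"
      by (rule pair_measure_closed)
    show "sets \<mu> = sigma_sets (space R \<times> space S) ?E" "sets \<nu> = sigma_sets (space R \<times> space S) ?E"
      by (simp_all add: \<mu>_def \<nu>_def sets_pair_measure)
    show "range (\<lambda>_. space R \<times> space S) \<subseteq> ?E" "(\<Union>i. space R \<times> space S) = space R \<times> space S"
      by auto
    show "emeasure \<mu> (space R \<times> space S) \<noteq> \<infinity>" for i :: nat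
      by (subst e\<mu>) auto
    fix D assume "D \<in> ?E"
    then obtain A B where D: "D = A \<times> B" "A \<in> sets R" "B \<in> sets S"
      by auto
    have "indicator D (x, z) = (indicator B z * indicator A x :: real)" for x z
      by (simp add: D split: split_indicator)
    then show "emeasure \<mu> D = emeasure \<nu> D"
      using eq[OF D(2,3)] D by (subst e\<mu>, simp, subst e\<nu>, simp) (simp add: mult.assoc)
  qed
  then have "ennreal (LINT x|M. w x * indicator C (X x, Z x)) = ennreal (LINT x|N. w' x * indicator C (X' x, Z' x))"
    using e\<mu>[OF C] e\<nu>[OF C] by simp
  then show ?thesis
    using w w' by (subst (asm) ennreal_inj) auto
qed

text \<open>For each D the indicator of \<open>Z\<close> in D is absorbed into the weight of
  \<open>levy_weighted\<close>; this settles rectangles.\<close>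

lemma char_weighted:
  fixes X :: "'a \<Rightarrow> real" and X' :: "'b \<Rightarrow> real"
  assumes fin: "finite_measure M" "finite_measure N"
    and [measurable]: "X \<in> borel_measurable M" "X' \<in> borel_measurable N" "Z \<in> M \<rightarrow>\<^sub>M S" "Z' \<in> N \<rightarrow>\<^sub>M S"
    and [measurable]: "w \<in> borel_measurable M" "w' \<in> borel_measurable N"
    and w: "\<And>x. 0 \<le> w x" "\<And>x. w x \<le> B" and w': "\<And>x. 0 \<le> w' x" "\<And>x. w' x \<le> B"
    and eq: "\<And>t D. D \<in> sets S \<Longrightarrow> (CLINT x|M. complex_of_real (w x * indicator D (Z x)) * iexp (t * X x)) =
        (CLINT x|N. complex_of_real (w' x * indicator D (Z' x)) * iexp (t * X' x))"
    and C: "C \<in> sets (borel \<Otimes>\<^sub>M S)"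
  shows "(LINT x|M. w x * indicator C (X x, Z x)) = (LINT x|N. w' x * indicat_real C (X' x, Z' x))"
proof (rule rectangle_weighted[OF fin _ _ _ _ _ _ w w' _ C])
  fix A :: "real set" and D assume [measurable]: "A \<in> sets borel" "D \<in> sets S"
  show "(LINT x|M. w x * indicator D (Z x) * indicator A (X x)) = (LINT x|N. w' x * indicator D (Z' x) * indicator A (X' x))"
    by (rule levy_weighted[OF fin, where B = B])
       (use w w' eq in \<open>auto split: split_indicator intro: order_trans\<close>)
qed measurable

text \<open>If the joint transform is known with \<open>X\<close> in exponential form, then \<open>X\<close> can be replaced by
  the indicator of an event: the weights \<open>1 + cos \<theta>\<close> and \<open>1 + sin \<theta>\<close> are nonnegative,
  so that the one-dimensional uniqueness theorem applies to them.\<close>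

lemma char_step:
  fixes X \<theta> :: "'a \<Rightarrow> real" and X' \<theta>' :: "'b \<Rightarrow> real"
  assumes fin: "finite_measure M" "finite_measure N"
    and XZ[measurable]: "X \<in> borel_measurable M" "X' \<in> borel_measurable N" "Z \<in> M \<rightarrow>\<^sub>M S" "Z' \<in> N \<rightarrow>\<^sub>M S"
    and [measurable]: "\<theta> \<in> borel_measurable M" "\<theta>' \<in> borel_measurable N"
    and eq: "\<And>t r D. D \<in> sets S \<Longrightarrow> (CLINT x|M. complex_of_real (indicator D (Z x)) * iexp (t * X x + r * \<theta> x)) =
        (CLINT x|N. complex_of_real (indicator D (Z' x)) * iexp (t * X' x + r * \<theta>' x))"
    and C[measurable]: "C \<in> sets (borel \<Otimes>\<^sub>M S)"
  shows "(CLINT x|M. complex_of_real (indicator C (X x, Z x)) * iexp (\<theta> x)) =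
      (CLINT x|N. complex_of_real (indicator C (X' x, Z' x)) * iexp (\<theta>' x))"
proof -
  interpret M: finite_measure M by fact
  interpret N: finite_measure N by fact
  define J where "J r D t x = complex_of_real (indicator D (Z x)) * iexp (t * X x + r * \<theta> x)" for r D t x
  define J' where "J' r D t x = complex_of_real (indicator D (Z' x)) * iexp (t * X' x + r * \<theta>' x)" for r D t x
  have nI: "norm (complex_of_real (indicator D y) * iexp z) \<le> 1" for D and y :: 'c and z
    by (simp add: norm_mult split: split_indicator)
  have iJ: "integrable M (J r D t)" if "D \<in> sets S" for r D t
  proof (rule M.integrable_bounded[where B = 1])
    note [measurable] = that
    show "J r D t \<in> borel_measurable M"
      unfolding J_def[abs_def] by measurable
  qed (simp only: J_def nI)
  have iJ': "integrable N (J' r D t)" if "D \<in> sets S" for r D t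
  proof (rule N.integrable_bounded[where B = 1])
    note [measurable] = that
    show "J' r D t \<in> borel_measurable N"
      unfolding J'_def[abs_def] by measurable
  qed (simp only: J'_def nI)
  have JJ: "integral\<^sup>L M (J r D t) = integral\<^sup>L N (J' r D t)" if "D \<in> sets S" for r D t
    unfolding J_def J'_def using eq[OF that] .
  have cosE: "complex_of_real (cos y) = (iexp y + iexp (- y)) / 2" for y
    by (simp add: cos_exp_eq cos_of_real[symmetric])
  have sinE: "complex_of_real (sin y) = (iexp y - iexp (- y)) / (2 * \<i>)" for y
    by (simp add: sin_exp_eq sin_of_real[symmetric])
  have ex: "iexp (T + 0 * y) = iexp T" "iexp (T + 1 * y) = iexp T * iexp y" "iexp (T + (- 1) * y) = iexp T * iexp (- y)" for T y :: real
    by (simp_all add: exp_add[symmetric] distrib_left right_diff_distrib)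
  \<comment> \<open>Euler's formula writes the weight as a combination of exponentials in \<theta>
    with r = 0, 1, -1, for which \<open>eq\<close> is assumed.\<close>
  have cosJ: "complex_of_real ((1 + cos y) * i) * iexp T = complex_of_real i * iexp (T + 0 * y) +
      (complex_of_real i * iexp (T + 1 * y) + complex_of_real i * iexp (T + (- 1) * y)) / 2" for i T y :: real
  proof -
    have "(1 + (b + b') / 2) * I * a = I * a + (I * (a * b) + I * (a * b')) / 2" for a b b' I :: complex
      by (simp add: field_simps)
    then show ?thesis
      unfolding ex unfolding of_real_mult of_real_add of_real_1 cosE .
  qed
  have sinJ: "complex_of_real ((1 + sin y) * i) * iexp T = complex_of_real i * iexp (T + 0 * y) +
      (complex_of_real i * iexp (T + 1 * y) - complex_of_real i * iexp (T + (- 1) * y)) / (2 * \<i>)" for i T y :: real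
  proof -
    have "(1 + (b - b') / (2 * \<i>)) * I * a = I * a + (I * (a * b) - I * (a * b')) / (2 * \<i>)" for a b b' I :: complex
      by (simp add: field_simps)
    then show ?thesis
      unfolding ex unfolding of_real_mult of_real_add of_real_1 sinE .
  qed
  \<comment> \<open>The weight 1 is treated separately, so that it can be subtracted from the
    results for 1 + cos and 1 + sin.\<close>
  have 0: "(LINT x|M. 1 * indicator C (X x, Z x)) = (LINT x|N. 1 * indicat_real C (X' x, Z' x))"
    by (rule char_weighted[OF fin XZ, where B = 1]) (use eq[where r = 0] in \<open>simp_all add: C\<close>)
  have cs: "0 \<le> 1 + cos y" "1 + cos y \<le> 2" "0 \<le> 1 + sin y" "1 + sin y \<le> 2" for y :: real
    using cos_ge_minus_one[of y] sin_ge_minus_one[of y] cos_le_one[of y] sin_le_one[of y] by linarith+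
  have mw: "(\<lambda>x. 1 + cos (\<theta> x)) \<in> borel_measurable M" "(\<lambda>x. 1 + cos (\<theta>' x)) \<in> borel_measurable N"
      "(\<lambda>x. 1 + sin (\<theta> x)) \<in> borel_measurable M" "(\<lambda>x. 1 + sin (\<theta>' x)) \<in> borel_measurable N"
    by measurable
  have 1: "(LINT x|M. (1 + cos (\<theta> x)) * indicator C (X x, Z x)) = (LINT x|N. (1 + cos (\<theta>' x)) * indicat_real C (X' x, Z' x))"
  proof (rule char_weighted[OF fin XZ, where B = 2 and w = "\<lambda>x. 1 + cos (\<theta> x)" and w' = "\<lambda>x. 1 + cos (\<theta>' x)"])
    fix t D assume D: "D \<in> sets S"
    have "(CLINT x|M. complex_of_real ((1 + cos (\<theta> x)) * indicator D (Z x)) * iexp (t * X x)) =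
        (CLINT x|M. J 0 D t x + (J 1 D t x + J (- 1) D t x) / 2)"
      by (intro Bochner_Integration.integral_cong refl)
         (simp only: J_def cosJ)
    also have "\<dots> = integral\<^sup>L M (J 0 D t) + (integral\<^sup>L M (J 1 D t) + integral\<^sup>L M (J (- 1) D t)) / 2"
      by (simp add: iJ[OF D])
    also have "\<dots> = integral\<^sup>L N (J' 0 D t) + (integral\<^sup>L N (J' 1 D t) + integral\<^sup>L N (J' (- 1) D t)) / 2"
      by (simp add: JJ[OF D])
    also have "\<dots> = (CLINT x|N. J' 0 D t x + (J' 1 D t x + J' (- 1) D t x) / 2)"
      by (simp add: iJ'[OF D])
    also have "\<dots> = (CLINT x|N. complex_of_real ((1 + cos (\<theta>' x)) * indicator D (Z' x)) * iexp (t * X' x))"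
      by (intro Bochner_Integration.integral_cong refl)
         (simp only: J'_def cosJ)
    finally show "(CLINT x|M. complex_of_real ((1 + cos (\<theta> x)) * indicator D (Z x)) * iexp (t * X x)) =
        (CLINT x|N. complex_of_real ((1 + cos (\<theta>' x)) * indicator D (Z' x)) * iexp (t * X' x))" .
  qed (rule mw cs C)+
  have 2: "(LINT x|M. (1 + sin (\<theta> x)) * indicator C (X x, Z x)) = (LINT x|N. (1 + sin (\<theta>' x)) * indicat_real C (X' x, Z' x))"
  proof (rule char_weighted[OF fin XZ, where B = 2 and w = "\<lambda>x. 1 + sin (\<theta> x)" and w' = "\<lambda>x. 1 + sin (\<theta>' x)"])
    fix t D assume D: "D \<in> sets S"
    have "(CLINT x|M. complex_of_real ((1 + sin (\<theta> x)) * indicator D (Z x)) * iexp (t * X x)) =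
        (CLINT x|M. J 0 D t x + (J 1 D t x - J (- 1) D t x) / (2 * \<i>))"
      by (intro Bochner_Integration.integral_cong refl)
         (simp only: J_def sinJ)
    also have "\<dots> = integral\<^sup>L M (J 0 D t) + (integral\<^sup>L M (J 1 D t) - integral\<^sup>L M (J (- 1) D t)) / (2 * \<i>)"
      by (simp add: iJ[OF D])
    also have "\<dots> = integral\<^sup>L N (J' 0 D t) + (integral\<^sup>L N (J' 1 D t) - integral\<^sup>L N (J' (- 1) D t)) / (2 * \<i>)"
      by (simp add: JJ[OF D])
    also have "\<dots> = (CLINT x|N. J' 0 D t x + (J' 1 D t x - J' (- 1) D t x) / (2 * \<i>))"
      by (simp add: iJ'[OF D])
    also have "\<dots> = (CLINT x|N. complex_of_real ((1 + sin (\<theta>' x)) * indicator D (Z' x)) * iexp (t * X' x))"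
      by (intro Bochner_Integration.integral_cong refl)
         (simp only: J'_def sinJ)
    finally show "(CLINT x|M. complex_of_real ((1 + sin (\<theta> x)) * indicator D (Z x)) * iexp (t * X x)) =
        (CLINT x|N. complex_of_real ((1 + sin (\<theta>' x)) * indicator D (Z' x)) * iexp (t * X' x))" .
  qed (rule mw cs C)+
  have i: "integrable M (\<lambda>x. f (\<theta> x) * indicat_real C (X x, Z x))" "integrable N (\<lambda>x. f (\<theta>' x) * indicat_real C (X' x, Z' x))"
    if "f \<in> borel_measurable borel" "\<And>y. \<bar>f y\<bar> \<le> 1" for f :: "real \<Rightarrow> real"
    using that by (auto intro!: M.integrable_bounded[where B = 1] N.integrable_bounded[where B = 1] split: split_indicator)
  note ic = i[of cos] and isn = i[of sin] and i1 = i[of "\<lambda>_. 1"]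
  have c: "(LINT x|M. cos (\<theta> x) * indicator C (X x, Z x)) = (LINT x|N. cos (\<theta>' x) * indicat_real C (X' x, Z' x))"
    using 0 1 ic i1 by (simp add: distrib_right)
  have s: "(LINT x|M. sin (\<theta> x) * indicator C (X x, Z x)) = (LINT x|N. sin (\<theta>' x) * indicat_real C (X' x, Z' x))"
    using 0 2 isn i1 by (simp add: distrib_right)
  have eM: "complex_of_real (indicator C (X x, Z x)) * iexp (\<theta> x) = complex_of_real (cos (\<theta> x) * indicator C (X x, Z x)) +
      \<i> * complex_of_real (sin (\<theta> x) * indicator C (X x, Z x))" for x
    by (simp add: cis_conv_exp[symmetric] complex_eq_iff)
  have eN: "complex_of_real (indicator C (X' x, Z' x)) * iexp (\<theta>' x) = complex_of_real (cos (\<theta>' x) * indicator C (X' x, Z' x)) +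
      \<i> * complex_of_real (sin (\<theta>' x) * indicator C (X' x, Z' x))" for x
    by (simp add: cis_conv_exp[symmetric] complex_eq_iff)
  have "(CLINT x|M. complex_of_real (indicator C (X x, Z x)) * iexp (\<theta> x)) =
     complex_of_real (LINT x|M. cos (\<theta> x) * indicator C (X x, Z x)) + \<i> * complex_of_real (LINT x|M. sin (\<theta> x) * indicator C (X x, Z x))"
    unfolding eM using ic isn by (intro integral_re_im) auto
  also have "\<dots> = (CLINT x|N. complex_of_real (indicator C (X' x, Z' x)) * iexp (\<theta>' x))"
    unfolding eN c s using ic isn by (intro integral_re_im[symmetric]) auto
  finally show ?thesis .
qed

text \<open>Each use of \<open>char_step\<close> moves one coordinate from the exponential into an
  event, from the fourth to the first; after four of them the joint laws agree on all measurable
  sets.\<close>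

lemma char_unique4:
  fixes X1 X2 X3 X4 :: "'a \<Rightarrow> real" and Y1 Y2 Y3 Y4 :: "'b \<Rightarrow> real" and g :: "real \<times> real \<times> real \<times> real \<Rightarrow> real"
  assumes fin: "finite_measure M" "finite_measure N"
    and X[measurable]: "X1 \<in> borel_measurable M" "X2 \<in> borel_measurable M" "X3 \<in> borel_measurable M" "X4 \<in> borel_measurable M"
    and Y[measurable]: "Y1 \<in> borel_measurable N" "Y2 \<in> borel_measurable N" "Y3 \<in> borel_measurable N" "Y4 \<in> borel_measurable N"
    and eq: "\<And>s1 s2 s3 s4. (CLINT x|M. iexp (s1 * X1 x + s2 * X2 x + s3 * X3 x + s4 * X4 x)) =
      (CLINT x|N. iexp (s1 * Y1 x + s2 * Y2 x + s3 * Y3 x + s4 * Y4 x))"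
    and g[measurable]: "g \<in> borel_measurable (borel \<Otimes>\<^sub>M (borel \<Otimes>\<^sub>M (borel \<Otimes>\<^sub>M borel)))"
  shows "(LINT x|M. g (X1 x, X2 x, X3 x, X4 x)) = (LINT x|N. g (Y1 x, Y2 x, Y3 x, Y4 x))"
proof -
  interpret M: finite_measure M by fact
  interpret N: finite_measure N by fact
  have 4: "(CLINT x|M. complex_of_real (indicator C (X4 x)) * iexp (s1 * X1 x + s2 * X2 x + s3 * X3 x)) =
      (CLINT x|N. complex_of_real (indicator C (Y4 x)) * iexp (s1 * Y1 x + s2 * Y2 x + s3 * Y3 x))"
    if C: "C \<in> sets borel" for C s1 s2 s3
  proof -
    \<comment> \<open>At the start no coordinate sits in an event yet; the unit type serves as the
      empty tuple \<open>Z\<close>.\<close>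
    have "C \<times> UNIV \<in> sets (borel \<Otimes>\<^sub>M (count_space UNIV :: unit measure))"
      using C by simp
    note CU = this
    have "(CLINT x|M. complex_of_real (indicator (C \<times> UNIV) (X4 x, ())) * iexp (s1 * X1 x + s2 * X2 x + s3 * X3 x)) =
      (CLINT x|N. complex_of_real (indicator (C \<times> UNIV) (Y4 x, ())) * iexp (s1 * Y1 x + s2 * Y2 x + s3 * Y3 x))"
    proof (rule char_step[OF fin X(4) Y(4) _ _ _ _ _ CU])
      fix t r :: real and D :: "unit set"
      have "t * a + r * (s1 * b + s2 * c + s3 * d) = (r * s1) * b + (r * s2) * c + (r * s3) * d + t * a" for a b c d :: real
        by (simp add: algebra_simps)
      then show "(CLINT x|M. complex_of_real (indicator D ()) * iexp (t * X4 x + r * (s1 * X1 x + s2 * X2 x + s3 * X3 x))) =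
         (CLINT x|N. complex_of_real (indicator D ()) * iexp (t * Y4 x + r * (s1 * Y1 x + s2 * Y2 x + s3 * Y3 x)))"
        unfolding integral_mult_right_zero using eq[of "r * s1" "r * s2" "r * s3" t] by (simp only:)
    qed simp_all
    then show ?thesis
      by (simp only: indicator_times indicator_UNIV mult_1_right fst_conv)
  qed
  have 3: "(CLINT x|M. complex_of_real (indicator C (X3 x, X4 x)) * iexp (s1 * X1 x + s2 * X2 x)) =
      (CLINT x|N. complex_of_real (indicator C (Y3 x, Y4 x)) * iexp (s1 * Y1 x + s2 * Y2 x))"
    if C: "C \<in> sets (borel \<Otimes>\<^sub>M borel)" for C s1 s2
  proof (rule char_step[OF fin X(3) Y(3) X(4) Y(4) _ _ _ C])
    fix t r and D :: "real set" assume D: "D \<in> sets borel"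
    have "t * a + r * (s1 * b + s2 * c) = (r * s1) * b + (r * s2) * c + t * a" for a b c :: real
      by (simp add: algebra_simps)
    then show "(CLINT x|M. complex_of_real (indicator D (X4 x)) * iexp (t * X3 x + r * (s1 * X1 x + s2 * X2 x))) =
      (CLINT x|N. complex_of_real (indicator D (Y4 x)) * iexp (t * Y3 x + r * (s1 * Y1 x + s2 * Y2 x)))"
      using 4[OF D] by (simp only:)
  qed simp_all
  have 2: "(CLINT x|M. complex_of_real (indicator C (X2 x, X3 x, X4 x)) * iexp (s1 * X1 x)) =
      (CLINT x|N. complex_of_real (indicator C (Y2 x, Y3 x, Y4 x)) * iexp (s1 * Y1 x))"
    if C: "C \<in> sets (borel \<Otimes>\<^sub>M (borel \<Otimes>\<^sub>M borel))" for C s1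
  proof (rule char_step[OF fin X(2) Y(2) _ _ _ _ _ C])
    fix t r and D :: "(real \<times> real) set" assume D: "D \<in> sets (borel \<Otimes>\<^sub>M borel)"
    have "t * a + r * (s1 * b) = (r * s1) * b + t * a" for a b :: real
      by (simp add: algebra_simps)
    then show "(CLINT x|M. complex_of_real (indicator D (X3 x, X4 x)) * iexp (t * X2 x + r * (s1 * X1 x))) =
      (CLINT x|N. complex_of_real (indicator D (Y3 x, Y4 x)) * iexp (t * Y2 x + r * (s1 * Y1 x)))"
      using 3[OF D] by (simp only:)
  qed simp_all
  have 1: "(CLINT x|M. complex_of_real (indicator C (X1 x, X2 x, X3 x, X4 x)) * iexp 0) =
      (CLINT x|N. complex_of_real (indicator C (Y1 x, Y2 x, Y3 x, Y4 x)) * iexp 0)"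
    if C: "C \<in> sets (borel \<Otimes>\<^sub>M (borel \<Otimes>\<^sub>M (borel \<Otimes>\<^sub>M borel)))" for C
  proof (rule char_step[OF fin X(1) Y(1) _ _ _ _ _ C])
    fix t r :: real and D :: "(real \<times> real \<times> real) set" assume D: "D \<in> sets (borel \<Otimes>\<^sub>M (borel \<Otimes>\<^sub>M borel))"
    have "t * a + r * 0 = t * a" for a :: real
      by simp
    then show "(CLINT x|M. complex_of_real (indicator D (X2 x, X3 x, X4 x)) * iexp (t * X1 x + r * 0)) =
      (CLINT x|N. complex_of_real (indicator D (Y2 x, Y3 x, Y4 x)) * iexp (t * Y1 x + r * 0))"
      using 2[OF D] by (simp only:)
  qed simp_all
  let ?S = "borel \<Otimes>\<^sub>M (borel \<Otimes>\<^sub>M (borel \<Otimes>\<^sub>M borel)) :: (real \<times> real \<times> real \<times> real) measure"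
  have "distr M ?S (\<lambda>x. (X1 x, X2 x, X3 x, X4 x)) = distr N ?S (\<lambda>x. (Y1 x, Y2 x, Y3 x, Y4 x))" (is "?\<mu> = ?\<nu>")
  proof (rule measure_eqI)
    fix C assume "C \<in> sets ?\<mu>"
    then have C[measurable]: "C \<in> sets ?S" by simp
    have "(LINT x|M. indicator C (X1 x, X2 x, X3 x, X4 x)) = (LINT x|N. indicat_real C (Y1 x, Y2 x, Y3 x, Y4 x))"
      using 1[OF C] by (simp only: of_real_0 mult_zero_right exp_zero mult_1_right integral_complex_of_real of_real_eq_iff)
    then have "(LINT p|?\<mu>. indicator C p) = (LINT p|?\<nu>. indicat_real C p)"
      by (subst (1 2) integral_distr) auto
    moreover have "finite_measure ?\<mu>" "finite_measure ?\<nu>"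
      by (auto intro!: M.finite_measure_distr N.finite_measure_distr)
    ultimately show "emeasure ?\<mu> C = emeasure ?\<nu> C"
      using C by (simp add: finite_measure.emeasure_eq_measure)
  qed simp
  then have "integral\<^sup>L ?\<mu> g = integral\<^sup>L ?\<nu> g"
    by simp
  then show ?thesis
    by (subst (asm) (1 2) integral_distr) auto
qed

section \<open>Four independent standard normals and the Cholesky factor\<close>

lemma prob_pair_integral:
  fixes f :: "'a \<times> 'b \<Rightarrow> 'c::{banach, second_countable_topology}"
  assumes "prob_space P" "prob_space Q" "f \<in> borel_measurable (P \<Otimes>\<^sub>M Q)" "\<And>p. norm (f p) \<le> B"
  shows "integral\<^sup>L (P \<Otimes>\<^sub>M Q) f = (\<integral>x. \<integral>y. f (x, y) \<partial>Q \<partial>P)"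
proof -
  interpret P: prob_space P by fact
  interpret Q: prob_space Q by fact
  interpret PQ: pair_prob_space P Q ..
  show ?thesis
    using assms(3,4) by (intro PQ.integral_fst'[symmetric] PQ.P.integrable_const_bound[where B = B]) auto
qed

abbreviation "N1 \<equiv> std_normal_distribution"
abbreviation "N2 \<equiv> N1 \<Otimes>\<^sub>M N1"
abbreviation "N3 \<equiv> N1 \<Otimes>\<^sub>M N2"
abbreviation "N4 \<equiv> N1 \<Otimes>\<^sub>M N3"

lemma prob_space_N1: "prob_space N1" by (rule std_normal.prob_space_axioms)

lemma prob_space_N: "prob_space N2" "prob_space N3" "prob_space N4"
  by (intro prob_space_pair prob_space_N1)+

lemma integral_N4:
  fixes f :: "real \<times> real \<times> real \<times> real \<Rightarrow> 'c::{banach, second_countable_topology}"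
  assumes f[measurable]: "f \<in> borel_measurable (borel \<Otimes>\<^sub>M (borel \<Otimes>\<^sub>M (borel \<Otimes>\<^sub>M borel)))" and B: "\<And>p. norm (f p) \<le> B"
  shows "integral\<^sup>L N4 f = (\<integral>a. \<integral>b. \<integral>c. \<integral>d. f (a, b, c, d) \<partial>N1 \<partial>N1 \<partial>N1 \<partial>N1)"
proof -
  have m: "f \<in> borel_measurable N4"
    using f by (simp cong: measurable_cong_sets sets_pair_measure_cong)
  have 1: "integral\<^sup>L N4 f = (\<integral>a. \<integral>p. f (a, p) \<partial>N3 \<partial>N1)"
    using m B by (rule prob_pair_integral[OF prob_space_N1 prob_space_N(2)])
  have 2: "(\<integral>p. f (a, p) \<partial>N3) = (\<integral>b. \<integral>p. f (a, b, p) \<partial>N2 \<partial>N1)" for a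
  proof (rule prob_pair_integral[OF prob_space_N1 prob_space_N(1)])
    show "(\<lambda>p. f (a, p)) \<in> borel_measurable N3"
      using m by (rule measurable_compose[rotated]) simp
  qed (rule B)
  have 3: "(\<integral>p. f (a, b, p) \<partial>N2) = (\<integral>c. \<integral>d. f (a, b, c, d) \<partial>N1 \<partial>N1)" for a b
  proof (rule prob_pair_integral[OF prob_space_N1 prob_space_N1])
    show "(\<lambda>p. f (a, b, p)) \<in> borel_measurable N2"
      using m by (rule measurable_compose[rotated]) simp
  qed (rule B)
  show ?thesis
    unfolding 1 2 3 ..
qed

lemma char_N1: "(CLINT x|N1. iexp (t * x)) = complex_of_real (exp (- t\<^sup>2 / 2))"
  using char_std_normal_distribution by (simp add: char_def fun_eq_iff)

lemma char_N4:
  "(CLINT p|N4. iexp (b1 * fst p + b2 * fst (snd p) + b3 * fst (snd (snd p)) + b4 * snd (snd (snd p))))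
     = exp (- (b1\<^sup>2 + b2\<^sup>2 + b3\<^sup>2 + b4\<^sup>2) / 2)"
proof -
  have "(CLINT p|N4. iexp (b1 * fst p + b2 * fst (snd p) + b3 * fst (snd (snd p)) + b4 * snd (snd (snd p)))) =
    (CLINT a|N1. CLINT b|N1. CLINT c|N1. CLINT d|N1. iexp (b1 * a) * (iexp (b2 * b) * (iexp (b3 * c) * iexp (b4 * d))))"
    by (subst integral_N4[where B = 1]) (simp_all add: exp_add[symmetric] distrib_left add.assoc)
  also have "\<dots> = complex_of_real (exp (- b1\<^sup>2 / 2) * (exp (- b2\<^sup>2 / 2) * (exp (- b3\<^sup>2 / 2) * exp (- b4\<^sup>2 / 2))))"
    unfolding integral_mult_right_zero integral_mult_left_zero char_N1 by (simp only: of_real_mult)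
  also have "exp (- b1\<^sup>2 / 2) * (exp (- b2\<^sup>2 / 2) * (exp (- b3\<^sup>2 / 2) * exp (- b4\<^sup>2 / 2))) = exp (- (b1\<^sup>2 + b2\<^sup>2 + b3\<^sup>2 + b4\<^sup>2) / 2)"
    unfolding exp_add[symmetric] by (simp add: add_divide_distrib diff_divide_distrib)
  finally show ?thesis .
qed

text \<open>The Cholesky factorisation of the covariance matrix \<open>sech (u j - u i)\<close>: the factor has the entries
  \<open>sech (u j - u k)\<close> times the product of \<open>tanh (u j - u l)\<close> over \<open>l < k\<close>.\<close>

lemma cov_factor:
  fixes u1 u2 u3 u4 s1 s2 s3 s4 :: real
  defines "c i j \<equiv> sech (j - i)" and "t i j \<equiv> tanh (j - i)"
  shows "(s1 + c u1 u2 * s2 + c u1 u3 * s3 + c u1 u4 * s4)\<^sup>2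
     + (t u1 u2 * s2 + t u1 u3 * c u2 u3 * s3 + t u1 u4 * c u2 u4 * s4)\<^sup>2
     + (t u1 u3 * t u2 u3 * s3 + t u1 u4 * t u2 u4 * c u3 u4 * s4)\<^sup>2
     + (t u1 u4 * t u2 u4 * t u3 u4 * s4)\<^sup>2
   = s1\<^sup>2 + s2\<^sup>2 + s3\<^sup>2 + s4\<^sup>2 + 2 * c u1 u2 * s1 * s2 + 2 * c u1 u3 * s1 * s3 + 2 * c u1 u4 * s1 * s4
     + 2 * c u2 u3 * s2 * s3 + 2 * c u2 u4 * s2 * s4 + 2 * c u3 u4 * s3 * s4"
proof -
  have sq: "(t i j)\<^sup>2 + (c i j)\<^sup>2 = 1" for i j
    by (simp add: t_def c_def tanh_sech_square)
  have rel: "c k j * (1 - t i j * t i k) = c i j * c i k" for i j k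
    using sech_diff_mult[of "j - i" "k - i"] by (simp add: c_def t_def)
  have "(s1 + c u1 u2 * s2 + c u1 u3 * s3 + c u1 u4 * s4)\<^sup>2
     + (t u1 u2 * s2 + t u1 u3 * c u2 u3 * s3 + t u1 u4 * c u2 u4 * s4)\<^sup>2
     + (t u1 u3 * t u2 u3 * s3 + t u1 u4 * t u2 u4 * c u3 u4 * s4)\<^sup>2
     + (t u1 u4 * t u2 u4 * t u3 u4 * s4)\<^sup>2
    = s1\<^sup>2 + ((t u1 u2)\<^sup>2 + (c u1 u2)\<^sup>2) * s2\<^sup>2 + ((c u1 u3)\<^sup>2 + (t u1 u3)\<^sup>2 * ((t u2 u3)\<^sup>2 + (c u2 u3)\<^sup>2)) * s3\<^sup>2
     + ((c u1 u4)\<^sup>2 + (t u1 u4)\<^sup>2 * ((c u2 u4)\<^sup>2 + (t u2 u4)\<^sup>2 * ((t u3 u4)\<^sup>2 + (c u3 u4)\<^sup>2))) * s4\<^sup>2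
     + 2 * c u1 u2 * s1 * s2 + 2 * c u1 u3 * s1 * s3 + 2 * c u1 u4 * s1 * s4
     + 2 * (c u1 u3 * c u1 u2 + c u2 u3 * t u1 u3 * t u1 u2) * s2 * s3
     + 2 * (c u1 u4 * c u1 u2 + c u2 u4 * t u1 u4 * t u1 u2) * s2 * s4
     + 2 * (c u1 u4 * c u1 u3 + t u1 u4 * t u1 u3 * (c u2 u4 * c u2 u3 + c u3 u4 * t u2 u4 * t u2 u3)) * s3 * s4"
    by algebra
  also have "\<dots> = s1\<^sup>2 + s2\<^sup>2 + s3\<^sup>2 + s4\<^sup>2 + 2 * c u1 u2 * s1 * s2 + 2 * c u1 u3 * s1 * s3 + 2 * c u1 u4 * s1 * s4
     + 2 * c u2 u3 * s2 * s3 + 2 * c u2 u4 * s2 * s4 + 2 * c u3 u4 * s3 * s4"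
  proof -
    have "c i j * c i k + c k j * t i j * t i k = c k j" for i j k
      using rel[of k j i] by (simp add: algebra_simps)
    from this[of u1 u3 u2] this[of u1 u4 u2] this[of u2 u4 u3] this[of u1 u4 u3]
    have "c u1 u3 * c u1 u2 + c u2 u3 * t u1 u3 * t u1 u2 = c u2 u3"
        "c u1 u4 * c u1 u2 + c u2 u4 * t u1 u4 * t u1 u2 = c u2 u4"
        "c u2 u4 * c u2 u3 + c u3 u4 * t u2 u4 * t u2 u3 = c u3 u4"
        "c u1 u4 * c u1 u3 + t u1 u4 * t u1 u3 * c u3 u4 = c u3 u4"
      by (simp_all only: mult_ac)
    moreover have "(c i j)\<^sup>2 + (t i j)\<^sup>2 = 1" for i j
      using sq[of i j] by simp
    ultimately show ?thesis
      using sq by simp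
  qed
  finally show ?thesis .
qed

subsection \<open>The Gaussian power series\<close>

locale gaussian_series = prob_space M for M :: "'w measure" +
  fixes a :: "nat \<Rightarrow> 'w \<Rightarrow> real"
  assumes iid: "iid_std_gaussian M a"
begin

lemma indep_a: "indep_vars (\<lambda>_. borel) a UNIV"
  using iid by (simp add: iid_std_gaussian_def)

lemma distributed_a: "distributed M lborel (a k) std_normal_density"
  using iid by (simp add: iid_std_gaussian_def)

lemma measurable_a [measurable]: "a k \<in> borel_measurable M"
  using distributed_measurable[OF distributed_a[of k]] by simp

lemma distr_a: "distr M borel (a k) = std_normal_distribution"
proof -
  have "distr M borel (a k) = distr M lborel (a k)"
    by (rule distr_cong) auto
  also have "\<dots> = std_normal_distribution"
    by (rule distributed_distr_eq_density[OF distributed_a])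
  finally show ?thesis .
qed

lemma char_a: "(CLINT \<omega>|M. iexp (t * a k \<omega>)) = complex_of_real (exp (- t\<^sup>2 / 2))"
  using char_N1[of t] unfolding distr_a[of k, symmetric] by (subst (asm) integral_distr) auto

lemma nn_integral_abs_a: "(\<integral>\<^sup>+\<omega>. ennreal \<bar>a k \<omega>\<bar> \<partial>M) = ennreal (sqrt (2 / pi))"
proof -
  have "(\<integral>\<^sup>+\<omega>. ennreal \<bar>a k \<omega>\<bar> \<partial>M) = (\<integral>\<^sup>+x. ennreal \<bar>x\<bar> \<partial>std_normal_distribution)"
    unfolding distr_a[of k, symmetric] by (subst nn_integral_distr) auto
  also have "\<dots> = ennreal (LINT x|std_normal_distribution. \<bar>x\<bar>)"
    using integrable_std_normal_distribution_moment[of 1] by (intro nn_integral_eq_integral) auto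
  also have "(LINT x|std_normal_distribution. \<bar>x\<bar>) = sqrt (2 / pi)"
    using std_normal_distribution_odd_moments_abs[of 0] by simp
  finally show ?thesis .
qed

text \<open>The absolute first moments are equal, so the expected sum is a convergent geometric
  series; a variable of finite expectation is almost surely finite.\<close>

lemma AE_summable:
  assumes r: "0 \<le> r" "r < 1"
  shows "AE \<omega> in M. summable (\<lambda>k. \<bar>a k \<omega>\<bar> * r ^ k)"
proof -
  have "(\<integral>\<^sup>+\<omega>. (\<Sum>k. ennreal (\<bar>a k \<omega>\<bar> * r ^ k)) \<partial>M) = (\<Sum>k. (\<integral>\<^sup>+\<omega>. ennreal (\<bar>a k \<omega>\<bar> * r ^ k) \<partial>M))"
    by (intro nn_integral_suminf) simp
  also have "\<dots> = (\<Sum>k. ennreal (sqrt (2 / pi) * r ^ k))"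
  proof (intro suminf_cong)
    fix k
    have "(\<integral>\<^sup>+\<omega>. ennreal (\<bar>a k \<omega>\<bar> * r ^ k) \<partial>M) = (\<integral>\<^sup>+\<omega>. ennreal \<bar>a k \<omega>\<bar> * ennreal (r ^ k) \<partial>M)"
      using r by (intro nn_integral_cong) (simp add: ennreal_mult)
    also have "\<dots> = ennreal (sqrt (2 / pi)) * ennreal (r ^ k)"
      by (subst nn_integral_multc) (simp_all add: nn_integral_abs_a)
    finally show "(\<integral>\<^sup>+\<omega>. ennreal (\<bar>a k \<omega>\<bar> * r ^ k) \<partial>M) = ennreal (sqrt (2 / pi) * r ^ k)"
      using r by (simp add: ennreal_mult)
  qed
  also have "\<dots> \<noteq> \<infinity>"
    using r by (intro ennreal_suminf_neq_top[simplified infinity_ennreal_def[symmetric]] summable_mult summable_geometric) auto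
  finally have "AE \<omega> in M. (\<Sum>k. ennreal (\<bar>a k \<omega>\<bar> * r ^ k)) \<noteq> \<infinity>"
    by (intro nn_integral_PInf_AE) auto
  then show ?thesis
    by eventually_elim (use r in \<open>auto intro: summable_suminf_not_top\<close>)
qed

text \<open>A power series converges absolutely inside its disc, so countably many radii tending to
  1 decide. This makes the event measurable and reduces its probability to countably many almost
  sure statements.\<close>

lemma converges_on_disc_iff:
  "converges_on_disc a \<omega> \<longleftrightarrow> (\<forall>n::nat. summable (\<lambda>k. \<bar>a k \<omega>\<bar> * (1 - 1 / (real n + 1)) ^ k))"
proof (intro iffI allI)
  fix n :: nat
  assume c: "converges_on_disc a \<omega>"
  define r where "r = 1 - 1 / (real n + 1)"
  have r: "0 \<le> r" "r < 1" by (auto simp: r_def)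
  define x where "x = complex_of_real ((r + 1) / 2)"
  have "norm x < 1" "norm (complex_of_real r) < norm x"
    using r by (auto simp: x_def)
  then have "summable (\<lambda>k. norm (complex_of_real (a k \<omega>) * complex_of_real r ^ k))"
    using c unfolding converges_on_disc_def by (intro powser_insidea[of _ x]) auto
  then show "summable (\<lambda>k. \<bar>a k \<omega>\<bar> * (1 - 1 / (real n + 1)) ^ k)"
    using r by (simp add: norm_mult norm_power r_def[symmetric])
next
  assume s: "\<forall>n::nat. summable (\<lambda>k. \<bar>a k \<omega>\<bar> * (1 - 1 / (real n + 1)) ^ k)"
  show "converges_on_disc a \<omega>"
    unfolding converges_on_disc_def
  proof (intro allI impI)
    fix z :: complex assume "norm z < 1"
    then have "0 < 1 - norm z" by simp
    then obtain n where n: "inverse (real (Suc n)) < 1 - norm z"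
      using reals_Archimedean by blast
    have "norm z \<le> 1 - 1 / (real n + 1)"
      using n by (simp add: inverse_eq_divide add.commute)
    then have "norm (of_real (a k \<omega>) * z ^ k) \<le> \<bar>a k \<omega>\<bar> * (1 - 1 / (real n + 1)) ^ k" for k
      unfolding norm_mult norm_power norm_of_real by (intro mult_left_mono power_mono) auto
    then show "summable (\<lambda>k. complex_of_real (a k \<omega>) * z ^ k)"
      by (rule summable_comparison_test'[OF s[rule_format, of n], of 0])
  qed
qed

lemma AE_converges: "AE \<omega> in M. converges_on_disc a \<omega>"
  unfolding converges_on_disc_iff by (subst AE_all_countable) (intro allI AE_summable, auto)

lemma measurable_converges [measurable]: "Measurable.pred M (converges_on_disc a)"
proof -
  have "summable (\<lambda>k. \<bar>a k \<omega>\<bar> * (1 - 1 / (real n + 1)) ^ k) \<longleftrightarrow>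
      (\<Sum>k. ennreal (\<bar>a k \<omega>\<bar> * (1 - 1 / (real n + 1)) ^ k)) \<noteq> top" for n :: nat and \<omega>
  proof -
    have nn: "0 \<le> \<bar>a k \<omega>\<bar> * (1 - 1 / (real n + 1)) ^ k" for k
      by simp
    show ?thesis
      using summable_suminf_not_top[OF nn] ennreal_suminf_neq_top[OF _ nn] by (rule iffI[rotated])
  qed
  then have eq: "converges_on_disc a = (\<lambda>\<omega>. \<forall>n::nat. (\<Sum>k. ennreal (\<bar>a k \<omega>\<bar> * (1 - 1 / (real n + 1)) ^ k)) \<noteq> top)"
    by (simp only: fun_eq_iff converges_on_disc_iff simp_thms)
  show ?thesis
    unfolding eq by measurable
qed

lemma summable_abs:
  assumes "converges_on_disc a \<omega>" "\<bar>x\<bar> < 1"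
  shows "summable (\<lambda>k. \<bar>a k \<omega>\<bar> * \<bar>x\<bar> ^ k)"
proof -
  define y where "y = complex_of_real ((\<bar>x\<bar> + 1) / 2)"
  have "norm y < 1" "norm (complex_of_real x) < norm y"
    using assms(2) by (auto simp: y_def)
  then have "summable (\<lambda>k. norm (complex_of_real (a k \<omega>) * complex_of_real x ^ k))"
    using assms(1) unfolding converges_on_disc_def by (intro powser_insidea[of _ y]) auto
  then show ?thesis
    by (simp add: norm_mult norm_power)
qed

lemma summable_a:
  assumes "converges_on_disc a \<omega>" "\<bar>x\<bar> < 1"
  shows "summable (\<lambda>k. a k \<omega> * x ^ k)"
  by (rule summable_norm_cancel) (use summable_abs[OF assms] in \<open>simp add: abs_mult power_abs\<close>)

section \<open>The stationary process and its four-point laws\<close>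

definition f :: "'w \<Rightarrow> real \<Rightarrow> real" where "f \<omega> x = (\<Sum>k. a k \<omega> * x ^ k)"

lemma random_series_eq:
  assumes "converges_on_disc a \<omega>" "\<bar>x\<bar> < 1"
  shows "random_series a \<omega> (of_real x) = of_real (f \<omega> x)"
  unfolding random_series_def f_def using suminf_of_real[OF summable_a[OF assms], where 'a = complex] by simp

lemma measurable_f [measurable]: "(\<lambda>\<omega>. f \<omega> x) \<in> borel_measurable M"
  unfolding f_def by measurable

definition X :: "real \<Rightarrow> 'w \<Rightarrow> real" where "X u \<omega> = sech u * f \<omega> (tanh u)"

lemma measurable_X [measurable]: "X u \<in> borel_measurable M"
  unfolding X_def[abs_def] by measurable

lemma sgn_X: "sgn (X u \<omega>) = sgn (f \<omega> (tanh u))"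
  by (simp add: X_def sgn_mult sech_pos)

text \<open>Independence factors the transform of each partial sum; almost sure convergence and the
  bound 1 pass it to the limit.\<close>

lemma char_series:
  assumes summ: "AE \<omega> in M. summable (\<lambda>k. a k \<omega> * c k)" and c: "(\<lambda>k. (c k)\<^sup>2) sums V"
  shows "(CLINT \<omega>|M. iexp (\<Sum>k. a k \<omega> * c k)) = complex_of_real (exp (- V / 2))"
proof (rule LIMSEQ_unique)
  show "(\<lambda>n. CLINT \<omega>|M. iexp (\<Sum>k<n. a k \<omega> * c k)) \<longlonglongrightarrow> (CLINT \<omega>|M. iexp (\<Sum>k. a k \<omega> * c k))"
  proof (rule integral_dominated_convergence[where w = "\<lambda>_. 1"])
    show "AE \<omega> in M. (\<lambda>n. iexp (\<Sum>k<n. a k \<omega> * c k)) \<longlonglongrightarrow> iexp (\<Sum>k. a k \<omega> * c k)"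
      using summ by eventually_elim (intro tendsto_intros summable_LIMSEQ)
  qed auto
  have "(CLINT \<omega>|M. iexp (\<Sum>k<n. a k \<omega> * c k)) = complex_of_real (exp (- (\<Sum>k<n. (c k)\<^sup>2) / 2))" for n
  proof -
    have "indep_vars (\<lambda>_. borel) (\<lambda>k \<omega>. a k \<omega> * c k) {..<n}"
      using indep_vars_compose2[OF indep_vars_subset[OF indep_a, of "{..<n}"], of "\<lambda>k x. x * c k" "\<lambda>_. borel"] by simp
    from char_distr_sum[OF this, of 1]
    have "(CLINT \<omega>|M. iexp (\<Sum>k<n. a k \<omega> * c k)) = (\<Prod>k<n. CLINT \<omega>|M. iexp (c k * a k \<omega>))"
      by (simp add: char_def integral_distr mult.commute)
    also have "\<dots> = complex_of_real (\<Prod>k<n. exp (- (c k)\<^sup>2 / 2))"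
      unfolding char_a by simp
    also have "(\<Prod>k<n. exp (- (c k)\<^sup>2 / 2)) = exp (- (\<Sum>k<n. (c k)\<^sup>2) / 2)"
      by (simp add: exp_sum[symmetric] sum_divide_distrib sum_negf)
    finally show ?thesis .
  qed
  moreover have "(\<lambda>n. complex_of_real (exp (- (\<Sum>k<n. (c k)\<^sup>2) / 2))) \<longlonglongrightarrow> complex_of_real (exp (- V / 2))"
    using c unfolding sums_def by (intro tendsto_intros) auto
  ultimately show "(\<lambda>n. CLINT \<omega>|M. iexp (\<Sum>k<n. a k \<omega> * c k)) \<longlonglongrightarrow> complex_of_real (exp (- V / 2))"
    by simp
qed

text \<open>A geometric series: the covariance of the raw series is 1 / (1 - x y), and the two
  \<open>sech\<close> factors normalise it to a function of the difference.\<close>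

lemma sums_cov: "(\<lambda>k. (sech u * tanh u ^ k) * (sech v * tanh v ^ k)) sums sech (v - u)"
proof -
  have t: "\<bar>tanh u * tanh v\<bar> < 1"
    unfolding abs_mult using mult_strict_mono'[of "\<bar>tanh u\<bar>" 1 "\<bar>tanh v\<bar>" 1] by (simp add: abs_less_iff tanh_real_lt_1 tanh_real_gt_neg1 minus_less_iff)
  then have "(\<lambda>k. sech u * sech v * (tanh u * tanh v) ^ k) sums (sech u * sech v * (1 / (1 - tanh u * tanh v)))"
    by (intro sums_mult geometric_sums) simp
  also have "sech u * sech v * (1 / (1 - tanh u * tanh v)) = sech (v - u)"
    using sech_diff_mult[of v u] t by (simp add: field_simps)
  finally show ?thesis
    by (simp add: power_mult_distrib mult_ac)
qed

lemma char_X: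
  "(CLINT \<omega>|M. iexp (s1 * X u1 \<omega> + s2 * X u2 \<omega> + s3 * X u3 \<omega> + s4 * X u4 \<omega>)) =
    complex_of_real (exp (- (s1\<^sup>2 + s2\<^sup>2 + s3\<^sup>2 + s4\<^sup>2
     + 2 * sech (u2 - u1) * s1 * s2 + 2 * sech (u3 - u1) * s1 * s3 + 2 * sech (u4 - u1) * s1 * s4
     + 2 * sech (u3 - u2) * s2 * s3 + 2 * sech (u4 - u2) * s2 * s4 + 2 * sech (u4 - u3) * s3 * s4) / 2))"
proof -
  define e where "e u k = sech u * tanh u ^ k" for u :: real and k :: nat
  define c where "c k = s1 * e u1 k + s2 * e u2 k + s3 * e u3 k + s4 * e u4 k" for k
  define V where "V = s1\<^sup>2 + s2\<^sup>2 + s3\<^sup>2 + s4\<^sup>2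
     + 2 * sech (u2 - u1) * s1 * s2 + 2 * sech (u3 - u1) * s1 * s3 + 2 * sech (u4 - u1) * s1 * s4
     + 2 * sech (u3 - u2) * s2 * s3 + 2 * sech (u4 - u2) * s2 * s4 + 2 * sech (u4 - u3) * s3 * s4"
  have S: "(\<lambda>k. x * (e u k * e v k)) sums (x * sech (v - u))" for x u v
    unfolding e_def by (intro sums_mult sums_cov)
  have "(\<lambda>k. s1\<^sup>2 * (e u1 k * e u1 k) + s2\<^sup>2 * (e u2 k * e u2 k) + s3\<^sup>2 * (e u3 k * e u3 k) + s4\<^sup>2 * (e u4 k * e u4 k)
     + (2 * s1 * s2) * (e u1 k * e u2 k) + (2 * s1 * s3) * (e u1 k * e u3 k) + (2 * s1 * s4) * (e u1 k * e u4 k)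
     + (2 * s2 * s3) * (e u2 k * e u3 k) + (2 * s2 * s4) * (e u2 k * e u4 k) + (2 * s3 * s4) * (e u3 k * e u4 k)) sums
    (s1\<^sup>2 * sech (u1 - u1) + s2\<^sup>2 * sech (u2 - u2) + s3\<^sup>2 * sech (u3 - u3) + s4\<^sup>2 * sech (u4 - u4)
     + (2 * s1 * s2) * sech (u2 - u1) + (2 * s1 * s3) * sech (u3 - u1) + (2 * s1 * s4) * sech (u4 - u1)
     + (2 * s2 * s3) * sech (u3 - u2) + (2 * s2 * s4) * sech (u4 - u2) + (2 * s3 * s4) * sech (u4 - u3))"
    by (intro sums_add S)
  also have "(\<lambda>k. s1\<^sup>2 * (e u1 k * e u1 k) + s2\<^sup>2 * (e u2 k * e u2 k) + s3\<^sup>2 * (e u3 k * e u3 k) + s4\<^sup>2 * (e u4 k * e u4 k)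
     + (2 * s1 * s2) * (e u1 k * e u2 k) + (2 * s1 * s3) * (e u1 k * e u3 k) + (2 * s1 * s4) * (e u1 k * e u4 k)
     + (2 * s2 * s3) * (e u2 k * e u3 k) + (2 * s2 * s4) * (e u2 k * e u4 k) + (2 * s3 * s4) * (e u3 k * e u4 k)) = (\<lambda>k. (c k)\<^sup>2)"
    unfolding c_def by (rule ext) algebra
  also have "s1\<^sup>2 * sech (u1 - u1) + s2\<^sup>2 * sech (u2 - u2) + s3\<^sup>2 * sech (u3 - u3) + s4\<^sup>2 * sech (u4 - u4)
     + (2 * s1 * s2) * sech (u2 - u1) + (2 * s1 * s3) * sech (u3 - u1) + (2 * s1 * s4) * sech (u4 - u1)
     + (2 * s2 * s3) * sech (u3 - u2) + (2 * s2 * s4) * sech (u4 - u2) + (2 * s3 * s4) * sech (u4 - u3) = V"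
    by (simp add: V_def mult_ac)
  finally have cV: "(\<lambda>k. (c k)\<^sup>2) sums V" .
  have sums: "(\<lambda>k. a k \<omega> * c k) sums (s1 * X u1 \<omega> + s2 * X u2 \<omega> + s3 * X u3 \<omega> + s4 * X u4 \<omega>)"
    if "converges_on_disc a \<omega>" for \<omega>
  proof -
    have "\<bar>tanh u\<bar> < 1" for u :: real
      using tanh_real_lt_1[of u] tanh_real_gt_neg1[of u] by (simp add: abs_less_iff)
    then have "(\<lambda>k. a k \<omega> * tanh u ^ k) sums f \<omega> (tanh u)" for u
      unfolding f_def by (intro summable_sums summable_a that)
    then have "(\<lambda>k. sech u * (a k \<omega> * tanh u ^ k)) sums X u \<omega>" for u
      unfolding X_def by (rule sums_mult)
    then have "(\<lambda>k. s1 * (sech u1 * (a k \<omega> * tanh u1 ^ k)) + s2 * (sech u2 * (a k \<omega> * tanh u2 ^ k))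
       + s3 * (sech u3 * (a k \<omega> * tanh u3 ^ k)) + s4 * (sech u4 * (a k \<omega> * tanh u4 ^ k))) sums
       (s1 * X u1 \<omega> + s2 * X u2 \<omega> + s3 * X u3 \<omega> + s4 * X u4 \<omega>)"
      by (intro sums_add sums_mult)
    then show ?thesis
      by (simp add: c_def e_def algebra_simps)
  qed
  have "(CLINT \<omega>|M. iexp (s1 * X u1 \<omega> + s2 * X u2 \<omega> + s3 * X u3 \<omega> + s4 * X u4 \<omega>)) =
      (CLINT \<omega>|M. iexp (\<Sum>k. a k \<omega> * c k))"
  proof (rule integral_cong_AE)
    show "AE \<omega> in M. iexp (s1 * X u1 \<omega> + s2 * X u2 \<omega> + s3 * X u3 \<omega> + s4 * X u4 \<omega>) = iexp (\<Sum>k. a k \<omega> * c k)"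
      using AE_converges by eventually_elim (simp only: sums_unique[OF sums])
  qed measurable
  also have "\<dots> = complex_of_real (exp (- V / 2))"
    using AE_converges by (intro char_series cV) (auto elim!: eventually_mono intro: sums_summable[OF sums])
  finally show ?thesis
    by (simp only: V_def)
qed

text \<open>Both sides have the same characteristic function by \<open>cov_factor\<close>, which
  requires no order or distinctness of the points. Repeated points are used below to obtain the one-
  and two-point laws.\<close>

lemma expectation_X4:
  fixes g :: "real \<times> real \<times> real \<times> real \<Rightarrow> real" and u1 u2 u3 u4 :: real
  defines "c i j \<equiv> sech (j - i)" and "t i j \<equiv> tanh (j - i)"
  assumes g[measurable]: "g \<in> borel_measurable (borel \<Otimes>\<^sub>M (borel \<Otimes>\<^sub>M (borel \<Otimes>\<^sub>M borel)))" and B: "\<And>p. norm (g p) \<le> B"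
  shows "expectation (\<lambda>\<omega>. g (X u1 \<omega>, X u2 \<omega>, X u3 \<omega>, X u4 \<omega>)) =
    (LINT x|N1. LINT y|N1. LINT z|N1. LINT w|N1.
      g (x, c u1 u2 * x + t u1 u2 * y, c u1 u3 * x + t u1 u3 * c u2 u3 * y + t u1 u3 * t u2 u3 * z,
        c u1 u4 * x + t u1 u4 * c u2 u4 * y + t u1 u4 * t u2 u4 * c u3 u4 * z + t u1 u4 * t u2 u4 * t u3 u4 * w))"
proof -
  define Y1 Y2 Y3 Y4 :: "real \<times> real \<times> real \<times> real \<Rightarrow> real" where
    "Y1 p = fst p" and "Y2 p = c u1 u2 * fst p + t u1 u2 * fst (snd p)"
    and "Y3 p = c u1 u3 * fst p + t u1 u3 * c u2 u3 * fst (snd p) + t u1 u3 * t u2 u3 * fst (snd (snd p))"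
    and "Y4 p = c u1 u4 * fst p + t u1 u4 * c u2 u4 * fst (snd p) + t u1 u4 * t u2 u4 * c u3 u4 * fst (snd (snd p))
       + t u1 u4 * t u2 u4 * t u3 u4 * snd (snd (snd p))" for p
  have mY: "Y1 \<in> borel_measurable (borel \<Otimes>\<^sub>M (borel \<Otimes>\<^sub>M (borel \<Otimes>\<^sub>M borel)))"
     "Y2 \<in> borel_measurable (borel \<Otimes>\<^sub>M (borel \<Otimes>\<^sub>M (borel \<Otimes>\<^sub>M borel)))"
     "Y3 \<in> borel_measurable (borel \<Otimes>\<^sub>M (borel \<Otimes>\<^sub>M (borel \<Otimes>\<^sub>M borel)))"
     "Y4 \<in> borel_measurable (borel \<Otimes>\<^sub>M (borel \<Otimes>\<^sub>M (borel \<Otimes>\<^sub>M borel)))"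
    unfolding Y1_def[abs_def] Y2_def[abs_def] Y3_def[abs_def] Y4_def[abs_def] by measurable
  have sets: "sets N4 = sets (borel \<Otimes>\<^sub>M (borel \<Otimes>\<^sub>M (borel \<Otimes>\<^sub>M borel)))"
    by (intro sets_pair_measure_cong) auto
  have mY': "Y1 \<in> borel_measurable N4" "Y2 \<in> borel_measurable N4" "Y3 \<in> borel_measurable N4" "Y4 \<in> borel_measurable N4"
    using mY by (simp_all only: measurable_cong_sets[OF sets refl])
  have "expectation (\<lambda>\<omega>. g (X u1 \<omega>, X u2 \<omega>, X u3 \<omega>, X u4 \<omega>)) = (LINT p|N4. g (Y1 p, Y2 p, Y3 p, Y4 p))"
  proof (rule char_unique4[OF _ _ _ _ _ _ mY' _ g])
    show "finite_measure M"
      by (rule finite_measure_axioms)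
    show "finite_measure N4"
      using prob_space_N(3) by (simp add: prob_space_def)
    fix s1 s2 s3 s4
    have "(CLINT p|N4. iexp (s1 * Y1 p + s2 * Y2 p + s3 * Y3 p + s4 * Y4 p)) =
      (CLINT p|N4. iexp ((s1 + c u1 u2 * s2 + c u1 u3 * s3 + c u1 u4 * s4) * fst p
       + (t u1 u2 * s2 + t u1 u3 * c u2 u3 * s3 + t u1 u4 * c u2 u4 * s4) * fst (snd p)
       + (t u1 u3 * t u2 u3 * s3 + t u1 u4 * t u2 u4 * c u3 u4 * s4) * fst (snd (snd p))
       + (t u1 u4 * t u2 u4 * t u3 u4 * s4) * snd (snd (snd p))))"
      by (intro Bochner_Integration.integral_cong refl arg_cong[of _ _ "\<lambda>x. iexp x"])
         (simp add: Y1_def Y2_def Y3_def Y4_def algebra_simps)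
    also have "\<dots> = (CLINT \<omega>|M. iexp (s1 * X u1 \<omega> + s2 * X u2 \<omega> + s3 * X u3 \<omega> + s4 * X u4 \<omega>))"
      unfolding char_N4 char_X c_def t_def cov_factor ..
    finally show "(CLINT \<omega>|M. iexp (s1 * X u1 \<omega> + s2 * X u2 \<omega> + s3 * X u3 \<omega> + s4 * X u4 \<omega>)) =
        (CLINT p|N4. iexp (s1 * Y1 p + s2 * Y2 p + s3 * Y3 p + s4 * Y4 p))" ..
  qed measurable
  also have "\<dots> = (LINT x|N1. LINT y|N1. LINT z|N1. LINT w|N1. g (Y1 (x, y, z, w), Y2 (x, y, z, w), Y3 (x, y, z, w), Y4 (x, y, z, w)))"
  proof (rule integral_N4[where B = B])
    note [measurable] = mY
    show "(\<lambda>p. g (Y1 p, Y2 p, Y3 p, Y4 p)) \<in> borel_measurable (borel \<Otimes>\<^sub>M (borel \<Otimes>\<^sub>M (borel \<Otimes>\<^sub>M borel)))"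
      by measurable
  qed (rule B)
  finally show ?thesis
    by (simp only: Y1_def Y2_def Y3_def Y4_def fst_conv snd_conv)
qed

end

lemma tanh_artanh_real:
  assumes "\<bar>x\<bar> < 1"
  shows "tanh (artanh x) = (x::real)"
proof -
  have q: "0 < (1 + x) / (1 - x)"
    using assms by (auto simp: abs_less_iff)
  have "exp (- 2 * artanh x) = inverse ((1 + x) / (1 - x))"
    using q by (simp add: artanh_def exp_minus)
  then have e: "exp (- 2 * artanh x) = (1 - x) / (1 + x)"
    by simp
  have "1 + x \<noteq> 0"
    using assms by auto
  then have "1 - (1 - x) / (1 + x) = 2 * x / (1 + x)" "1 + (1 - x) / (1 + x) = 2 / (1 + x)"
    by (simp_all add: field_simps)
  then show ?thesis
    unfolding tanh_real_altdef e using \<open>1 + x \<noteq> 0\<close> by simp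
qed

section \<open>Sign correlations and small-ball bounds\<close>

context gaussian_series
begin

lemma integral_N1_const [simp]: "(LINT x|N1. (c::real)) = c"
  using std_normal.prob_space by simp

lemma prob_N1_UNIV [simp]: "std_normal.prob UNIV = 1"
  using std_normal.prob_space by simp

lemma expectation_sgn2:
  assumes "u1 < u2"
  shows "expectation (\<lambda>\<omega>. sgn (X u1 \<omega>) * sgn (X u2 \<omega>)) = 2 / pi * gd_co (u2 - u1)"
proof -
  define c t where "c = sech (u2 - u1)" and "t = tanh (u2 - u1)"
  have t: "0 < t" using assms by (simp add: t_def)
  have "expectation (\<lambda>\<omega>. sgn (X u1 \<omega>) * sgn (X u2 \<omega>)) =
    expectation (\<lambda>\<omega>. (\<lambda>p. sgn (fst p) * sgn (fst (snd p))) (X u1 \<omega>, X u2 \<omega>, X u1 \<omega>, X u1 \<omega>))"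
    by simp
  also have "\<dots> = (LINT x|N1. LINT y|N1. sgn x * sgn (c * x + t * y))"
    by (subst expectation_X4[where B = 1]) (simp_all add: c_def t_def abs_mult abs_sgn_eq)
  also have "\<dots> = (LINT x|N1. sgn x * sgn_normal ((c / t) * x))"
    by (simp only: integral_mult_right_zero integral_sgn_affine[OF t]) simp
  also have "\<dots> = 2 / pi * arctan (c / t)"
    by (rule integral_sgn_sgn_normal)
  also have "arctan (c / t) = gd_co (u2 - u1)"
    using assms by (simp add: c_def t_def sech_div_tanh arctan_inverse_sinh)
  finally show ?thesis .
qed

lemma expectation_sgn4:
  assumes "u1 < u2" "u2 < u3" "u3 < u4"
  shows "expectation (\<lambda>\<omega>. sgn (X u1 \<omega>) * sgn (X u2 \<omega>) * sgn (X u3 \<omega>) * sgn (X u4 \<omega>)) =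
    4 / pi\<^sup>2 * (gd_co (u2 - u1) * gd_co (u4 - u3) - gd_co (u3 - u1) * gd_co (u4 - u2) + gd_co (u3 - u2) * gd_co (u4 - u1))"
proof -
  interpret T: three_points u1 u2 u3
    by standard fact+
  have "expectation (\<lambda>\<omega>. sgn (X u1 \<omega>) * sgn (X u2 \<omega>) * sgn (X u3 \<omega>) * sgn (X u4 \<omega>)) =
    expectation (\<lambda>\<omega>. (\<lambda>p. sgn (fst p) * sgn (fst (snd p)) * sgn (fst (snd (snd p))) * sgn (snd (snd (snd p))))
      (X u1 \<omega>, X u2 \<omega>, X u3 \<omega>, X u4 \<omega>))"
    by simp
  also have "\<dots> = (LINT x|N1. LINT y|N1. LINT z|N1. LINT w|N1.
      sgn x * sgn (T.c12 * x + T.t12 * y) * sgn (T.c13 * x + T.t13 * T.c23 * y + T.t13 * T.t23 * z)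
        * sgn (T.s1 u4 * x + T.t1 u4 * T.s2 u4 * y + T.t1 u4 * T.t2 u4 * T.s3 u4 * z + T.t1 u4 * T.t2 u4 * T.t3 u4 * w))"
    by (subst expectation_X4[where B = 1])
       (simp_all add: abs_mult abs_sgn_eq T.c12_def T.c13_def T.c23_def T.t12_def T.t13_def T.t23_def
         T.s1_def[OF assms(3)] T.s2_def[OF assms(3)] T.s3_def[OF assms(3)]
         T.t1_def[OF assms(3)] T.t2_def[OF assms(3)] T.t3_def[OF assms(3)])
  also have "\<dots> = 4 / pi\<^sup>2 * (T.A12 * gd_co (u4 - u3) - T.A13 * gd_co (u4 - u2) + T.A23 * gd_co (u4 - u1))"
    by (rule T.four_sign_integral) fact
  finally show ?thesis
    by (simp add: T.A12_def T.A13_def T.A23_def)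
qed

text \<open>Each \<open>X u\<close> is standard normal, with density at most 1 / 2, and the interval
  has length 2 e.\<close>

lemma prob_X_le:
  assumes "0 \<le> e"
  shows "prob {\<omega> \<in> space M. \<bar>X u \<omega>\<bar> \<le> e} \<le> e"
proof -
  have "prob {\<omega> \<in> space M. \<bar>X u \<omega>\<bar> \<le> e} = expectation (indicator {\<omega> \<in> space M. \<bar>X u \<omega>\<bar> \<le> e})"
    by simp
  also have "\<dots> = expectation (\<lambda>\<omega>. (\<lambda>p. indicator {- e..e} (fst p)) (X u \<omega>, X u \<omega>, X u \<omega>, X u \<omega>))"
    by (intro Bochner_Integration.integral_cong) (auto split: split_indicator)
  also have "\<dots> = (LINT x|N1. indicator {- e..e} x)"
    by (subst expectation_X4[where B = 1]) (simp_all del: Bochner_Integration.integral_indicator)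
  also have "\<dots> = (LINT x|lborel. std_normal_density x * indicator {- e..e} x)"
    by (rule integral_std_normal) simp
  also have "\<dots> \<le> (LINT x|lborel. 1 / 2 * indicator {- e..e} x)"
  proof (rule integral_mono)
    note * = std_normal_density_le_half
    from * show "std_normal_density x * indicator {- e..e} x \<le> 1 / 2 * indicator {- e..e} x" for x
      by (intro mult_right_mono) auto
    show "integrable lborel (\<lambda>x. 1 / 2 * indicat_real {- e..e} x)"
      using assms by (intro integrable_mult_right integrable_real_indicator) auto
    then show "integrable lborel (\<lambda>x. std_normal_density x * indicat_real {- e..e} x)"
      by (rule Bochner_Integration.integrable_bound)
         (use * normal_density_nonneg in \<open>auto split: split_indicator\<close>)
  qed
  also have "\<dots> = e"
    using assms by simp
  finally show ?thesis .
qed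

text \<open>With x = tanh u the normalising factor \<open>sech u\<close> is at most 1, so a small
  value of f forces a small value of \<open>X u\<close>. The bound is therefore uniform in x, as the
  union over a grid requires.\<close>

lemma prob_f_le:
  assumes "0 \<le> e" "\<bar>x\<bar> < 1"
  shows "prob {\<omega> \<in> space M. \<bar>f \<omega> x\<bar> \<le> e} \<le> e"
proof -
  define u where "u = artanh x"
  have x: "x = tanh u"
    using assms by (simp add: u_def tanh_artanh_real)
  have "\<bar>X u \<omega>\<bar> \<le> \<bar>f \<omega> x\<bar>" for \<omega>
  proof -
    have "sech u * \<bar>f \<omega> x\<bar> \<le> 1 * \<bar>f \<omega> x\<bar>"
      using sech_le_1[of u] by (intro mult_right_mono) (auto simp: sech_def)
    then show ?thesis
      using sech_pos[of u] by (simp add: X_def x[symmetric] abs_mult)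
  qed
  then have "{\<omega> \<in> space M. \<bar>f \<omega> x\<bar> \<le> e} \<subseteq> {\<omega> \<in> space M. \<bar>X u \<omega>\<bar> \<le> e}"
    by (auto intro: order_trans)
  then have "prob {\<omega> \<in> space M. \<bar>f \<omega> x\<bar> \<le> e} \<le> prob {\<omega> \<in> space M. \<bar>X u \<omega>\<bar> \<le> e}"
    by (intro finite_measure_mono) auto
  then show ?thesis
    using prob_X_le[OF assms(1), of u] by simp
qed

lemma AE_f_nonzero:
  assumes "\<bar>x\<bar> < 1"
  shows "AE \<omega> in M. f \<omega> x \<noteq> 0"
proof (rule AE_I')
  show "{\<omega> \<in> space M. \<not> f \<omega> x \<noteq> 0} \<subseteq> {\<omega> \<in> space M. \<bar>f \<omega> x\<bar> \<le> 0}"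
    by auto
  show "{\<omega> \<in> space M. \<bar>f \<omega> x\<bar> \<le> 0} \<in> null_sets M"
    using prob_f_le[OF order_refl assms] by (intro null_setsI) (auto simp: emeasure_eq_measure intro: order_antisym)
qed

section \<open>Derivatives of the series and simplicity of its zeros\<close>

definition f1 :: "'w \<Rightarrow> real \<Rightarrow> real" where "f1 \<omega> x = (\<Sum>k. diffs (\<lambda>k. a k \<omega>) k * x ^ k)"
definition f2 :: "'w \<Rightarrow> real \<Rightarrow> real" where "f2 \<omega> x = (\<Sum>k. diffs (diffs (\<lambda>k. a k \<omega>)) k * x ^ k)"

lemma
  assumes c: "converges_on_disc a \<omega>" and x: "\<bar>x\<bar> < 1"
  shows DERIV_f: "(f \<omega> has_real_derivative f1 \<omega> x) (at x)"
    and DERIV_f1: "(f1 \<omega> has_real_derivative f2 \<omega> x) (at x)"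
    and isCont_f2: "isCont (f2 \<omega>) x"
proof -
  have s0: "summable (\<lambda>k. a k \<omega> * y ^ k)" if "norm y < 1" for y
    using summable_a[OF c, of y] that by simp
  have s1: "summable (\<lambda>k. diffs (\<lambda>k. a k \<omega>) k * y ^ k)" if "norm y < 1" for y :: real
    using s0 that by (rule termdiff_converges[rotated]) auto
  have s2: "summable (\<lambda>k. diffs (diffs (\<lambda>k. a k \<omega>)) k * y ^ k)" if "norm y < 1" for y :: real
    using s1 that by (rule termdiff_converges[rotated]) auto
  show "(f \<omega> has_real_derivative f1 \<omega> x) (at x)"
    unfolding f_def[abs_def] f1_def using s0 x by (intro termdiffs_strong'[of 1]) auto
  show "(f1 \<omega> has_real_derivative f2 \<omega> x) (at x)"
    unfolding f1_def[abs_def] f2_def using s1 x by (intro termdiffs_strong'[of 1]) auto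
  have "(f2 \<omega> has_real_derivative (\<Sum>k. diffs (diffs (diffs (\<lambda>k. a k \<omega>))) k * x ^ k)) (at x)"
    unfolding f2_def[abs_def] using s2 x by (intro termdiffs_strong'[of 1]) auto
  then show "isCont (f2 \<omega>) x"
    by (rule DERIV_isCont)
qed

lemma continuous_on_f:
  assumes "converges_on_disc a \<omega>" "r < 1"
  shows "continuous_on {-r..r} (f \<omega>)"
  using assms by (intro continuous_at_imp_continuous_on ballI DERIV_isCont[OF DERIV_f]) auto

text \<open>Bulinskaya's argument: near a double zero the function is quadratically small on a grid,
  which is too unlikely for a bounded density.\<close>

lemma AE_simple_zeros:
  assumes r: "0 < r" "r < 1"
  shows "AE \<omega> in M. \<forall>x\<in>{-r..r}. f \<omega> x = 0 \<longrightarrow> f1 \<omega> x \<noteq> 0"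
proof -
  define \<delta> where "\<delta> n = 2 * r / real (Suc n)" for n
  \<comment> \<open>The union has n + 2 members, each of probability at most
    \<open>K * (\<delta> n)\<^sup>2\<close>, which is of order 1 / n^2. So the events for fixed K
    have probabilities tending to 0.\<close>
  define B where "B K n = (\<Union>i\<le>Suc n. {\<omega> \<in> space M. \<bar>f \<omega> (- r + real i * \<delta> n)\<bar> \<le> real K * (\<delta> n)\<^sup>2})" for K n
  have grid: "- r + real i * \<delta> n \<in> {-r..r}" if "i \<le> Suc n" for i n
  proof -
    have "real i * \<delta> n \<le> real (Suc n) * \<delta> n"
      using that r by (intro mult_right_mono) (auto simp: \<delta>_def)
    also have "\<dots> = 2 * r"
      by (simp add: \<delta>_def)
    finally show ?thesis
      using r by (auto simp: \<delta>_def)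
  qed
  have B_sets [measurable]: "B K n \<in> sets M" for K n
    unfolding B_def by measurable
  have B_prob: "prob (B K n) \<le> real (n + 2) * (real K * (\<delta> n)\<^sup>2)" for K n
  proof -
    have "prob (B K n) \<le> (\<Sum>i\<le>Suc n. prob {\<omega> \<in> space M. \<bar>f \<omega> (- r + real i * \<delta> n)\<bar> \<le> real K * (\<delta> n)\<^sup>2})"
      unfolding B_def by (rule finite_measure_subadditive_finite) auto
    also have "\<dots> \<le> (\<Sum>i\<le>Suc n. real K * (\<delta> n)\<^sup>2)"
    proof (intro sum_mono prob_f_le)
      fix i assume "i \<in> {..Suc n}"
      then show "\<bar>- r + real i * \<delta> n\<bar> < 1"
        using grid[of i n] r by (auto simp: abs_less_iff)
    qed simp
    also have "\<dots> = real (n + 2) * (real K * (\<delta> n)\<^sup>2)"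
      by simp
    finally show ?thesis .
  qed
  have null: "(\<Inter>n. B K n) \<in> null_sets M" for K
  proof -
    have "(\<lambda>n. real (n + 2) * (real K * (\<delta> n)\<^sup>2)) \<longlonglongrightarrow> 0"
    proof -
      have "(\<lambda>n. (1 + 1 / real (Suc n)) * (4 * r\<^sup>2 * real K / real (Suc n))) \<longlonglongrightarrow> (1 + 0) * 0"
        by (intro tendsto_intros LIMSEQ_Suc[OF lim_const_over_n])
      also have "(\<lambda>n. (1 + 1 / real (Suc n)) * (4 * r\<^sup>2 * real K / real (Suc n))) = (\<lambda>n. real (n + 2) * (real K * (\<delta> n)\<^sup>2))"
        by (auto simp: \<delta>_def fun_eq_iff power2_eq_square field_simps)
      finally show ?thesis by simp
    qed
    moreover have "prob (\<Inter>n. B K n) \<le> real (n + 2) * (real K * (\<delta> n)\<^sup>2)" for n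
      by (rule order_trans[OF finite_measure_mono B_prob]) auto
    ultimately have "prob (\<Inter>n. B K n) \<le> 0"
      by (intro LIMSEQ_le_const) auto
    then have "prob (\<Inter>n. B K n) = 0"
      by (rule order_antisym) simp
    then show ?thesis
      by (intro null_setsI) (auto simp: emeasure_eq_measure)
  qed
  have "AE \<omega> in M. \<forall>K. \<omega> \<notin> (\<Inter>n. B K n)"
    unfolding AE_all_countable by (intro allI AE_not_in null)
  then show ?thesis
    using AE_converges AE_space
  proof eventually_elim
    case (elim \<omega>)
    show ?case
    proof (intro ballI impI notI)
      fix z assume z: "z \<in> {-r..r}" "f \<omega> z = 0" "f1 \<omega> z = 0"
      have ball: "\<bar>x\<bar> < 1" if "x \<in> {-r..r}" for x
        using that r by auto
      have "compact (f2 \<omega> ` {-r..r})"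
        using isCont_f2[OF elim(2) ball] by (intro compact_continuous_image continuous_at_imp_continuous_on) auto
      then obtain C where C: "\<And>x. x \<in> {-r..r} \<Longrightarrow> \<bar>f2 \<omega> x\<bar> \<le> C"
        by (meson bounded_real compact_imp_bounded imageI)
      obtain K :: nat where K: "C \<le> real K"
        using real_arch_simple by blast
      have d1: "\<bar>f1 \<omega> x\<bar> \<le> real K * \<bar>x - z\<bar>" if "x \<in> {-r..r}" for x
      proof -
        have "norm (f1 \<omega> x - f1 \<omega> z) \<le> real K * norm (x - z)"
        proof (rule field_differentiable_bound[of "{-r..r}" "f1 \<omega>" "f2 \<omega>"])
          fix y assume y: "y \<in> {-r..r}"
          show "(f1 \<omega> has_field_derivative f2 \<omega> y) (at y within {-r..r})"
            by (rule has_field_derivative_at_within[OF DERIV_f1[OF elim(2) ball[OF y]]])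
          show "norm (f2 \<omega> y) \<le> real K"
            using C[OF y] K by simp
        qed (use that z(1) in auto)
        then show ?thesis
          using z(3) by simp
      qed
      have d0: "\<bar>f \<omega> x\<bar> \<le> real K * \<bar>x - z\<bar>\<^sup>2" if x: "x \<in> {-r..r}" for x
      proof -
        \<comment> \<open>Only the segment between x and z is used: there the bound on
          \<open>f1\<close> is at most \<open>K * \<bar>x - z\<bar>\<close>, which yields the
          square.\<close>
        define I where "I = {min x z..max x z}"
        have I: "I \<subseteq> {-r..r}" using x z by (auto simp: I_def)
        have "norm (f \<omega> x - f \<omega> z) \<le> (real K * \<bar>x - z\<bar>) * norm (x - z)"
        proof (rule field_differentiable_bound[of I "f \<omega>" "f1 \<omega>"])
          fix y assume y: "y \<in> I"
          show "(f \<omega> has_field_derivative f1 \<omega> y) (at y within I)"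
            by (rule has_field_derivative_at_within[OF DERIV_f[OF elim(2) ball[OF subsetD[OF I y]]]])
          have "\<bar>f1 \<omega> y\<bar> \<le> real K * \<bar>y - z\<bar>"
            using d1 I y by blast
          also have "\<dots> \<le> real K * \<bar>x - z\<bar>"
            using y by (intro mult_left_mono) (auto simp: I_def)
          finally show "norm (f1 \<omega> y) \<le> real K * \<bar>x - z\<bar>"
            by simp
        qed (auto simp: I_def)
        then show ?thesis
          using z by (simp add: power2_eq_square mult.assoc)
      qed
      have "\<omega> \<in> B K n" for n
      proof -
        \<comment> \<open>The index of the last grid point not to the right of z; its distance to z
          is less than \<delta>.\<close>
        define i where "i = nat \<lfloor>(z + r) / \<delta> n\<rfloor>"
        have \<delta>: "0 < \<delta> n" using r by (simp add: \<delta>_def)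
        have zr: "0 \<le> (z + r) / \<delta> n"
          using z \<delta> by simp
        then have i: "real i \<le> (z + r) / \<delta> n" "(z + r) / \<delta> n < real i + 1"
          unfolding i_def by linarith+
        have "(z + r) / \<delta> n \<le> 2 * r / \<delta> n"
          using z \<delta> by (intro divide_right_mono) auto
        also have "\<dots> = real (Suc n)"
          using r by (simp add: \<delta>_def)
        finally have "i \<le> Suc n"
          using i(1) by linarith
        moreover have "\<bar>- r + real i * \<delta> n - z\<bar> \<le> \<delta> n"
          using i \<delta> by (simp add: field_simps abs_le_iff)
        then have "\<bar>- r + real i * \<delta> n - z\<bar>\<^sup>2 \<le> (\<delta> n)\<^sup>2"
          by (intro power_mono) auto
        then have "\<bar>f \<omega> (- r + real i * \<delta> n)\<bar> \<le> real K * (\<delta> n)\<^sup>2"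
          by (intro order_trans[OF d0[OF grid[OF \<open>i \<le> Suc n\<close>]]] mult_left_mono) auto
        ultimately show ?thesis
          unfolding B_def using elim(3) by auto
      qed
      then show False
        using elim(1) by blast
    qed
  qed
qed

end

subsection \<open>Sign changes and zeros\<close>

lemma simple_zero_sgn:
  fixes F :: "real \<Rightarrow> real"
  assumes "(F has_real_derivative l) (at z)" "F z = 0" "l \<noteq> 0"
  obtains d where "0 < d" "\<And>y. z < y \<Longrightarrow> y < z + d \<Longrightarrow> sgn (F y) = sgn l"
    "\<And>y. z - d < y \<Longrightarrow> y < z \<Longrightarrow> sgn (F y) = - sgn l"
proof (cases "0 < l")
  case True
  obtain d1 where d1: "0 < d1" "\<And>h. 0 < h \<Longrightarrow> h < d1 \<Longrightarrow> F z < F (z + h)"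
    using DERIV_pos_inc_right[OF assms(1) True] by blast
  obtain d2 where d2: "0 < d2" "\<And>h. 0 < h \<Longrightarrow> h < d2 \<Longrightarrow> F (z - h) < F z"
    using DERIV_pos_inc_left[OF assms(1) True] by blast
  show ?thesis
  proof (rule that[of "min d1 d2"])
    show "sgn (F y) = sgn l" if "z < y" "y < z + min d1 d2" for y
      using d1(2)[of "y - z"] that assms(2) True by simp
    show "sgn (F y) = - sgn l" if "z - min d1 d2 < y" "y < z" for y
      using d2(2)[of "z - y"] that assms(2) True by simp
  qed (use d1 d2 in simp)
next
  case False
  then have l: "l < 0" using assms(3) by simp
  obtain d1 where d1: "0 < d1" "\<And>h. 0 < h \<Longrightarrow> h < d1 \<Longrightarrow> F (z + h) < F z"
    using DERIV_neg_dec_right[OF assms(1) l] by blast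
  obtain d2 where d2: "0 < d2" "\<And>h. 0 < h \<Longrightarrow> h < d2 \<Longrightarrow> F z < F (z - h)"
    using DERIV_neg_dec_left[OF assms(1) l] by blast
  show ?thesis
  proof (rule that[of "min d1 d2"])
    show "sgn (F y) = sgn l" if "z < y" "y < z + min d1 d2" for y
      using d1(2)[of "y - z"] that assms(2) l by simp
    show "sgn (F y) = - sgn l" if "z - min d1 d2 < y" "y < z" for y
      using d2(2)[of "z - y"] that assms(2) l by simp
  qed (use d1 d2 in simp)
qed

text \<open>By compactness infinitely many zeros would accumulate, by continuity at a zero; but a
  simple zero is isolated, as the sign is nonzero on either side.\<close>

lemma finite_simple_zeros:
  fixes F :: "real \<Rightarrow> real"
  assumes cont: "continuous_on {p..q} F"
    and simple: "\<And>z. z \<in> {p..q} \<Longrightarrow> F z = 0 \<Longrightarrow> \<exists>l. (F has_real_derivative l) (at z) \<and> l \<noteq> 0"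
  shows "finite {z \<in> {p..q}. F z = 0}"
proof (rule ccontr)
  assume inf: "infinite {z \<in> {p..q}. F z = 0}"
  have "{z \<in> {p..q}. F z = 0} \<subseteq> {p..q}"
    by blast
  from Heine_Borel_imp_Bolzano_Weierstrass[OF compact_Icc inf this]
  obtain z where z: "z \<in> {p..q}" "z islimpt {z \<in> {p..q}. F z = 0}"
    by (elim bexE)
  have "closed {z \<in> {p..q}. F z = 0}"
    using continuous_closed_preimage_constant[OF cont] by simp
  then have "F z = 0"
    using z(2) unfolding closed_limpt by blast
  then obtain l where l: "(F has_real_derivative l) (at z)" "l \<noteq> 0"
    using simple z(1) by blast
  obtain d where d: "0 < d" "\<And>y. z < y \<Longrightarrow> y < z + d \<Longrightarrow> sgn (F y) = sgn l"
    "\<And>y. z - d < y \<Longrightarrow> y < z \<Longrightarrow> sgn (F y) = - sgn l"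
    using simple_zero_sgn[OF l(1) \<open>F z = 0\<close> l(2)] by metis
  obtain y where y: "y \<in> {z \<in> {p..q}. F z = 0}" "y \<noteq> z" "dist y z < d"
    using z(2)[unfolded islimpt_approachable, rule_format, OF d(1)] by blast
  then show False
    using d(2)[of y] d(3)[of y] l(2) by (cases "z < y") (simp_all add: dist_real_def sgn_zero_iff)
qed

text \<open>Product -1 demands nonzero values at both ends, so a grid point that is itself a zero
  never counts.\<close>

definition sign_changes :: "(real \<Rightarrow> real) \<Rightarrow> (nat \<Rightarrow> real) \<Rightarrow> nat \<Rightarrow> nat set" where
  "sign_changes F g m = {i. i < m \<and> sgn (F (g i)) * sgn (F (g (Suc i))) = - 1}"

lemma finite_sign_changes [simp]: "finite (sign_changes F g m)"
  by (simp add: sign_changes_def)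

lemma card_sign_changes:
  assumes "\<And>i. i \<le> m \<Longrightarrow> F (g i) \<noteq> 0"
  shows "real (card (sign_changes F g m)) = (\<Sum>i<m. (1 - sgn (F (g i)) * sgn (F (g (Suc i)))) / 2)"
proof -
  have "(1 - sgn (F (g i)) * sgn (F (g (Suc i)))) / 2 = (if i \<in> sign_changes F g m then 1 else 0)" if "i < m" for i
    using assms[of i] assms[of "Suc i"] that by (auto simp: sign_changes_def sgn_if)
  then have "(\<Sum>i<m. (1 - sgn (F (g i)) * sgn (F (g (Suc i)))) / 2) = (\<Sum>i<m. if i \<in> sign_changes F g m then 1 else 0)"
    by (intro sum.cong) auto
  also have "\<dots> = real (card ({..<m} \<inter> sign_changes F g m))"
    by (simp add: sum.If_cases)
  also have "{..<m} \<inter> sign_changes F g m = sign_changes F g m"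
    by (auto simp: sign_changes_def)
  finally show ?thesis ..
qed

lemma sgn_mult_neg_zero:
  fixes F :: "real \<Rightarrow> real"
  assumes "continuous_on {p..q} F" "p < q" "sgn (F p) * sgn (F q) = - 1"
  shows "\<exists>z. p < z \<and> z < q \<and> F z = 0"
proof -
  have n: "F p \<noteq> 0" "F q \<noteq> 0"
    using assms(3) by auto
  have "\<exists>z\<ge>p. z \<le> q \<and> F z = 0"
  proof (cases "F p < 0")
    case True
    then have "0 < F q"
      using assms(3) n by (auto simp: sgn_if split: if_splits)
    then show ?thesis
      using True assms by (intro IVT'[of F p 0 q]) auto
  next
    case False
    then have "F q < 0"
      using assms(3) n by (auto simp: sgn_if split: if_splits)
    then show ?thesis
      using False assms by (intro IVT2'[of F q 0 p]) auto
  qed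
  then show ?thesis
    using n by (metis order_le_less)
qed

text \<open>The intermediate value theorem puts a zero into each open cell with a sign change, and
  the open cells are disjoint.\<close>

lemma card_sign_changes_le:
  fixes F :: "real \<Rightarrow> real" and g :: "nat \<Rightarrow> real"
  assumes g: "strict_mono g" and cont: "continuous_on {g 0..g m} F" and fin: "finite {z \<in> {g 0..g m}. F z = 0}"
  shows "card (sign_changes F g m) \<le> card {z \<in> {g 0..g m}. F z = 0}"
proof -
  have mono: "g i \<le> g j" if "i \<le> j" for i j
    using g that by (simp add: strict_mono_less_eq)
  have "\<exists>z. g i < z \<and> z < g (Suc i) \<and> F z = 0" if "i \<in> sign_changes F g m" for i
  proof (rule sgn_mult_neg_zero)
    show "continuous_on {g i..g (Suc i)} F"
      using that mono[of 0 i] mono[of "Suc i" m] by (intro continuous_on_subset[OF cont]) (auto simp: sign_changes_def)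
  qed (use that strict_monoD[OF g] in \<open>auto simp: sign_changes_def\<close>)
  then obtain z where z: "\<And>i. i \<in> sign_changes F g m \<Longrightarrow> g i < z i \<and> z i < g (Suc i) \<and> F (z i) = 0"
    by metis
  have "inj_on z (sign_changes F g m)"
  proof (rule inj_onI)
    fix i j assume ij: "i \<in> sign_changes F g m" "j \<in> sign_changes F g m" "z i = z j"
    show "i = j"
    proof (rule ccontr)
      assume "i \<noteq> j"
      then consider "Suc i \<le> j" | "Suc j \<le> i" by linarith
      then show False
        using z[OF ij(1)] z[OF ij(2)] ij(3) mono[of "Suc i" j] mono[of "Suc j" i] by cases auto
    qed
  qed
  moreover have "z ` sign_changes F g m \<subseteq> {z \<in> {g 0..g m}. F z = 0}"
  proof
    fix y assume "y \<in> z ` sign_changes F g m"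
    then obtain i where i: "i \<in> sign_changes F g m" "y = z i" by auto
    then show "y \<in> {z \<in> {g 0..g m}. F z = 0}"
      using z[OF i(1)] mono[of 0 i] mono[of "Suc i" m] by (auto simp: sign_changes_def)
  qed
  ultimately show ?thesis
    using fin by (rule card_inj_on_le)
qed

lemma grid_cell:
  fixes g :: "nat \<Rightarrow> real"
  assumes "g 0 \<le> z" "z \<le> g m" "0 < m"
  shows "\<exists>i<m. g i \<le> z \<and> z \<le> g (Suc i)"
  using assms
proof (induction m)
  case (Suc m)
  show ?case
  proof (cases "g m \<le> z")
    case True
    then show ?thesis using Suc.prems by auto
  next
    case False
    then have "0 < m" using Suc.prems by (cases m) auto
    then show ?thesis
      using Suc.IH Suc.prems False by (auto intro: less_SucI)
  qed
qed simp

text \<open>Around each simple zero the sign is constant and opposite on the two sides. Once the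
  mesh is below all these radii, no cell holds two zeros, and the ends of a cell with a zero have
  opposite signs.\<close>

lemma sign_changes_fine_grid:
  fixes F :: "real \<Rightarrow> real"
  assumes fin: "finite {z \<in> {p..q}. F z = 0}"
    and simple: "\<And>z. z \<in> {p..q} \<Longrightarrow> F z = 0 \<Longrightarrow> \<exists>l. (F has_real_derivative l) (at z) \<and> l \<noteq> 0"
  shows "\<exists>\<epsilon>>0. \<forall>g m. 0 < m \<and> g 0 = p \<and> g m = q \<and> (\<forall>i\<le>m. F (g i) \<noteq> 0) \<and> (\<forall>i<m. g (Suc i) - g i < \<epsilon>) \<longrightarrow>
      card {z \<in> {p..q}. F z = 0} \<le> card (sign_changes F g m)"
proof -
  let ?Z = "{z \<in> {p..q}. F z = 0}"
  define P where "P z d s \<longleftrightarrow> 0 < d \<and> (s = 1 \<or> s = - 1) \<and> (\<forall>y. z < y \<and> y < z + d \<longrightarrow> sgn (F y) = s) \<and>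
      (\<forall>y. z - d < y \<and> y < z \<longrightarrow> sgn (F y) = - s)" for z d s
  have "\<exists>c. P z (fst c) (snd c)" if z: "z \<in> ?Z" for z
  proof -
    obtain l where l: "(F has_real_derivative l) (at z)" "l \<noteq> 0"
      using simple z by blast
    have Fz: "F z = 0" using z by simp
    obtain d where d: "0 < d" "\<And>y. z < y \<Longrightarrow> y < z + d \<Longrightarrow> sgn (F y) = sgn l"
      "\<And>y. z - d < y \<Longrightarrow> y < z \<Longrightarrow> sgn (F y) = - sgn l"
      using simple_zero_sgn[OF l(1) Fz l(2)] by metis
    then have "P z d (sgn l)"
      using l(2) by (auto simp: P_def sgn_if)
    then show ?thesis
      by (intro exI[of _ "(d, sgn l)"]) simp
  qed
  then obtain c where c: "\<And>z. z \<in> ?Z \<Longrightarrow> P z (fst (c z)) (snd (c z))"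
    by metis
  define d s where "d z = fst (c z)" and "s z = snd (c z)" for z
  have ds: "0 < d z" "s z = 1 \<or> s z = - 1"
      "z < y \<Longrightarrow> y < z + d z \<Longrightarrow> sgn (F y) = s z"
      "z - d z < y \<Longrightarrow> y < z \<Longrightarrow> sgn (F y) = - s z" if "z \<in> ?Z" for z y
    using c[OF that] by (auto simp: P_def d_def s_def)
  \<comment> \<open>The 1 keeps the minimum defined when there are no zeros.\<close>
  define \<epsilon> where "\<epsilon> = Min (insert 1 (d ` ?Z))"
  have \<epsilon>: "0 < \<epsilon>" "\<And>z. z \<in> ?Z \<Longrightarrow> \<epsilon> \<le> d z"
    using fin ds(1) by (auto simp: \<epsilon>_def)
  have "card ?Z \<le> card (sign_changes F g m)"
    if m: "0 < m" and g: "g 0 = p" "g m = q" and nz: "\<And>i. i \<le> m \<Longrightarrow> F (g i) \<noteq> 0" and mesh: "\<And>i. i < m \<Longrightarrow> g (Suc i) - g i < \<epsilon>"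
    for g :: "nat \<Rightarrow> real" and m
  proof -
    have "\<exists>i. i < m \<and> g i < z \<and> z < g (Suc i)" if z: "z \<in> ?Z" for z
    proof -
      obtain i where i: "i < m" "g i \<le> z" "z \<le> g (Suc i)"
        using grid_cell[of g z m] g m z by auto
      moreover have "g i \<noteq> z" "z \<noteq> g (Suc i)"
        using nz[of i] nz[of "Suc i"] z i(1) by auto
      ultimately show ?thesis by force
    qed
    then obtain c where c: "\<And>z. z \<in> ?Z \<Longrightarrow> c z < m \<and> g (c z) < z \<and> z < g (Suc (c z))"
      by metis
    have "inj_on c ?Z"
    proof (rule inj_onI, rule ccontr)
      fix z y assume zy: "z \<in> ?Z" "y \<in> ?Z" "c z = c y" "z \<noteq> y"
      have no: False if "z \<in> ?Z" "y \<in> ?Z" "c z = c y" "z < y" for z y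
      proof -
        have "y - z < d z"
          using c[OF that(1)] c[OF that(2)] mesh[of "c z"] that(3) \<epsilon>(2)[OF that(1)] by auto
        then have "sgn (F y) = s z"
          using ds(3)[OF that(1), of y] that(4) by simp
        then show False
          using that(2) ds(2)[OF that(1)] by auto
      qed
      show False
        using no[OF zy(1,2,3)] no[OF zy(2,1) zy(3)[symmetric]] zy(4) by linarith
    qed
    moreover have "c ` ?Z \<subseteq> sign_changes F g m"
    proof
      fix i assume "i \<in> c ` ?Z"
      then obtain z where z: "z \<in> ?Z" "i = c z" by auto
      have "g (Suc i) < z + d z" "z - d z < g i"
        using c[OF z(1)] mesh[of i] \<epsilon>(2)[OF z(1)] z(2) by auto
      then have "sgn (F (g (Suc i))) = s z" "sgn (F (g i)) = - s z"
        using ds(3)[OF z(1), of "g (Suc i)"] ds(4)[OF z(1), of "g i"] c[OF z(1)] z(2) by auto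
      then show "i \<in> sign_changes F g m"
        using c[OF z(1)] z(2) ds(2)[OF z(1)] by (auto simp: sign_changes_def)
    qed
    ultimately show ?thesis
      by (rule card_inj_on_le) simp
  qed
  then show ?thesis
    using \<epsilon>(1) by (intro exI[of _ \<epsilon>]) blast
qed

subsection \<open>Counting points by dyadic cells\<close>

text \<open>The index j stands for the half-open dyadic cell from (j - 1) / 2^n, excluded, to j /
  2^n, included. Whether a cell meets the zero set is a measurable event, which makes these counts
  the route to measurability.\<close>

definition cells :: "nat \<Rightarrow> real set \<Rightarrow> int set" where
  "cells n Z = (\<lambda>z. \<lceil>2 ^ n * z\<rceil>) ` Z"

lemma inj_on_cells:
  assumes "finite F"
  shows "\<forall>\<^sub>F n in sequentially. inj_on (\<lambda>z::real. \<lceil>2 ^ n * z\<rceil>) F"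
proof -
  have "\<forall>\<^sub>F n in sequentially. \<forall>z\<in>F. \<forall>y\<in>F. z < y \<longrightarrow> \<lceil>2 ^ n * z\<rceil> \<noteq> \<lceil>2 ^ n * y\<rceil>"
  proof (intro eventually_ball_finite assms ballI)
    fix z y :: real
    show "\<forall>\<^sub>F n in sequentially. z < y \<longrightarrow> \<lceil>2 ^ n * z\<rceil> \<noteq> \<lceil>2 ^ n * y\<rceil>"
    proof (cases "z < y")
      case True
      then obtain N where N: "1 / (y - z) < 2 ^ N"
        using real_arch_pow[of 2 "1 / (y - z)"] by auto
      have "2 ^ n * z + 1 \<le> 2 ^ n * y" if "N \<le> n" for n
      proof -
        have "1 / (y - z) \<le> 2 ^ n"
          using N power_increasing[OF that, of "2::real"] by linarith
        then show ?thesis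
          using True by (simp add: field_simps)
      qed
      then have "\<lceil>2 ^ n * z\<rceil> \<noteq> \<lceil>2 ^ n * y\<rceil>" if "N \<le> n" for n
        using ceiling_mono[of "2 ^ n * z + 1" "2 ^ n * y"] that by fastforce
      then show ?thesis
        unfolding eventually_sequentially by blast
    qed simp
  qed
  then show ?thesis
  proof eventually_elim
    case (elim n)
    show ?case
    proof (rule inj_onI, rule ccontr)
      fix z y assume "z \<in> F" "y \<in> F" "\<lceil>2 ^ n * z\<rceil> = \<lceil>2 ^ n * y\<rceil>" "z \<noteq> y"
      then show False
        using elim[rule_format, of z y] elim[rule_format, of y z] by linarith
    qed
  qed
qed

lemma card_cells_limit:
  assumes "finite Z"
  shows "(\<lambda>n. real (card (cells n Z))) \<longlonglongrightarrow> real (card Z)"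
proof (rule tendsto_eventually)
  show "\<forall>\<^sub>F n in sequentially. real (card (cells n Z)) = real (card Z)"
    using inj_on_cells[OF assms] by eventually_elim (simp add: cells_def card_image)
qed

text \<open>An infinite set contains finite subsets of any size, and fine enough cells separate each
  of them. The assumption excludes the default \<open>card\<close> 0 of an infinite index
  set.\<close>

lemma card_cells_bounded_iff:
  assumes fin: "\<And>n. finite (cells n Z)"
  shows "(\<exists>B. \<forall>n. card (cells n Z) \<le> B) \<longleftrightarrow> finite Z"
proof
  assume "finite Z"
  then show "\<exists>B. \<forall>n. card (cells n Z) \<le> B"
    by (intro exI[of _ "card Z"]) (simp add: cells_def card_image_le)
next
  assume "\<exists>B. \<forall>n. card (cells n Z) \<le> B"
  then obtain B where B: "\<And>n. card (cells n Z) \<le> B" by blast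
  show "finite Z"
  proof (rule ccontr)
    assume "infinite Z"
    then obtain F where F: "F \<subseteq> Z" "finite F" "card F = Suc B"
      using infinite_arbitrarily_large by blast
    obtain n where "inj_on (\<lambda>z. \<lceil>2 ^ n * z\<rceil>) F"
      using inj_on_cells[OF F(2)] unfolding eventually_sequentially by blast
    then have "Suc B = card (cells n F)"
      using F by (simp add: cells_def card_image)
    also have "\<dots> \<le> card (cells n Z)"
      using fin F(1) by (intro card_mono) (auto simp: cells_def)
    finally show False
      using B[of n] by simp
  qed
qed

subsection \<open>Measurability of the number of zeros\<close>

text \<open>By induction: a new last row and column each contain every lag once. The argument of
  \<beta> is the lag minus 1, the number of cells strictly between.\<close>

lemma double_sum_lags:
  fixes \<beta> :: "nat \<Rightarrow> real"
  shows "(\<Sum>i<Suc n. \<Sum>j<Suc n. if i = j then \<alpha> else if i < j then \<beta> (j - i - 1) else \<beta> (i - j - 1))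
    = real (Suc n) * \<alpha> + 2 * (\<Sum>d<n. (real n - real d) * \<beta> d)"
proof (induction n)
  case (Suc n)
  define c where "c i j = (if i = j then \<alpha> else if i < j then \<beta> (j - i - 1) else \<beta> (i - j - 1))" for i j
  have row: "(\<Sum>i<Suc n. c i (Suc n)) = (\<Sum>d<Suc n. \<beta> d)" "(\<Sum>i<Suc n. c (Suc n) i) = (\<Sum>d<Suc n. \<beta> d)"
  proof -
    have "(\<Sum>i<Suc n. c i (Suc n)) = (\<Sum>i<Suc n. \<beta> (Suc n - Suc i))"
      by (intro sum.cong) (auto simp: c_def)
    also have "\<dots> = (\<Sum>d<Suc n. \<beta> d)"
      by (rule sum.nat_diff_reindex)
    finally show "(\<Sum>i<Suc n. c i (Suc n)) = (\<Sum>d<Suc n. \<beta> d)" .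
    moreover have "c (Suc n) i = c i (Suc n)" for i
      by (auto simp: c_def)
    ultimately show "(\<Sum>i<Suc n. c (Suc n) i) = (\<Sum>d<Suc n. \<beta> d)"
      by simp
  qed
  have "(\<Sum>i<Suc (Suc n). \<Sum>j<Suc (Suc n). c i j) =
      (\<Sum>i<Suc n. \<Sum>j<Suc n. c i j) + (\<Sum>i<Suc n. c i (Suc n)) + (\<Sum>j<Suc n. c (Suc n) j) + c (Suc n) (Suc n)"
    unfolding sum.lessThan_Suc[of _ "Suc n"] sum.distrib by simp
  also have "\<dots> = real (Suc n) * \<alpha> + 2 * (\<Sum>d<n. (real n - real d) * \<beta> d) + 2 * (\<Sum>d<Suc n. \<beta> d) + \<alpha>"
    unfolding row using Suc.IH by (simp add: c_def)
  also have "\<dots> = real (Suc (Suc n)) * \<alpha> + 2 * (\<Sum>d<Suc n. (real (Suc n) - real d) * \<beta> d)"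
    by (simp add: algebra_simps sum.distrib sum_subtractf)
  finally show ?case
    unfolding c_def .
qed simp

section \<open>Zeros in closed intervals and in dyadic cells as events\<close>

context gaussian_series
begin

lemma real_zeros_eq:
  assumes "converges_on_disc a \<omega>" "r < 1"
  shows "real_zeros a r \<omega> = {x \<in> {-r..r}. f \<omega> x = 0}"
proof -
  have "random_series a \<omega> (complex_of_real x) = 0 \<longleftrightarrow> f \<omega> x = 0" if "x \<in> {-r..r}" for x
    using random_series_eq[OF assms(1), of x] that assms(2) by (auto simp: abs_less_iff)
  then show ?thesis
    unfolding real_zeros_def by blast
qed

text \<open>On a compact interval a continuous function has a zero iff its modulus has infimum 0,
  and the infimum can be taken over the countably many grid points.\<close>

lemma measurable_zero_in_interval:
  assumes p: "- 1 < p" "q < 1"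
  shows "Measurable.pred M (\<lambda>\<omega>. converges_on_disc a \<omega> \<and> (\<exists>z\<in>{p..q}. f \<omega> z = 0))"
proof (cases "p \<le> q")
  case True
  define x where "x n j = p + (q - p) * (real j / real (Suc n))" for n j
  have x_in: "x n j \<in> {p..q}" if "j \<le> Suc n" for n j
  proof -
    have "(q - p) * (real j / real (Suc n)) \<le> (q - p) * 1"
      using that True by (intro mult_left_mono) auto
    then show ?thesis
      using True by (simp add: x_def)
  qed
  have "(\<exists>z\<in>{p..q}. f \<omega> z = 0) \<longleftrightarrow> (\<forall>m. \<exists>n. \<exists>j\<in>{..Suc n}. \<bar>f \<omega> (x n j)\<bar> < 1 / real (Suc m))"
    if c: "converges_on_disc a \<omega>" for \<omega>
  proof
    have cont: "continuous_on {p..q} (f \<omega>)"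
      using p by (intro continuous_at_imp_continuous_on ballI DERIV_isCont[OF DERIV_f[OF c]]) auto
    show "\<forall>m. \<exists>n. \<exists>j\<in>{..Suc n}. \<bar>f \<omega> (x n j)\<bar> < 1 / real (Suc m)" if ex: "\<exists>z\<in>{p..q}. f \<omega> z = 0"
    proof
      fix m
      obtain z where z: "z \<in> {p..q}" "f \<omega> z = 0" using ex by blast
      obtain d where d: "0 < d" "\<And>y. y \<in> {p..q} \<Longrightarrow> dist y z < d \<Longrightarrow> dist (f \<omega> y) (f \<omega> z) < 1 / real (Suc m)"
        using cont[unfolded continuous_on_iff, rule_format, OF z(1), of "1 / real (Suc m)"] by auto
      obtain n :: nat where "(q - p) / d < real n"
        using reals_Archimedean2 by blast
      then have n: "(q - p) / real (Suc n) < d"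
        using d(1) True by (simp add: field_simps)
      \<comment> \<open>The relative position of z in the interval; the case q = p avoids a division
        by 0.\<close>
      define s where "s = (if q = p then 0 else (z - p) / (q - p))"
      have s: "0 \<le> s" "s \<le> 1" "z = p + (q - p) * s"
        using z(1) True by (auto simp: s_def divide_le_eq)
      define j where "j = nat \<lfloor>s * real (Suc n)\<rfloor>"
      have "0 \<le> s * real (Suc n)"
        using s by simp
      then have j: "real j \<le> s * real (Suc n)" "s * real (Suc n) < real j + 1"
        unfolding j_def by linarith+
      have "s * real (Suc n) \<le> 1 * real (Suc n)"
        using s by (intro mult_right_mono) auto
      from order_trans[OF j(1) this] have "real j \<le> real (Suc n)"
        by (simp only: mult_1)
      then have jn: "j \<le> Suc n"
        by (simp only: of_nat_le_iff)
      have "real j / real (Suc n) - s = (real j - s * real (Suc n)) / real (Suc n)"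
        by (simp add: diff_divide_distrib)
      moreover have "\<bar>real j - s * real (Suc n)\<bar> \<le> 1"
        using j by linarith
      ultimately have "\<bar>real j / real (Suc n) - s\<bar> \<le> 1 / real (Suc n)"
        by (simp only: abs_divide abs_of_nat divide_right_mono of_nat_0_le_iff)
      then have "\<bar>(q - p) * (real j / real (Suc n) - s)\<bar> \<le> (q - p) * (1 / real (Suc n))"
        unfolding abs_mult using True by (intro mult_mono) auto
      also have "(q - p) * (real j / real (Suc n) - s) = x n j - z"
        by (simp add: x_def s(3) algebra_simps)
      finally have "dist (x n j) z < d"
        using n by (simp add: dist_real_def)
      then have "\<bar>f \<omega> (x n j)\<bar> < 1 / real (Suc m)"
        using d(2)[OF x_in[OF jn]] z(2) by (simp add: dist_real_def)
      then show "\<exists>n. \<exists>j\<in>{..Suc n}. \<bar>f \<omega> (x n j)\<bar> < 1 / real (Suc m)"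
        using jn by (intro exI[of _ n] bexI[of _ j]) simp_all
    qed
    show "\<exists>z\<in>{p..q}. f \<omega> z = 0" if small: "\<forall>m. \<exists>n. \<exists>j\<in>{..Suc n}. \<bar>f \<omega> (x n j)\<bar> < 1 / real (Suc m)"
    proof -
      have "\<exists>z\<in>{p..q}. \<forall>y\<in>{p..q}. \<bar>f \<omega> z\<bar> \<le> \<bar>f \<omega> y\<bar>"
        using True by (intro continuous_attains_inf continuous_intros cont) auto
      then obtain z where z: "z \<in> {p..q}" "\<And>y. y \<in> {p..q} \<Longrightarrow> \<bar>f \<omega> z\<bar> \<le> \<bar>f \<omega> y\<bar>"
        by blast
      have le: "\<bar>f \<omega> z\<bar> \<le> 1 / real (Suc m)" for m
      proof -
        obtain n j where "j \<in> {..Suc n}" "\<bar>f \<omega> (x n j)\<bar> < 1 / real (Suc m)"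
          using small by blast
        then show ?thesis
          using z(2)[OF x_in[of j n]] by simp
      qed
      have "(\<lambda>m. 1 / real (Suc m)) \<longlonglongrightarrow> 0"
        by (rule LIMSEQ_Suc[OF lim_const_over_n])
      then have "\<bar>f \<omega> z\<bar> \<le> 0"
        by (rule LIMSEQ_le_const) (use le in blast)
      then show ?thesis
        using z(1) by auto
    qed
  qed
  then have eq: "(\<lambda>\<omega>. converges_on_disc a \<omega> \<and> (\<exists>z\<in>{p..q}. f \<omega> z = 0)) =
      (\<lambda>\<omega>. converges_on_disc a \<omega> \<and> (\<forall>m. \<exists>n. \<exists>j\<in>{..Suc n}. \<bar>f \<omega> (x n j)\<bar> < 1 / real (Suc m)))"
    by (intro ext conj_cong refl)
  show ?thesis
    unfolding eq by measurable
qed simp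

lemma cells_subset:
  assumes "0 < r" "r < 1" "Z \<subseteq> {-r..r}"
  shows "cells n Z \<subseteq> {- (2 ^ n)..2 ^ n}"
proof
  fix j assume "j \<in> cells n Z"
  then obtain z where z: "z \<in> Z" "j = \<lceil>2 ^ n * z\<rceil>"
    by (auto simp: cells_def)
  have zr: "- 1 \<le> z" "z \<le> 1"
    using assms z(1) by force+
  have "2 ^ n * z \<le> 2 ^ n * 1" "2 ^ n * (- 1) \<le> 2 ^ n * z"
    using zr by (intro mult_left_mono; simp)+
  then have "2 ^ n * z \<le> real_of_int (2 ^ n)" "real_of_int (- (2 ^ n)) \<le> 2 ^ n * z"
    by simp_all
  then have "\<lceil>2 ^ n * z\<rceil> \<le> 2 ^ n" "- (2 ^ n) \<le> \<lceil>2 ^ n * z\<rceil>"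
    by (simp_all only: ceiling_le_iff) (simp add: le_ceiling_iff)
  then show "j \<in> {- (2 ^ n)..2 ^ n}"
    using z(2) by simp
qed

lemma measurable_cells:
  assumes r: "0 < r" "r < 1"
  shows "(\<lambda>\<omega>. if converges_on_disc a \<omega> then real (card (cells n {x \<in> {-r..r}. f \<omega> x = 0})) else 0) \<in> borel_measurable M"
proof -
  \<comment> \<open>A half-open cell is exhausted by closed intervals that start 1 / (k + 1) after
    its excluded left end, to which the previous criterion applies.\<close>
  define Q where "Q j k \<omega> \<longleftrightarrow> converges_on_disc a \<omega> \<and>
      (\<exists>z\<in>{max (- r) ((real_of_int j - 1) / 2 ^ n + 1 / real (Suc k))..min r (real_of_int j / 2 ^ n)}. f \<omega> z = 0)" for j k \<omega>
  have [measurable]: "Measurable.pred M (Q j k)" for j k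
    unfolding Q_def[abs_def] using r by (intro measurable_zero_in_interval) auto
  have mem: "j \<in> cells n {x \<in> {-r..r}. f \<omega> x = 0} \<longleftrightarrow> (\<exists>k. Q j k \<omega>)" if c: "converges_on_disc a \<omega>" for j \<omega>
  proof
    assume "j \<in> cells n {x \<in> {-r..r}. f \<omega> x = 0}"
    then obtain z where z: "z \<in> {-r..r}" "f \<omega> z = 0" "j = \<lceil>2 ^ n * z\<rceil>"
      by (auto simp: cells_def)
    have j: "real_of_int j - 1 < 2 ^ n * z" "2 ^ n * z \<le> real_of_int j"
      unfolding z(3) by linarith+
    then have "0 < z - (real_of_int j - 1) / 2 ^ n"
      by (simp add: field_simps)
    then obtain k where "inverse (real (Suc k)) < z - (real_of_int j - 1) / 2 ^ n"
      using reals_Archimedean by blast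
    then have "(real_of_int j - 1) / 2 ^ n + 1 / real (Suc k) \<le> z"
      by (simp add: inverse_eq_divide)
    moreover have "z \<le> real_of_int j / 2 ^ n"
      using j(2) by (simp add: field_simps)
    ultimately have "Q j k \<omega>"
      unfolding Q_def using c z(1,2) by (intro conjI bexI[of _ z]) auto
    then show "\<exists>k. Q j k \<omega>" ..
  next
    assume "\<exists>k. Q j k \<omega>"
    then obtain k z where z: "z \<in> {-r..r}" "f \<omega> z = 0" "(real_of_int j - 1) / 2 ^ n + 1 / real (Suc k) \<le> z" "z \<le> real_of_int j / 2 ^ n"
      by (auto simp: Q_def)
    have "(real_of_int j - 1) / 2 ^ n < z"
      using z(3) by (rule order_less_le_trans[rotated]) simp
    then have "real_of_int j - 1 < 2 ^ n * z" "2 ^ n * z \<le> real_of_int j"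
      using z(4) by (simp_all add: field_simps)
    then have "\<lceil>2 ^ n * z\<rceil> = j"
      by (intro ceiling_unique) auto
    then show "j \<in> cells n {x \<in> {-r..r}. f \<omega> x = 0}"
      using z(1,2) by (auto simp: cells_def)
  qed
  have "(if converges_on_disc a \<omega> then real (card (cells n {x \<in> {-r..r}. f \<omega> x = 0})) else 0) =
      (if converges_on_disc a \<omega> then (\<Sum>j\<in>{- (2 ^ n)..2 ^ n}. if \<exists>k. Q j k \<omega> then 1 else 0) else 0)" for \<omega>
  proof (cases "converges_on_disc a \<omega>")
    case True
    have "(\<Sum>j\<in>{- (2 ^ n)..2 ^ n}. if \<exists>k. Q j k \<omega> then 1 else (0::real)) =
        (\<Sum>j\<in>{- (2 ^ n)..2 ^ n}. if j \<in> cells n {x \<in> {-r..r}. f \<omega> x = 0} then 1 else 0)"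
      using mem[OF True] by simp
    also have "\<dots> = real (card ({- (2 ^ n)..2 ^ n} \<inter> cells n {x \<in> {-r..r}. f \<omega> x = 0}))"
      by (simp add: sum.If_cases)
    also have "{- (2 ^ n)..2 ^ n} \<inter> cells n {x \<in> {-r..r}. f \<omega> x = 0} = cells n {x \<in> {-r..r}. f \<omega> x = 0}"
      using cells_subset[OF r, of "{x \<in> {-r..r}. f \<omega> x = 0}" n] by blast
    finally show ?thesis
      using True by simp
  qed simp
  then show ?thesis
    by simp
qed

text \<open>The count is 0 where there are infinitely many zeros; this event is detected by unbounded cell
  counts, so that measurability holds without completing \<open>M\<close>.\<close>

lemma measurable_num_real_zeros:
  assumes r: "0 < r" "r < 1"
  shows "num_real_zeros a r \<in> borel_measurable M"
proof -
  define Z where "Z \<omega> = {x \<in> {-r..r}. f \<omega> x = 0}" for \<omega>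
  define H where "H n \<omega> = (if converges_on_disc a \<omega> then real (card (cells n (Z \<omega>))) else 0)" for n \<omega>
  have [measurable]: "H n \<in> borel_measurable M" for n
    unfolding H_def[abs_def] Z_def using measurable_cells[OF r] .
  have fin: "finite (cells n (Z \<omega>))" for n \<omega>
    using cells_subset[OF r, of "Z \<omega>" n] by (rule finite_subset) (auto simp: Z_def)
  define G where "G n \<omega> = (if \<exists>B::nat. \<forall>n. H n \<omega> \<le> real B then H n \<omega> else 0)" for n \<omega>
  have Gm: "G n \<in> borel_measurable M" for n
    unfolding G_def[abs_def] by measurable
  show ?thesis
  proof (rule borel_measurable_LIMSEQ_real[OF _ Gm])
    fix \<omega>
    show "(\<lambda>n. G n \<omega>) \<longlonglongrightarrow> num_real_zeros a r \<omega>"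
    proof (cases "converges_on_disc a \<omega>")
      case True
      have N: "num_real_zeros a r \<omega> = real (card (Z \<omega>))"
        using True real_zeros_eq[OF True r(2)] by (simp add: num_real_zeros_def Z_def)
      have B: "(\<exists>B::nat. \<forall>n. H n \<omega> \<le> real B) \<longleftrightarrow> finite (Z \<omega>)"
        using card_cells_bounded_iff[OF fin, of \<omega>] True by (simp add: H_def)
      show ?thesis
      proof (cases "finite (Z \<omega>)")
        case fin: True
        then have "G n \<omega> = real (card (cells n (Z \<omega>)))" for n
          using B True by (simp only: G_def if_True) (simp add: H_def)
        then show ?thesis
          using card_cells_limit[OF fin] N by simp
      next
        case False
        then have "G n \<omega> = 0" for n
          using B by (simp only: G_def if_False simp_thms)
        then show ?thesis
          using False N by simp
      qed
    next
      case False
      then show ?thesis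
        by (simp add: G_def H_def num_real_zeros_def)
    qed
  qed
qed

end

subsection \<open>Moments of the number of sign changes\<close>

context gaussian_series
begin

lemma AE_X_nonzero: "AE \<omega> in M. X u \<omega> \<noteq> 0"
proof -
  have "\<bar>tanh u\<bar> < 1"
    using tanh_real_lt_1[of u] tanh_real_gt_neg1[of u] by (simp add: abs_less_iff)
  from AE_f_nonzero[OF this] show ?thesis
    by eventually_elim (simp add: X_def sech_pos[THEN less_imp_neq, symmetric])
qed

lemma integrable_bounded_M:
  fixes g :: "'w \<Rightarrow> real"
  assumes "g \<in> borel_measurable M" "\<And>\<omega>. \<bar>g \<omega>\<bar> \<le> B"
  shows "integrable M g"
  using assms by (intro integrable_const_bound[where B = B]) auto

definition sgn_pair :: "real \<Rightarrow> real \<Rightarrow> nat \<Rightarrow> 'w \<Rightarrow> real" where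
  "sgn_pair v h i \<omega> = sgn (X (v + real i * h) \<omega>) * sgn (X (v + real (Suc i) * h) \<omega>)"

lemma measurable_sgn_pair [measurable]: "sgn_pair v h i \<in> borel_measurable M"
  unfolding sgn_pair_def[abs_def] by measurable

lemma abs_sgn_pair_le: "\<bar>sgn_pair v h i \<omega>\<bar> \<le> 1"
  by (simp add: sgn_pair_def abs_mult abs_sgn_eq)

lemma expectation_sgn_pair:
  assumes "0 < h"
  shows "expectation (sgn_pair v h i) = 2 / pi * gd_co h"
  using expectation_sgn2[of "v + real i * h" "v + real (Suc i) * h"] assms
  by (simp add: sgn_pair_def[abs_def] algebra_simps)

lemma expectation_sgn_pair_square: "expectation (\<lambda>\<omega>. sgn_pair v h i \<omega> * sgn_pair v h i \<omega>) = 1"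
proof -
  have "expectation (\<lambda>\<omega>. sgn_pair v h i \<omega> * sgn_pair v h i \<omega>) = expectation (\<lambda>_. 1)"
  proof (rule integral_cong_AE)
    show "AE \<omega> in M. sgn_pair v h i \<omega> * sgn_pair v h i \<omega> = 1"
      using AE_X_nonzero[of "v + real i * h"] AE_X_nonzero[of "v + real (Suc i) * h"]
      by eventually_elim (auto simp: sgn_pair_def sgn_if)
  qed auto
  then show ?thesis
    by (simp add: prob_space)
qed

text \<open>The four-point formula needs distinct points and covers j > i + 1. For adjacent cells
  the common point drops out by sgn^2 = 1; the same expression stays valid there because
  \<open>gd_co 0 = pi / 2\<close> lets the squares cancel.\<close>

lemma expectation_sgn_pair_mult:
  assumes h: "0 < h" and ij: "i < j"
  shows "expectation (\<lambda>\<omega>. sgn_pair v h i \<omega> * sgn_pair v h j \<omega>) = (2 / pi * gd_co h)\<^sup>2 +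
    4 / pi\<^sup>2 * (gd_co (real (j - i - 1 + 2) * h) * gd_co (real (j - i - 1) * h) - (gd_co (real (j - i - 1 + 1) * h))\<^sup>2)"
proof -
  define d where "d = j - i - 1"
  have j: "j = i + d + 1"
    using ij by (simp add: d_def)
  show ?thesis
  proof (cases "d = 0")
    case True
    then have j: "j = Suc i" using j by simp
    have "expectation (\<lambda>\<omega>. sgn_pair v h i \<omega> * sgn_pair v h j \<omega>) =
        expectation (\<lambda>\<omega>. sgn (X (v + real i * h) \<omega>) * sgn (X (v + real (Suc (Suc i)) * h) \<omega>))"
    proof (rule integral_cong_AE)
      show "AE \<omega> in M. sgn_pair v h i \<omega> * sgn_pair v h j \<omega> = sgn (X (v + real i * h) \<omega>) * sgn (X (v + real (Suc (Suc i)) * h) \<omega>)"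
        using AE_X_nonzero[of "v + real (Suc i) * h"] unfolding j sgn_pair_def
        by eventually_elim (auto simp: sgn_if)
    qed auto
    also have "\<dots> = 2 / pi * gd_co (2 * h)"
      using expectation_sgn2[of "v + real i * h" "v + real (Suc (Suc i)) * h"] h
      by (simp add: algebra_simps)
    finally show ?thesis
      unfolding d_def[symmetric] True by (simp add: power2_eq_square field_simps)
  next
    case False
    then have d: "0 < d" by simp
    let ?u = "\<lambda>k. v + real k * h"
    have "?u i < ?u (Suc i)" "?u (Suc i) < ?u j" "?u j < ?u (Suc j)"
      using h d unfolding j by simp_all
    from expectation_sgn4[OF this]
    have "expectation (\<lambda>\<omega>. sgn_pair v h i \<omega> * sgn_pair v h j \<omega>) = 4 / pi\<^sup>2 *
      (gd_co (?u (Suc i) - ?u i) * gd_co (?u (Suc j) - ?u j) - gd_co (?u j - ?u i) * gd_co (?u (Suc j) - ?u (Suc i))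
       + gd_co (?u j - ?u (Suc i)) * gd_co (?u (Suc j) - ?u i))"
      by (simp add: sgn_pair_def mult.assoc)
    moreover have "?u (Suc i) - ?u i = h" "?u (Suc j) - ?u j = h" "?u j - ?u i = real (d + 1) * h"
        "?u (Suc j) - ?u (Suc i) = real (d + 1) * h" "?u j - ?u (Suc i) = real d * h" "?u (Suc j) - ?u i = real (d + 2) * h"
      unfolding j by (simp_all add: algebra_simps)
    ultimately have "expectation (\<lambda>\<omega>. sgn_pair v h i \<omega> * sgn_pair v h j \<omega>) = 4 / pi\<^sup>2 *
        (gd_co h * gd_co h - gd_co (real (d + 1) * h) * gd_co (real (d + 1) * h) + gd_co (real d * h) * gd_co (real (d + 2) * h))"
      by (simp only:)
    then show ?thesis
      unfolding d_def[symmetric] by (simp add: power2_eq_square algebra_simps)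
  qed
qed

text \<open>A polynomial in the signs, so that its moments follow from the correlations. It equals
  the number of sign changes off the null event that \<open>X\<close> vanishes at a grid
  point.\<close>

definition changes :: "real \<Rightarrow> real \<Rightarrow> nat \<Rightarrow> 'w \<Rightarrow> real" where
  "changes v h n \<omega> = (\<Sum>i<Suc n. (1 - sgn_pair v h i \<omega>) / 2)"

lemma measurable_changes [measurable]: "changes v h n \<in> borel_measurable M"
  unfolding changes_def[abs_def] by measurable

lemma changes_bounds: "0 \<le> changes v h n \<omega>" "changes v h n \<omega> \<le> real (Suc n)"
proof -
  have "0 \<le> (1 - sgn_pair v h i \<omega>) / 2" "(1 - sgn_pair v h i \<omega>) / 2 \<le> 1" for i
    using abs_sgn_pair_le[of v h i \<omega>] by (auto simp: abs_le_iff)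
  note b = this
  show "0 \<le> changes v h n \<omega>"
    unfolding changes_def by (intro sum_nonneg b)
  have "changes v h n \<omega> \<le> real (card {..<Suc n}) * 1"
    unfolding changes_def by (intro sum_bounded_above b)
  then show "changes v h n \<omega> \<le> real (Suc n)"
    by (simp only: card_lessThan mult_1_right)
qed

lemma expectation_changes:
  assumes "0 < h"
  shows "expectation (changes v h n) = real (Suc n) * (1 / 2 - gd_co h / pi)"
proof -
  have i: "integrable M (sgn_pair v h i)" for i
    by (rule integrable_bounded_M[where B = 1]) (auto simp: abs_sgn_pair_le)
  have "expectation (changes v h n) = (\<Sum>i<Suc n. expectation (\<lambda>\<omega>. (1 - sgn_pair v h i \<omega>) / 2))"
    unfolding changes_def using i by (intro Bochner_Integration.integral_sum) auto
  also have "\<dots> = (\<Sum>i<Suc n. 1 / 2 - gd_co h / pi)"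
  proof (rule sum.cong)
    fix i
    show "expectation (\<lambda>\<omega>. (1 - sgn_pair v h i \<omega>) / 2) = 1 / 2 - gd_co h / pi"
      using i expectation_sgn_pair[OF assms, of v i] by (simp add: prob_space field_simps)
  qed simp
  finally show ?thesis
    by simp
qed

text \<open>Almost surely the count is a sum of n + 1 indicators of probability q. The term
  \<open>q * (1 - q)\<close> is the variance of one of them, and the sum over d collects the
  covariances by lag.\<close>

lemma expectation_changes_square:
  assumes h: "0 < h"
  defines "q \<equiv> 1 / 2 - gd_co h / pi"
  shows "expectation (\<lambda>\<omega>. (changes v h n \<omega>)\<^sup>2) = (expectation (changes v h n))\<^sup>2 + real (Suc n) * (q * (1 - q))
     + 2 / pi\<^sup>2 * (\<Sum>d<n. (real n - real d) * (gd_co (real (d + 2) * h) * gd_co (real d * h) - (gd_co (real (d + 1) * h))\<^sup>2))"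
proof -
  define \<rho> where "\<rho> = 2 / pi * gd_co h"
  define D where "D d = gd_co (real (d + 2) * h) * gd_co (real d * h) - (gd_co (real (d + 1) * h))\<^sup>2" for d
  \<comment> \<open>Covariances of the products \<open>sgn_pair\<close>; the indicators (1 -
    \<open>sgn_pair\<close>) / 2 have a quarter of them.\<close>
  define c where "c i j = (if i = j then 1 - \<rho>\<^sup>2 else if i < j then 4 / pi\<^sup>2 * D (j - i - 1) else 4 / pi\<^sup>2 * D (i - j - 1))" for i j
  have i: "integrable M (sgn_pair v h i)" for i
    by (rule integrable_bounded_M[where B = 1]) (auto simp: abs_sgn_pair_le)
  have i2: "integrable M (\<lambda>\<omega>. sgn_pair v h i \<omega> * sgn_pair v h j \<omega>)" for i j
  proof (rule integrable_bounded_M[where B = 1])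
    show "\<bar>sgn_pair v h i \<omega> * sgn_pair v h j \<omega>\<bar> \<le> 1" for \<omega>
      using mult_mono[OF abs_sgn_pair_le[of v h i \<omega>] abs_sgn_pair_le[of v h j \<omega>]] by (simp add: abs_mult)
  qed simp
  have ep: "expectation (sgn_pair v h i) = \<rho>" for i
    by (simp only: expectation_sgn_pair[OF h] \<rho>_def)
  have epp: "expectation (\<lambda>\<omega>. sgn_pair v h i \<omega> * sgn_pair v h j \<omega>) = \<rho>\<^sup>2 + c i j" for i j
  proof (cases i j rule: linorder_cases)
    case less
    then show ?thesis
      using expectation_sgn_pair_mult[OF h less, of v] by (simp add: c_def D_def \<rho>_def)
  next
    case equal
    then show ?thesis
      using expectation_sgn_pair_square[of v h j] by (simp add: c_def)
  next
    case greater
    then show ?thesis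
      using expectation_sgn_pair_mult[OF h greater, of v] by (simp add: c_def D_def \<rho>_def mult.commute)
  qed
  have "(changes v h n \<omega>)\<^sup>2 = (\<Sum>i<Suc n. \<Sum>j<Suc n. (1 - sgn_pair v h i \<omega> - sgn_pair v h j \<omega> + sgn_pair v h i \<omega> * sgn_pair v h j \<omega>) / 4)" for \<omega>
    unfolding changes_def power2_eq_square sum_product
    by (intro sum.cong refl) (simp add: field_simps)
  then have "expectation (\<lambda>\<omega>. (changes v h n \<omega>)\<^sup>2) =
      (\<Sum>i<Suc n. \<Sum>j<Suc n. expectation (\<lambda>\<omega>. (1 - sgn_pair v h i \<omega> - sgn_pair v h j \<omega> + sgn_pair v h i \<omega> * sgn_pair v h j \<omega>) / 4))"
    using i i2 by (simp add: Bochner_Integration.integral_sum del: sum.lessThan_Suc)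
  also have "\<dots> = (\<Sum>i<Suc n. \<Sum>j<Suc n. ((1 - \<rho>)\<^sup>2 + c i j) / 4)"
  proof (intro sum.cong refl)
    fix i j
    show "expectation (\<lambda>\<omega>. (1 - sgn_pair v h i \<omega> - sgn_pair v h j \<omega> + sgn_pair v h i \<omega> * sgn_pair v h j \<omega>) / 4) = ((1 - \<rho>)\<^sup>2 + c i j) / 4"
      using i i2 by (simp add: ep epp prob_space power2_eq_square algebra_simps)
  qed
  also have "\<dots> = (real (Suc n) * ((1 - \<rho>) / 2))\<^sup>2 + (\<Sum>i<Suc n. \<Sum>j<Suc n. c i j) / 4"
  proof -
    have "(\<Sum>i<Suc n. \<Sum>j<Suc n. (K + c i j) / 4) = real (Suc n) * (real (Suc n) * (K / 4)) + (\<Sum>i<Suc n. \<Sum>j<Suc n. c i j) / 4" for K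
      by (simp add: add_divide_distrib sum.distrib sum_divide_distrib[symmetric] del: sum.lessThan_Suc)
    moreover have "real (Suc n) * (real (Suc n) * ((1 - \<rho>)\<^sup>2 / 4)) = (real (Suc n) * ((1 - \<rho>) / 2))\<^sup>2"
      by (simp add: power2_eq_square)
    ultimately show ?thesis
      by simp
  qed
  also have "(\<Sum>i<Suc n. \<Sum>j<Suc n. c i j) = real (Suc n) * (1 - \<rho>\<^sup>2) + 2 * (\<Sum>d<n. (real n - real d) * (4 / pi\<^sup>2 * D d))"
    unfolding c_def by (rule double_sum_lags)
  also have "(\<Sum>d<n. (real n - real d) * (4 / pi\<^sup>2 * D d)) = 4 / pi\<^sup>2 * (\<Sum>d<n. (real n - real d) * D d)"
    by (simp add: sum_distrib_left mult_ac)
  also have "real (Suc n) * ((1 - \<rho>) / 2) = expectation (changes v h n)"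
    unfolding expectation_changes[OF h] by (simp add: \<rho>_def field_simps)
  also have "1 - \<rho>\<^sup>2 = 4 * (q * (1 - q))"
    by (simp add: q_def \<rho>_def power2_eq_square field_simps)
  finally show ?thesis
    by (simp add: D_def)
qed

text \<open>(n + 1) q tends to L / pi while q tends to 0, so the diagonal contributes L / pi as for
  a Poisson count. The pairs are \<open>var_fun_limit\<close>.\<close>

lemma changes_limits:
  assumes L: "0 < L"
  defines "h n \<equiv> L / real (Suc n)"
  shows "(\<lambda>n. expectation (changes v (h n) n)) \<longlonglongrightarrow> L / pi"
    and "(\<lambda>n. expectation (\<lambda>\<omega>. (changes v (h n) n \<omega>)\<^sup>2)) \<longlonglongrightarrow> (L / pi)\<^sup>2 + L / pi + 2 / pi\<^sup>2 * var_fun L"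
proof -
  have h: "0 < h n" for n
    using L by (simp add: h_def)
  define q where "q n = 1 / 2 - gd_co (h n) / pi" for n
  have q1: "(\<lambda>n. real (Suc n) * q n) \<longlonglongrightarrow> L / pi"
    unfolding q_def h_def by (rule gd_co_limit_0[OF L])
  have "(\<lambda>n. (real (Suc n) * q n) * (1 / real (Suc n))) \<longlonglongrightarrow> L / pi * 0"
    by (intro tendsto_mult q1 LIMSEQ_Suc[OF lim_const_over_n])
  then have q0: "q \<longlonglongrightarrow> 0"
    by simp
  show E: "(\<lambda>n. expectation (changes v (h n) n)) \<longlonglongrightarrow> L / pi"
    unfolding expectation_changes[OF h] using q1 by (simp add: q_def)
  have "(\<lambda>n. (expectation (changes v (h n) n))\<^sup>2 + (real (Suc n) * q n) * (1 - q n) + 2 / pi\<^sup>2 *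
      (\<Sum>d<n. (real n - real d) * (gd_co (real (d + 2) * h n) * gd_co (real d * h n) - (gd_co (real (d + 1) * h n))\<^sup>2)))
      \<longlonglongrightarrow> (L / pi)\<^sup>2 + L / pi * (1 - 0) + 2 / pi\<^sup>2 * var_fun L"
    by (intro tendsto_intros E q1 q0 var_fun_limit[OF L, folded h_def])
  then show "(\<lambda>n. expectation (\<lambda>\<omega>. (changes v (h n) n \<omega>)\<^sup>2)) \<longlonglongrightarrow> (L / pi)\<^sup>2 + L / pi + 2 / pi\<^sup>2 * var_fun L"
    unfolding expectation_changes_square[OF h] by (simp add: q_def mult.assoc)
qed

end

subsection \<open>Convergence of the sign-change counts\<close>

context gaussian_series
begin

lemma tanh_lipschitz: "\<bar>tanh x - tanh y\<bar> \<le> \<bar>x - (y::real)\<bar>"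
proof -
  have "\<bar>tanh x - tanh y\<bar> \<le> 1 * \<bar>x - y\<bar>"
  proof (rule lipschitz_of_deriv[of tanh "\<lambda>x. 1 - (tanh x)\<^sup>2"])
    show "(tanh has_real_derivative 1 - (tanh z)\<^sup>2) (at z)" for z :: real
      by (auto intro!: derivative_eq_intros)
    show "\<bar>1 - (tanh z)\<^sup>2\<bar> \<le> 1" for z :: real
    proof -
      have "1 - (tanh z)\<^sup>2 = (sech z)\<^sup>2"
        using tanh_sech_square[of z] by simp
      moreover have "(sech z)\<^sup>2 \<le> 1"
        using tanh_sech_square[of z] zero_le_power2[of "tanh z"] by linarith
      ultimately show ?thesis by simp
    qed
  qed
  then show ?thesis by simp
qed

text \<open>The grid is uniform in u and is mapped to [-r, r] by \<open>tanh\<close>, which is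
  1-Lipschitz, so its mesh tends to 0. Almost surely all grid values are nonzero and all zeros are
  simple; then the counts never exceed the number of zeros and eventually equal it.\<close>

lemma changes_converge:
  assumes r: "0 < r" "r < 1"
  defines "U \<equiv> artanh r" and "h n \<equiv> 2 * artanh r / real (Suc n)"
  shows "AE \<omega> in M. finite (real_zeros a r \<omega>) \<and> (\<forall>n. changes (- U) (h n) n \<omega> \<le> num_real_zeros a r \<omega>) \<and>
     (\<lambda>n. changes (- U) (h n) n \<omega>) \<longlonglongrightarrow> num_real_zeros a r \<omega>"
proof -
  have tU: "tanh U = r"
    unfolding U_def using r by (intro tanh_artanh_real) auto
  have U: "0 < U"
    using tU r(1) by (metis tanh_real_pos_iff)
  have h: "0 < h n" for n
    using U by (simp add: h_def U_def)
  define g where "g n i = tanh (- U + real i * h n)" for n i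
  have g1: "\<bar>g n i\<bar> < 1" for n i
    using tanh_real_lt_1[of "- U + real i * h n"] tanh_real_gt_neg1[of "- U + real i * h n"]
    by (simp add: g_def abs_less_iff)
  have g0: "g n 0 = - r" for n
    by (simp add: g_def tU)
  have gm: "g n (Suc n) = r" for n
  proof -
    have "- U + real (Suc n) * h n = U"
      by (simp add: h_def U_def)
    then show ?thesis
      by (simp only: g_def tU)
  qed
  have g_mono: "strict_mono (g n)" for n
    using h[of n] by (auto simp: strict_mono_def g_def)
  have mesh: "g n (Suc i) - g n i \<le> h n" for n i
    using tanh_lipschitz[of "- U + real (Suc i) * h n" "- U + real i * h n"] h[of n]
    by (simp add: g_def algebra_simps)
  have h0: "h \<longlonglongrightarrow> 0"
    unfolding h_def by (rule LIMSEQ_Suc[OF lim_const_over_n])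
  have "AE \<omega> in M. \<forall>n i. f \<omega> (g n i) \<noteq> 0"
    unfolding AE_all_countable using AE_f_nonzero[OF g1] by blast
  then show ?thesis
    using AE_converges AE_simple_zeros[OF r]
  proof eventually_elim
    case (elim \<omega>)
    let ?Z = "{x \<in> {-r..r}. f \<omega> x = 0}"
    have simple: "\<exists>l. (f \<omega> has_real_derivative l) (at z) \<and> l \<noteq> 0" if "z \<in> {-r..r}" "f \<omega> z = 0" for z
      using DERIV_f[OF elim(2), of z] elim(3) that r by (auto simp: abs_less_iff)
    have cont: "continuous_on {-r..r} (f \<omega>)"
      using elim(2) r(2) by (rule continuous_on_f)
    have fin: "finite ?Z"
      using cont simple by (rule finite_simple_zeros)
    have N: "num_real_zeros a r \<omega> = real (card ?Z)"
      using elim(2) real_zeros_eq[OF elim(2) r(2)] by (simp add: num_real_zeros_def)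
    have S: "changes (- U) (h n) n \<omega> = real (card (sign_changes (f \<omega>) (g n) (Suc n)))" for n
    proof -
      have "sgn_pair (- U) (h n) i \<omega> = sgn (f \<omega> (g n i)) * sgn (f \<omega> (g n (Suc i)))" for i
        by (simp only: sgn_pair_def sgn_X g_def)
      then show ?thesis
        using elim(1) by (subst card_sign_changes) (simp_all only: changes_def, simp_all)
    qed
    have le: "card (sign_changes (f \<omega>) (g n) (Suc n)) \<le> card ?Z" for n
      using card_sign_changes_le[OF g_mono, of n "Suc n" "f \<omega>"] cont fin unfolding g0 gm by blast
    obtain \<epsilon> where \<epsilon>: "0 < \<epsilon>" "\<And>g m. 0 < m \<Longrightarrow> g 0 = - r \<Longrightarrow> g m = r \<Longrightarrow> (\<forall>i\<le>m. f \<omega> (g i) \<noteq> 0) \<Longrightarrow>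
        (\<forall>i<m. g (Suc i) - g i < \<epsilon>) \<Longrightarrow> card ?Z \<le> card (sign_changes (f \<omega>) g m)"
      using sign_changes_fine_grid[OF fin simple] by blast
    have "\<forall>\<^sub>F n in sequentially. h n < \<epsilon>"
      using h0 \<epsilon>(1) by (rule order_tendstoD)
    then have "\<forall>\<^sub>F n in sequentially. changes (- U) (h n) n \<omega> = num_real_zeros a r \<omega>"
    proof eventually_elim
      case (elim n)
      have "card ?Z \<le> card (sign_changes (f \<omega>) (g n) (Suc n))"
      proof (rule \<epsilon>(2)[OF _ g0 gm])
        show "\<forall>i<Suc n. g n (Suc i) - g n i < \<epsilon>"
          using mesh elim by (meson order_le_less_trans)
      qed (use \<open>\<forall>n i. f \<omega> (g n i) \<noteq> 0\<close> in auto)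
      then show ?case
        using le[of n] by (simp add: S N)
    qed
    then show ?case
      using fin le by (auto simp: real_zeros_eq[OF elim(2) r(2)] S N intro: tendsto_eventually)
  qed
qed

lemma num_real_zeros_moments:
  assumes r: "0 < r" "r < 1"
  defines "L \<equiv> 2 * artanh r"
  shows "AE \<omega> in M. finite (real_zeros a r \<omega>)"
    and "integrable M (num_real_zeros a r)"
    and "integrable M (\<lambda>\<omega>. (num_real_zeros a r \<omega>)\<^sup>2)"
    and "expectation (num_real_zeros a r) = L / pi"
    and "variance (num_real_zeros a r) = L / pi + 2 / pi\<^sup>2 * var_fun L"
proof -
  define N where "N = num_real_zeros a r"
  define T where "T n = changes (- artanh r) (L / real (Suc n)) n" for n
  have [measurable]: "N \<in> borel_measurable M"
    unfolding N_def using r by (rule measurable_num_real_zeros)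
  have [measurable]: "T n \<in> borel_measurable M" for n
    by (simp add: T_def)
  have N0: "0 \<le> N \<omega>" for \<omega>
    by (simp add: N_def num_real_zeros_def)
  have T0: "0 \<le> T n \<omega>" "T n \<omega> \<le> real (Suc n)" for n \<omega>
    unfolding T_def by (rule changes_bounds)+
  have ae: "AE \<omega> in M. finite (real_zeros a r \<omega>) \<and> (\<forall>n. T n \<omega> \<le> N \<omega>) \<and> (\<lambda>n. T n \<omega>) \<longlonglongrightarrow> N \<omega>"
    unfolding T_def N_def L_def using changes_converge[OF r] by simp
  then show "AE \<omega> in M. finite (real_zeros a r \<omega>)"
    by eventually_elim simp
  have L: "0 < L"
    using r tanh_artanh_real[of r] by (metis L_def abs_of_pos mult_pos_pos tanh_real_pos_iff zero_less_numeral)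
  have lim: "(\<lambda>n. expectation (T n)) \<longlonglongrightarrow> L / pi"
      "(\<lambda>n. expectation (\<lambda>\<omega>. (T n \<omega>)\<^sup>2)) \<longlonglongrightarrow> (L / pi)\<^sup>2 + L / pi + 2 / pi\<^sup>2 * var_fun L"
    unfolding T_def by (rule changes_limits[OF L])+
  have iT2: "integrable M (\<lambda>\<omega>. (T n \<omega>)\<^sup>2)" for n
  proof (rule integrable_bounded_M[where B = "(real (Suc n))\<^sup>2"])
    show "\<bar>(T n \<omega>)\<^sup>2\<bar> \<le> (real (Suc n))\<^sup>2" for \<omega>
      using T0[of n \<omega>] by (simp only: abs_power2) (rule power_mono)
  qed simp
  \<comment> \<open>Fatou's lemma with the convergent second moments of the grid counts.
    Integrability has to come first, for \<open>N\<close> and its square serve as dominating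
    functions afterwards.\<close>
  have N2: "integrable M (\<lambda>\<omega>. (N \<omega>)\<^sup>2)"
  proof (rule integrableI_bounded)
    have "(\<integral>\<^sup>+\<omega>. ennreal (norm ((N \<omega>)\<^sup>2)) \<partial>M) = (\<integral>\<^sup>+\<omega>. liminf (\<lambda>n. ennreal ((T n \<omega>)\<^sup>2)) \<partial>M)"
    proof (rule nn_integral_cong_AE)
      show "AE \<omega> in M. ennreal (norm ((N \<omega>)\<^sup>2)) = liminf (\<lambda>n. ennreal ((T n \<omega>)\<^sup>2))"
        using ae
      proof eventually_elim
        case (elim \<omega>)
        then have "(\<lambda>n. ennreal ((T n \<omega>)\<^sup>2)) \<longlonglongrightarrow> ennreal ((N \<omega>)\<^sup>2)"
          by (intro tendsto_ennrealI tendsto_power) simp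
        from lim_imp_Liminf[OF _ this] show ?case
          by simp
      qed
    qed
    also have "\<dots> \<le> liminf (\<lambda>n. \<integral>\<^sup>+\<omega>. ennreal ((T n \<omega>)\<^sup>2) \<partial>M)"
      by (rule nn_integral_liminf) simp
    also have "(\<lambda>n. \<integral>\<^sup>+\<omega>. ennreal ((T n \<omega>)\<^sup>2) \<partial>M) = (\<lambda>n. ennreal (expectation (\<lambda>\<omega>. (T n \<omega>)\<^sup>2)))"
      by (intro ext nn_integral_eq_integral iT2) simp
    also have "liminf (\<lambda>n. ennreal (expectation (\<lambda>\<omega>. (T n \<omega>)\<^sup>2))) = ennreal ((L / pi)\<^sup>2 + L / pi + 2 / pi\<^sup>2 * var_fun L)"
      by (intro lim_imp_Liminf tendsto_ennrealI lim(2)) simp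
    also have "\<dots> < \<infinity>"
      by simp
    finally show "(\<integral>\<^sup>+\<omega>. ennreal (norm ((N \<omega>)\<^sup>2)) \<partial>M) < \<infinity>" .
  qed simp
  then show "integrable M (\<lambda>\<omega>. (num_real_zeros a r \<omega>)\<^sup>2)"
    by (simp add: N_def)
  have N1: "integrable M N"
    using N2 by (rule square_integrable_imp_integrable[rotated]) simp
  then show "integrable M (num_real_zeros a r)"
    by (simp add: N_def)
  have "(\<lambda>n. expectation (T n)) \<longlonglongrightarrow> expectation N"
  proof (rule integral_dominated_convergence[OF _ _ N1])
    show "AE \<omega> in M. (\<lambda>n. T n \<omega>) \<longlonglongrightarrow> N \<omega>" "\<And>n. AE \<omega> in M. norm (T n \<omega>) \<le> N \<omega>"
      using ae by (eventually_elim, use T0 in simp)+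
  qed simp_all
  with lim(1) have EN: "expectation N = L / pi"
    by (rule LIMSEQ_unique[rotated])
  then show "expectation (num_real_zeros a r) = L / pi"
    by (simp add: N_def)
  have "(\<lambda>n. expectation (\<lambda>\<omega>. (T n \<omega>)\<^sup>2)) \<longlonglongrightarrow> expectation (\<lambda>\<omega>. (N \<omega>)\<^sup>2)"
  proof (rule integral_dominated_convergence[OF _ _ N2])
    show "AE \<omega> in M. (\<lambda>n. (T n \<omega>)\<^sup>2) \<longlonglongrightarrow> (N \<omega>)\<^sup>2"
      using ae by eventually_elim (intro tendsto_power, simp)
    show "AE \<omega> in M. norm ((T n \<omega>)\<^sup>2) \<le> (N \<omega>)\<^sup>2" for n
      using ae by eventually_elim (use T0 in \<open>simp add: power_mono\<close>)
  qed simp_all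
  with lim(2) have EN2: "expectation (\<lambda>\<omega>. (N \<omega>)\<^sup>2) = (L / pi)\<^sup>2 + L / pi + 2 / pi\<^sup>2 * var_fun L"
    by (rule LIMSEQ_unique[rotated])
  have "variance N = expectation (\<lambda>\<omega>. (N \<omega>)\<^sup>2) - (expectation N)\<^sup>2"
    using N1 N2 by (rule variance_eq)
  also have "\<dots> = L / pi + 2 / pi\<^sup>2 * var_fun L"
    unfolding EN EN2 by simp
  finally show "variance (num_real_zeros a r) = L / pi + 2 / pi\<^sup>2 * var_fun L"
    by (simp only: N_def)
qed

end

text \<open>Almost sure finiteness and integrability are part of the claim because
  \<open>card\<close> and the Bochner integral return 0 outside their domain; only with them are the
  two moments the intended ones.\<close>

theorem corollary2p3:
  fixes M :: "'w measure" and a :: "nat \<Rightarrow> 'w \<Rightarrow> real"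
  assumes "prob_space M"
    and "iid_std_gaussian M a"
  shows "(AE \<omega> in M. converges_on_disc a \<omega>) \<and>
    (\<forall>r. 0 < r \<and> r < 1 \<longrightarrow>
       (AE \<omega> in M. finite (real_zeros a r \<omega>)) \<and>
       integrable M (num_real_zeros a r) \<and>
       integrable M (\<lambda>\<omega>. (num_real_zeros a r \<omega>)\<^sup>2) \<and>
       prob_space.expectation M (num_real_zeros a r) = 1 / pi * ln ((1 + r) / (1 - r))) \<and>
    (\<lambda>r. prob_space.variance M (num_real_zeros a r)
          - 2 * (1 - 2 / pi) * prob_space.expectation M (num_real_zeros a r))
      \<in> O[at_left 1](\<lambda>_. 1)"
proof -
  interpret prob_space M by fact
  interpret gaussian_series M a
    by unfold_locales fact
  \<comment> \<open>With L = 2 artanh r the mean is L / pi, and 2 (1 - 2 / pi) L / pi - L / pi = (2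
    / pi^2) (pi / 2 - 2) L.\<close>
  have "prob_space.variance M (num_real_zeros a r) - 2 * (1 - 2 / pi) * prob_space.expectation M (num_real_zeros a r)
      = 2 / pi\<^sup>2 * (var_fun (2 * artanh r) - (pi / 2 - 2) * (2 * artanh r))" if "0 < r" "r < 1" for r
    unfolding num_real_zeros_moments(5)[OF that] unfolding num_real_zeros_moments(4)[OF that] by (simp add: power2_eq_square field_simps)
  moreover have "\<bar>2 / pi\<^sup>2 * (var_fun (2 * artanh r) - (pi / 2 - 2) * (2 * artanh r))\<bar> \<le> 2 / pi\<^sup>2 * (pi\<^sup>2 / 8 + 2 * ln 2)"
    if "0 < r" "r < 1" for r
  proof -
    have "0 \<le> artanh r"
      using that tanh_artanh_real[of r] by (metis abs_of_pos less_imp_le tanh_real_nonneg_iff)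
    then show ?thesis
      unfolding abs_mult using var_fun_asymp[of "2 * artanh r"] by (simp add: mult_left_mono del: times_divide_eq_left)
  qed
  ultimately have "\<bar>prob_space.variance M (num_real_zeros a r) - 2 * (1 - 2 / pi) * prob_space.expectation M (num_real_zeros a r)\<bar>
      \<le> 2 / pi\<^sup>2 * (pi\<^sup>2 / 8 + 2 * ln 2)" if "0 < r" "r < 1" for r
    using that by simp
  \<comment> \<open>The moment formulas hold only for 0 < r < 1, which is eventually the case to the
    left of 1.\<close>
  moreover have "\<forall>\<^sub>F r::real in at_left 1. 0 < r \<and> r < 1"
    using eventually_at_left_real[of 0 "1::real"] by (auto elim: eventually_mono)
  ultimately have "(\<lambda>r. prob_space.variance M (num_real_zeros a r)
          - 2 * (1 - 2 / pi) * prob_space.expectation M (num_real_zeros a r)) \<in> O[at_left 1](\<lambda>_. 1)"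
    by (intro bigoI[where c = "2 / pi\<^sup>2 * (pi\<^sup>2 / 8 + 2 * ln 2)"]) (auto elim!: eventually_mono)
  moreover have "prob_space.expectation M (num_real_zeros a r) = 1 / pi * ln ((1 + r) / (1 - r))" if "0 < r" "r < 1" for r
    using num_real_zeros_moments(4)[OF that] by (simp add: artanh_def)
  ultimately show ?thesis
    using AE_converges num_real_zeros_moments by blast
qed

end
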